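(* Let $N\ge 2$ and $\alpha=(\alpha_1,\dots,\alpha_{N+1})\in(0,\infty)^{N+1}$. Let $\mu^{(N)}_\alpha$ be the Dirichlet distribution on $\Delta^{(N)}$ and $L^{(N)}_\alpha$, $\mathcal E^{(N)}_\alpha$, $P^\alpha_t$ as in the context. Then: (i) $\int_{\Delta^{(N)}} f\,L^{(N)}_\alpha g\,d\mu^{(N)}_\alpha=\int_{\Delta^{(N)}} g\,L^{(N)}_\alpha f\,d\mu^{(N)}_\alpha$ for all $f,g\in C^2(\mathbb R^N)$, so that $P^\alpha_t$ is symmetric in $L^2(\mu^{(N)}_\alpha)$; (ii) the spectral gap of $L^{(N)}_\alpha$ equals $\alpha_{N+1}$, i.e. $$\inf\Big\{\mathcal E^{(N)}_\alpha(f,f):\ f\in\mathcal D(\mathcal E^{(N)}_\alpha),\ \mu^{(N)}_\alpha(f)=0,\ \mu^{(N)}_\alpha(f^2)=1\Big\}=\alpha_{N+1};$$ (iii) consequently $\|P^\alpha_t-\mu^{(N)}_\alpha\|_{L^2(\mu^{(N)}_\alpha)}\le e^{-\alpha_{N+1}t}$ for all $t\ge0$, where $\mu^{(N)}_\alpha$ denotes the operator $f\mapsto\mu^{(N)}_\alpha(f)$ and the norm is the operator norm on $L^2(\mu^{(N)}_\alpha)$; (iv) the Poincaré inequality $$\mu^{(N)}_\alpha(f^2)\le\frac1{\alpha_{N+1}}\mathcal E^{(N)}_\alpha(f,f),\qquad f\in\mathcal D(\mathcal E^{(N)}_\alpha),\ \mu^{(N)}_\alpha(f)=0$$ holds, and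 the constant $1/\alpha_{N+1}$ is sharp.
   Context: $\Delta^{(N)}=\{x\in[0,1]^N:\ |x|_1:=\sum_{i=1}^N x_i\le1\}$. For $\alpha\in(0,\infty)^{N+1}$ the Dirichlet distribution $\mu^{(N)}_\alpha$ is the probability measure on $\Delta^{(N)}$ with density $$\rho(x)=\frac{\Gamma(|\alpha|_1)}{\prod_{i=1}^{N+1}\Gamma(\alpha_i)}(1-|x|_1)^{\alpha_{N+1}-1}\prod_{i=1}^N x_i^{\alpha_i-1},\qquad |\alpha|_1=\sum_{i=1}^{N+1}\alpha_i.$$ The operator is $L^{(N)}_\alpha=\sum_{n=1}^N\big(x_n(1-|x|_1)\partial_n^2+\{\alpha_n(1-|x|_1)-\alpha_{N+1}x_n\}\partial_n\big)$, $\partial_n=\partial/\partial x_n$; it is the generator of the diffusion solving $dX_i=\{\alpha_i(1-|X|_1)-\alpha_{N+1}X_i\}dt+\sqrt{2(1-|X|_1)X_i}\,dB_i$, $1\le i\le N$, on $\Delta^{(N)}$, whose Markov semigroup is $P^\alpha_t$. The form $\mathcal E^{(N)}_\alpha(f,g)=\int_{\Delta^{(N)}}(1-|x|_1)\sum_{n=1}^N x_n\,\partial_nf\,\partial_ng\;d\mu^{(N)}_\alpha$ on $C^2(\Delta^{(N)})$ is closable in $L^2(\mu^{(N)}_\alpha)$; $(\mathcal E^{(N)}_\alpha,\mathcal D(\mathcal E^{(N)}_\alpha))$ denotes its closure, a symmetric Dirichlet form whose associated semigroup is $P^\alpha_t$, and $L^{(N)}_\alpha$ also denotes the self-adjoint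 closure of $(L^{(N)}_\alpha,C^2(\Delta^{(N)}))$. *)

theory Defs
  imports "HOL-Analysis.Analysis"
begin

text \<open>Points of R^N are vectors x :: real^'n (N = CARD('n)).  The Dirichlet parameter
 alpha = (alpha_1,...,alpha_{N+1}) is split as al :: real^'n (first N entries) and
 a :: real (the entry alpha_{N+1}).\<close>

definition l1 :: "real^'n \<Rightarrow> real" where
  "l1 x = (\<Sum>i\<in>UNIV. x $ i)"

definition dsimplex :: "(real^'n) set" where
  "dsimplex = {x. (\<forall>i. 0 \<le> x $ i) \<and> l1 x \<le> 1}"

definition dir_density :: "real^'n \<Rightarrow> real \<Rightarrow> real^'n \<Rightarrow> real" where
  "dir_density al a x =
     indicator dsimplex x *
     (Gamma (l1 al + a) / ((\<Prod>i\<in>UNIV. Gamma (al $ i)) * Gamma a)) *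
     ((1 - l1 x) powr (a - 1)) * (\<Prod>i\<in>UNIV. (x $ i) powr (al $ i - 1))"

definition dirichlet :: "real^'n \<Rightarrow> real \<Rightarrow> (real^'n) measure" where
  "dirichlet al a = density lborel (\<lambda>x. ennreal (dir_density al a x))"

definition pd :: "'n \<Rightarrow> (real^'n \<Rightarrow> real) \<Rightarrow> real^'n \<Rightarrow> real" where
  "pd i f x = deriv (\<lambda>t. f (x + t *\<^sub>R axis i 1)) 0"

definition C2 :: "(real^'n \<Rightarrow> real) \<Rightarrow> bool" where
  "C2 f \<longleftrightarrow>
     (\<forall>i x. (\<lambda>t. f (x + t *\<^sub>R axis i 1)) differentiable (at 0)) \<and>
     (\<forall>i j x. (\<lambda>t. pd i f (x + t *\<^sub>R axis j 1)) differentiable (at 0)) \<and>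
     (\<forall>i j. continuous_on UNIV (pd j (pd i f)))"

definition Lop :: "real^'n \<Rightarrow> real \<Rightarrow> (real^'n \<Rightarrow> real) \<Rightarrow> real^'n \<Rightarrow> real" where
  "Lop al a f x = (\<Sum>i\<in>UNIV.
      x $ i * (1 - l1 x) * pd i (pd i f) x
      + (al $ i * (1 - l1 x) - a * x $ i) * pd i f x)"

definition E0 :: "real^'n \<Rightarrow> real \<Rightarrow> (real^'n \<Rightarrow> real) \<Rightarrow> (real^'n \<Rightarrow> real) \<Rightarrow> real" where
  "E0 al a f g = (\<integral>x. (1 - l1 x) * (\<Sum>i\<in>UNIV. x $ i * pd i f x * pd i g x) \<partial>dirichlet al a)"

definition L2 :: "real^'n \<Rightarrow> real \<Rightarrow> (real^'n \<Rightarrow> real) \<Rightarrow> bool" where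
  "L2 al a f \<longleftrightarrow> f \<in> borel_measurable borel \<and> integrable (dirichlet al a) (\<lambda>x. (f x)\<^sup>2)"

definition L2norm :: "real^'n \<Rightarrow> real \<Rightarrow> (real^'n \<Rightarrow> real) \<Rightarrow> real" where
  "L2norm al a f = sqrt (\<integral>x. (f x)\<^sup>2 \<partial>dirichlet al a)"

definition approx_seq :: "real^'n \<Rightarrow> real \<Rightarrow> (real^'n \<Rightarrow> real) \<Rightarrow> (nat \<Rightarrow> real^'n \<Rightarrow> real) \<Rightarrow> bool" where
  "approx_seq al a f s \<longleftrightarrow>
     (\<forall>n. C2 (s n)) \<and>
     (\<lambda>n. L2norm al a (\<lambda>x. s n x - f x)) \<longlonglongrightarrow> 0 \<and>
     (\<forall>e>0. \<exists>M. \<forall>m\<ge>M. \<forall>n\<ge>M. E0 al a (\<lambda>x. s n x - s m x) (\<lambda>x. s n x - s m x) < e)"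

definition domE :: "real^'n \<Rightarrow> real \<Rightarrow> (real^'n \<Rightarrow> real) \<Rightarrow> bool" where
  "domE al a f \<longleftrightarrow> L2 al a f \<and> (\<exists>s. approx_seq al a f s)"

text \<open>The closed form (value via approximating sequences; well defined by closability).\<close>
definition energy :: "real^'n \<Rightarrow> real \<Rightarrow> (real^'n \<Rightarrow> real) \<Rightarrow> (real^'n \<Rightarrow> real) \<Rightarrow> real" where
  "energy al a f g =
     lim (\<lambda>n. E0 al a ((SOME s. approx_seq al a f s) n) ((SOME s. approx_seq al a g s) n))"

definition form_generator :: "real^'n \<Rightarrow> real \<Rightarrow> (real^'n \<Rightarrow> real) \<Rightarrow> (real^'n \<Rightarrow> real) \<Rightarrow> bool" where
  "form_generator al a f h \<longleftrightarrow> domE al a f \<and> L2 al a h \<and>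
     (\<forall>g. domE al a g \<longrightarrow> energy al a f g = - (\<integral>x. h x * g x \<partial>dirichlet al a))"

text \<open>P is the (strongly continuous) semigroup on L^2(mu) associated with the closed form,
 i.e. a C_0 semigroup of bounded linear operators whose generator is the operator of the form
 (this determines P uniquely up to a.e. equality).\<close>
definition form_semigroup :: "real^'n \<Rightarrow> real \<Rightarrow> (real \<Rightarrow> (real^'n \<Rightarrow> real) \<Rightarrow> real^'n \<Rightarrow> real) \<Rightarrow> bool" where
  "form_semigroup al a P \<longleftrightarrow>
     (\<forall>t\<ge>0. \<forall>f. L2 al a f \<longrightarrow> L2 al a (P t f)) \<and>
     (\<forall>t\<ge>0. \<forall>f g c. L2 al a f \<longrightarrow> L2 al a g \<longrightarrow>
        (AE x in dirichlet al a. P t (\<lambda>y. c * f y + g y) x = c * P t f x + P t g x)) \<and>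
     (\<forall>t\<ge>0. \<exists>C. \<forall>f. L2 al a f \<longrightarrow> L2norm al a (P t f) \<le> C * L2norm al a f) \<and>
     (\<forall>f. L2 al a f \<longrightarrow> (AE x in dirichlet al a. P 0 f x = f x)) \<and>
     (\<forall>s\<ge>0. \<forall>t\<ge>0. \<forall>f. L2 al a f \<longrightarrow>
        (AE x in dirichlet al a. P (s + t) f x = P t (P s f) x)) \<and>
     (\<forall>f. L2 al a f \<longrightarrow>
        ((\<lambda>t. L2norm al a (\<lambda>x. P t f x - f x)) \<longlongrightarrow> 0) (at_right 0)) \<and>
     (\<forall>f h. L2 al a f \<longrightarrow> L2 al a h \<longrightarrow>
        (((\<lambda>t. L2norm al a (\<lambda>x. (P t f x - f x) / t - h x)) \<longlongrightarrow> 0) (at_right 0)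
          \<longleftrightarrow> form_generator al a f h))"

end

(*
  Write L_a for the operator with parameter a = alpha_{N+1} and A for the sum of the other alpha_i.
  Then L_a = (1 - |x|) D - a E with D = sum_i (x_i d_i^2 + alpha_i d_i) and the Euler field
  E = sum_i x_i d_i, and D L_a = (L_{a+2} - (A + a)) D.  Hence a polynomial eigenfunction phi with
  -L_a phi = lam phi either satisfies D phi <> 0, and then D phi is an eigenfunction of -L_{a+2} with
  eigenvalue lam - A - a >= 0, or it satisfies a E phi = lam phi, so it is homogeneous of degree lam / a.
  In both cases lam = 0 or lam >= a.  Since L_a preserves the polynomials of degree at most k and is
  symmetric, the form splits along the orthogonal projection onto them; as polynomials are dense in L2,
  the bound a on their nonzero eigenvalues is the Poincare inequality for all C2 functions.  Equality
  holds for x_i / alpha_i - x_j / alpha_j.  C2 functions lie in the domain of the generator, which is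
  enough to differentiate |P_t f|^2 once the semigroup is known to be locally bounded
  (uniform boundedness principle).
*)

theory Submission
  imports Defs
begin

section \<open>Square-integrable functions\<close>

text \<open>The hypotheses on the semigroup are weak: each \<open>P t\<close> has some bound of its
  own, continuity is from the right at 0, and neither contractivity nor symmetry is assumed.
  Symmetry and decay are derived from properties of the generator, with right-sided increments,
  uniform in time, in place of derivatives. Compactness of the resolvent is avoided: on polynomials
  of bounded degree the Rayleigh quotient attains its minimum because the unit sphere of
  coefficients is compact, and the minimiser is an eigenfunction because the space is invariant. The
  inequality lam - A - a >= 0 is the nonnegativity of -L_{a+2} in another L2 space, that of the
  Dirichlet distribution with last parameter a + 2; this is why the parameters of the distribution
  must be allowed to vary in the argument.\<close>

definition sqint :: "'a measure \<Rightarrow> ('a \<Rightarrow> real) \<Rightarrow> bool" where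
  "sqint M f \<longleftrightarrow> f \<in> borel_measurable M \<and> integrable M (\<lambda>x. (f x)\<^sup>2)"

text \<open>A function that is not square integrable gets norm 0, the default value of its Bochner
  integral; hence the recurring assumption \<open>sqint\<close>. Functions are not identified up to
  null sets, so this is a seminorm.\<close>

definition nrm2 :: "'a measure \<Rightarrow> ('a \<Rightarrow> real) \<Rightarrow> real" where
  "nrm2 M f = sqrt (\<integral>x. (f x)\<^sup>2 \<partial>M)"

lemma sqint_measurable [measurable_dest]: "sqint M f \<Longrightarrow> f \<in> borel_measurable M"
  by (simp add: sqint_def)

lemma sqint_mult:
  assumes "sqint M f" "sqint M g"
  shows "integrable M (\<lambda>x. f x * g x)"
proof (rule Bochner_Integration.integrable_bound)
  show "integrable M (\<lambda>x. (f x)\<^sup>2 + (g x)\<^sup>2)"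
    using assms by (auto simp: sqint_def)
  show "(\<lambda>x. f x * g x) \<in> borel_measurable M"
    using assms by (auto simp: sqint_def)
  have "\<bar>u * v\<bar> \<le> u\<^sup>2 + v\<^sup>2" for u v :: real
  proof -
    have "0 \<le> (\<bar>u\<bar> - \<bar>v\<bar>)\<^sup>2" by simp
    then have "2 * (\<bar>u\<bar> * \<bar>v\<bar>) \<le> u\<^sup>2 + v\<^sup>2" by (simp add: power2_diff mult.assoc)
    moreover have "0 \<le> \<bar>u\<bar> * \<bar>v\<bar>" by simp
    ultimately show ?thesis unfolding abs_mult by linarith
  qed
  then show "AE x in M. norm (f x * g x) \<le> norm ((f x)\<^sup>2 + (g x)\<^sup>2)" by auto
qed

lemma sqint_cmult: "sqint M f \<Longrightarrow> sqint M (\<lambda>x. c * f x)"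
  by (auto simp: sqint_def power_mult_distrib)

lemma sqint_divide: "sqint M f \<Longrightarrow> sqint M (\<lambda>x. f x / c)"
  by (auto simp: sqint_def power_divide)

lemma sqint_add:
  assumes "sqint M f" "sqint M g"
  shows "sqint M (\<lambda>x. f x + g x)"
  using sqint_mult[OF assms] assms by (auto simp: sqint_def power2_sum mult.assoc)

lemma sqint_minus: "sqint M f \<Longrightarrow> sqint M (\<lambda>x. - f x)"
  by (auto simp: sqint_def)

lemma sqint_diff: "sqint M f \<Longrightarrow> sqint M g \<Longrightarrow> sqint M (\<lambda>x. f x - g x)"
  using sqint_add[of M f "\<lambda>x. - g x"] sqint_minus[of M g] by simp

lemma sqint_zero: "sqint M (\<lambda>x. 0)"
  by (simp add: sqint_def)

lemma sqint_sum: "(\<And>i. i \<in> I \<Longrightarrow> sqint M (f i)) \<Longrightarrow> sqint M (\<lambda>x. \<Sum>i\<in>I. f i x)"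
  by (induction I rule: infinite_finite_induct) (auto intro: sqint_add sqint_zero)

lemma nrm2_nonneg [simp]: "0 \<le> nrm2 M f"
  by (simp add: nrm2_def)

lemma nrm2_sq: "(nrm2 M f)\<^sup>2 = (\<integral>x. (f x)\<^sup>2 \<partial>M)"
  by (simp add: nrm2_def)

lemma nrm2_cmult: "nrm2 M (\<lambda>x. c * f x) = \<bar>c\<bar> * nrm2 M f"
  by (simp add: nrm2_def power_mult_distrib real_sqrt_mult)

lemma nrm2_commute: "nrm2 M (\<lambda>x. f x - g x) = nrm2 M (\<lambda>x. g x - f x)"
  by (simp add: nrm2_def power2_commute)

lemma nrm2_cong_AE:
  assumes "sqint M f" "sqint M g" "AE x in M. f x = g x"
  shows "nrm2 M f = nrm2 M g"
proof -
  have "(\<integral>x. (f x)\<^sup>2 \<partial>M) = (\<integral>x. (g x)\<^sup>2 \<partial>M)"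
    using assms by (intro integral_cong_AE) (auto simp: sqint_def)
  then show ?thesis by (simp add: nrm2_def)
qed

lemma nrm2_eq_0_iff:
  assumes "sqint M f"
  shows "nrm2 M f = 0 \<longleftrightarrow> (AE x in M. f x = 0)"
  using integral_nonneg_eq_0_iff_AE[of M "\<lambda>x. (f x)\<^sup>2"] assms by (auto simp: nrm2_def sqint_def)

text \<open>If \<open>C < 0\<close>, large \<open>t\<close> contradict the hypothesis; if
  \<open>C = 0\<close>, then \<open>B = 0\<close>; otherwise \<open>t = - B / C\<close> is the
  minimum. With \<open>A = 0\<close> the conclusion is \<open>B = 0\<close>, the vanishing of a
  first variation.\<close>

lemma discriminant_bound:
  fixes A B C :: real
  assumes "\<And>t. 0 \<le> A + 2 * t * B + t\<^sup>2 * C"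
  shows "B\<^sup>2 \<le> A * C"
proof (cases "C = 0")
  case True
  have "B = 0"
  proof (rule ccontr)
    assume "B \<noteq> 0"
    \<comment> \<open>This \<open>t\<close> makes the affine function equal to -1.\<close>
    with assms[of "- (A + 1) / (2 * B)"] True show False by (simp add: field_simps)
  qed
  with True show ?thesis by simp
next
  case False
  have C: "0 < C"
  proof (rule ccontr)
    assume "\<not> 0 < C"
    with False have neg: "C < 0" by simp
    \<comment> \<open>Large enough that \<open>t * \<bar>C\<bar>\<close> beats the other
      coefficients; \<open>1 \<le> t\<close> allows the constant term to be multiplied by
      \<open>t\<close> as well.\<close>
    define t where "t = (\<bar>A\<bar> + 2 * \<bar>B\<bar> + 1) / \<bar>C\<bar> + 1"
    have t: "1 \<le> t" "t * \<bar>C\<bar> = \<bar>A\<bar> + 2 * \<bar>B\<bar> + 1 + \<bar>C\<bar>"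
      using neg by (auto simp: t_def field_simps)
    have "t\<^sup>2 * C = - t * (t * \<bar>C\<bar>)"
      using neg by (simp add: power2_eq_square)
    then have "t\<^sup>2 * C = - t * (\<bar>A\<bar> + 2 * \<bar>B\<bar> + 1 + \<bar>C\<bar>)"
      unfolding t(2) .
    moreover have "A \<le> t * \<bar>A\<bar>" using t mult_right_mono[of 1 t "\<bar>A\<bar>"] by (simp add: abs_le_iff)
    moreover have "2 * t * B \<le> t * (2 * \<bar>B\<bar>)" using t by (simp add: mult_left_mono)
    ultimately have "A + 2 * t * B + t\<^sup>2 * C \<le> - t * (1 + \<bar>C\<bar>)"
      by (simp add: algebra_simps)
    also have "\<dots> < 0" using t by (simp add: mult_neg_pos)
    finally show False using assms[of t] by simp
  qed
  have "0 \<le> A + 2 * (- B / C) * B + (- B / C)\<^sup>2 * C" by (rule assms)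
  also have "\<dots> = A - B\<^sup>2 / C" using C by (simp add: power2_eq_square field_simps)
  finally show ?thesis using C by (simp add: field_simps)
qed

lemma cauchy_schwarz_L2:
  assumes f: "sqint M f" and g: "sqint M g"
  shows "\<bar>\<integral>x. f x * g x \<partial>M\<bar> \<le> nrm2 M f * nrm2 M g"
proof -
  note [simp] = sqint_mult[OF f g]
  have "integrable M (\<lambda>x. (f x)\<^sup>2)" "integrable M (\<lambda>x. (g x)\<^sup>2)"
    using f g by (auto simp: sqint_def)
  note [simp] = this
  have "(\<integral>x. f x * g x \<partial>M)\<^sup>2 \<le> (\<integral>x. (f x)\<^sup>2 \<partial>M) * (\<integral>x. (g x)\<^sup>2 \<partial>M)"
  proof (rule discriminant_bound)
    fix t
    have "(\<integral>x. (f x)\<^sup>2 \<partial>M) + 2 * t * (\<integral>x. f x * g x \<partial>M) + t\<^sup>2 * (\<integral>x. (g x)\<^sup>2 \<partial>M)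
        = (\<integral>x. (f x)\<^sup>2 + 2 * t * (f x * g x) + t\<^sup>2 * (g x)\<^sup>2 \<partial>M)"
      by simp
    also have "\<dots> = (\<integral>x. (f x + t * g x)\<^sup>2 \<partial>M)"
      by (intro Bochner_Integration.integral_cong) (auto simp: power2_sum power_mult_distrib)
    also have "\<dots> \<ge> 0" by simp
    finally show "0 \<le> (\<integral>x. (f x)\<^sup>2 \<partial>M) + 2 * t * (\<integral>x. f x * g x \<partial>M) + t\<^sup>2 * (\<integral>x. (g x)\<^sup>2 \<partial>M)" .
  qed
  then have "\<bar>\<integral>x. f x * g x \<partial>M\<bar> \<le> sqrt ((\<integral>x. (f x)\<^sup>2 \<partial>M) * (\<integral>x. (g x)\<^sup>2 \<partial>M))"
    using real_le_rsqrt by (metis real_sqrt_abs real_sqrt_le_mono)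
  then show ?thesis by (simp add: nrm2_def real_sqrt_mult)
qed

lemma nrm2_sq_add:
  assumes f: "sqint M f" and g: "sqint M g"
  shows "(nrm2 M (\<lambda>x. f x + g x))\<^sup>2 = (nrm2 M f)\<^sup>2 + 2 * (\<integral>x. f x * g x \<partial>M) + (nrm2 M g)\<^sup>2"
proof -
  have "integrable M (\<lambda>x. (f x)\<^sup>2)" "integrable M (\<lambda>x. (g x)\<^sup>2)"
    using f g by (auto simp: sqint_def)
  with sqint_mult[OF f g] show ?thesis
    by (simp add: nrm2_sq power2_sum mult.assoc)
qed

lemma nrm2_triangle:
  assumes f: "sqint M f" and g: "sqint M g"
  shows "nrm2 M (\<lambda>x. f x + g x) \<le> nrm2 M f + nrm2 M g"
proof (rule power2_le_imp_le)
  show "(nrm2 M (\<lambda>x. f x + g x))\<^sup>2 \<le> (nrm2 M f + nrm2 M g)\<^sup>2"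
    using cauchy_schwarz_L2[OF f g] by (simp add: nrm2_sq_add[OF f g] power2_sum)
qed auto

lemma nrm2_triangle_diff:
  assumes f: "sqint M f" and g: "sqint M g" and h: "sqint M h"
  shows "nrm2 M (\<lambda>x. f x - h x) \<le> nrm2 M (\<lambda>x. f x - g x) + nrm2 M (\<lambda>x. g x - h x)"
  using nrm2_triangle[OF sqint_diff[OF f g] sqint_diff[OF g h]] by simp

lemma nrm2_triangle_rev:
  assumes f: "sqint M f" and g: "sqint M g"
  shows "\<bar>nrm2 M f - nrm2 M g\<bar> \<le> nrm2 M (\<lambda>x. f x - g x)"
  using nrm2_triangle[OF sqint_diff[OF f g] g] nrm2_triangle[OF sqint_diff[OF g f] f]
  by (simp add: nrm2_commute[of M f g])

text \<open>The Riesz-Fischer argument. The sums \<open>S\<close> of absolute increments are bounded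
  in norm by the tails \<open>T\<close>, so by monotone convergence their supremum is finite a.e.
  and the increments are summable there. The same kind of supremum, started at index
  \<open>m\<close>, dominates the limit minus \<open>f m\<close>, which gives the rate.\<close>

lemma L2_complete:
  assumes f: "\<And>n. sqint M (f n)"
    and s: "summable (\<lambda>n. nrm2 M (\<lambda>x. f (Suc n) x - f n x))"
  obtains g where "sqint M g"
    "\<And>n. nrm2 M (\<lambda>x. g x - f n x) \<le> (\<Sum>k. nrm2 M (\<lambda>x. f (Suc (k + n)) x - f (k + n) x))"
proof -
  define d where "d n x = f (Suc n) x - f n x" for n x
  have d: "sqint M (d n)" for n unfolding d_def by (intro sqint_diff f)
  have [measurable]: "f n \<in> borel_measurable M" "d n \<in> borel_measurable M" for n
    using f d by (auto simp: sqint_def)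
  define S where "S m n x = (\<Sum>k<n. \<bar>d (k + m) x\<bar>)" for m n x
  have [measurable]: "S m n \<in> borel_measurable M" for m n unfolding S_def by measurable
  define T where "T m = (\<Sum>k. nrm2 M (d (k + m)))" for m
  have sm: "summable (\<lambda>k. nrm2 M (d (k + m)))" for m
    using s summable_iff_shift[of "\<lambda>n. nrm2 M (d n)" m] by (simp add: d_def[abs_def])
  have T0: "0 \<le> T m" for m unfolding T_def by (intro suminf_nonneg sm) simp
  have dabs: "sqint M (\<lambda>x. \<bar>d n x\<bar>)" for n using d by (auto simp: sqint_def)
  have Ssq: "sqint M (S m n)" for m n unfolding S_def by (intro sqint_sum dabs)
  have SnT: "nrm2 M (S m n) \<le> T m" for m n
  proof -
    have "nrm2 M (S m n) \<le> (\<Sum>k<n. nrm2 M (d (k + m)))"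
    proof (induction n)
      case 0 show ?case by (simp add: S_def nrm2_def)
    next
      case (Suc n)
      have "nrm2 M (S m (Suc n)) \<le> nrm2 M (S m n) + nrm2 M (\<lambda>x. \<bar>d (n + m) x\<bar>)"
        using nrm2_triangle[OF Ssq dabs, of m n "n + m"] by (simp add: S_def[abs_def])
      then show ?case using Suc by (simp add: nrm2_def)
    qed
    also have "\<dots> \<le> T m" unfolding T_def by (intro sum_le_suminf sm) auto
    finally show ?thesis .
  qed
  have nnS: "(\<integral>\<^sup>+x. ennreal ((S m n x)\<^sup>2) \<partial>M) \<le> ennreal ((T m)\<^sup>2)" for m n
  proof -
    have "(\<integral>\<^sup>+x. ennreal ((S m n x)\<^sup>2) \<partial>M) = ennreal (\<integral>x. (S m n x)\<^sup>2 \<partial>M)"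
      using Ssq[of m n] by (intro nn_integral_eq_integral) (auto simp: sqint_def)
    also have "\<dots> \<le> ennreal ((T m)\<^sup>2)"
      using SnT[of m n] by (intro ennreal_leI) (simp add: nrm2_sq[symmetric] power_mono)
    finally show ?thesis .
  qed
  have Smono: "S m n x \<le> S m (Suc n) x" and S0: "0 \<le> S m n x" for m n x
    by (auto simp: S_def sum_nonneg)
  have sup: "(\<integral>\<^sup>+x. (SUP n. ennreal ((S m n x)\<^sup>2)) \<partial>M) \<le> ennreal ((T m)\<^sup>2)" for m
  proof -
    have "(\<integral>\<^sup>+x. (SUP n. ennreal ((S m n x)\<^sup>2)) \<partial>M) = (SUP n. \<integral>\<^sup>+x. ennreal ((S m n x)\<^sup>2) \<partial>M)"
      by (rule nn_integral_monotone_convergence_SUP)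
        (auto simp: incseq_Suc_iff le_fun_def intro!: ennreal_leI power_mono Smono S0)
    also have "\<dots> \<le> ennreal ((T m)\<^sup>2)" by (intro SUP_least nnS)
    finally show ?thesis .
  qed
  have "AE x in M. (SUP n. ennreal ((S 0 n x)\<^sup>2)) \<noteq> \<infinity>"
    using sup[of 0] by (intro nn_integral_noteq_infinite) (auto simp: top_unique)
  then have fin: "AE x in M. summable (\<lambda>k. d k x)"
  proof (eventually_elim)
    case (elim x)
    then obtain B where B: "(SUP n. ennreal ((S 0 n x)\<^sup>2)) = ennreal B" "0 \<le> B"
      by (metis enn2real_nonneg ennreal_enn2real_if infinity_ennreal_def)
    have "(S 0 n x)\<^sup>2 \<le> B" for n
      using SUP_upper[of n UNIV "\<lambda>n. ennreal ((S 0 n x)\<^sup>2)"] B by (simp add: ennreal_le_iff)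
    then have "S 0 n x \<le> sqrt B" for n by (simp add: real_le_rsqrt)
    then have "summable (\<lambda>k. \<bar>d k x\<bar>)"
      by (intro summableI_nonneg_bounded[of _ "sqrt B"]) (auto simp: S_def)
    then show ?case by (rule summable_rabs_cancel)
  qed
  \<comment> \<open>On the exceptional null set the series has an unspecified value, yet
    \<open>g\<close> is measurable everywhere.\<close>
  define g where "g x = f 0 x + (\<Sum>k. d k x)" for x
  have gm [measurable]: "g \<in> borel_measurable M" unfolding g_def by measurable
  have tel: "f 0 x + (\<Sum>k<n. d k x) = f n x" for n x
    by (induction n) (auto simp: d_def)
  have lim: "AE x in M. (\<lambda>n. f n x) \<longlonglongrightarrow> g x"
    using fin
  proof eventually_elim
    case (elim x)
    from summable_LIMSEQ[OF this] have "(\<lambda>n. f 0 x + (\<Sum>k<n. d k x)) \<longlonglongrightarrow> g x"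
      unfolding g_def by (intro tendsto_intros)
    then show ?case by (simp add: tel)
  qed
  have bound: "(\<integral>\<^sup>+x. ennreal ((g x - f m x)\<^sup>2) \<partial>M) \<le> ennreal ((T m)\<^sup>2)" for m
  proof -
    have "AE x in M. ennreal ((g x - f m x)\<^sup>2) \<le> (SUP n. ennreal ((S m n x)\<^sup>2))"
      using lim
    proof eventually_elim
      case (elim x)
      have tel2: "f (n + m) x - f m x = (\<Sum>k<n. d (k + m) x)" for n
        by (induction n) (auto simp: d_def)
      have "(\<lambda>n. ennreal ((f (n + m) x - f m x)\<^sup>2)) \<longlonglongrightarrow> ennreal ((g x - f m x)\<^sup>2)"
        using LIMSEQ_ignore_initial_segment[OF elim, of m] by (intro tendsto_intros) auto
      then show ?case
      proof (rule LIMSEQ_le_const2, intro exI allI impI)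
        fix n
        have "\<bar>f (n + m) x - f m x\<bar> \<le> S m n x" unfolding tel2 S_def by (rule sum_abs)
        then have "(f (n + m) x - f m x)\<^sup>2 \<le> (S m n x)\<^sup>2" using S0[of m n x]
          by (simp add: abs_le_square_iff[symmetric])
        then show "ennreal ((f (n + m) x - f m x)\<^sup>2) \<le> (SUP n. ennreal ((S m n x)\<^sup>2))"
          by (intro SUP_upper2[of n] ennreal_leI) auto
      qed
    qed
    from nn_integral_mono_AE[OF this] sup[of m] show ?thesis by (rule order_trans)
  qed
  have int: "integrable M (\<lambda>x. (g x - f m x)\<^sup>2)" for m
    using bound[of m] by (intro integrableI_nonneg) (auto simp: less_top[symmetric] top_unique)
  have sq: "sqint M (\<lambda>x. g x - f m x)" for m using int by (simp add: sqint_def)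
  have gs: "sqint M g" using sqint_add[OF sq f, of 0 0] by simp
  have "nrm2 M (\<lambda>x. g x - f m x) \<le> T m" for m
  proof -
    have "ennreal (\<integral>x. (g x - f m x)\<^sup>2 \<partial>M) \<le> ennreal ((T m)\<^sup>2)"
      using bound[of m] int[of m] by (simp add: nn_integral_eq_integral)
    then have "(\<integral>x. (g x - f m x)\<^sup>2 \<partial>M) \<le> (T m)\<^sup>2" by (simp add: ennreal_le_iff)
    then show ?thesis using T0[of m] by (auto simp: nrm2_def intro: real_le_lsqrt)
  qed
  with gs that show ?thesis unfolding T_def d_def by blast
qed

text \<open>The gliding hump: since \<open>2 p f \<le> p (x + f) + p (x - f)\<close>, the sign of each increment can be
  chosen so that the partial sum is large for the current seminorm.\<close>

lemma uniform_boundedness_L2: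
  assumes p_nonneg: "\<And>n f. 0 \<le> p n f"
    and p_add: "\<And>n f g. sqint M f \<Longrightarrow> sqint M g \<Longrightarrow> p n (\<lambda>x. f x + g x) \<le> p n f + p n g"
    and p_cmult: "\<And>n f c. sqint M f \<Longrightarrow> p n (\<lambda>x. c * f x) = \<bar>c\<bar> * p n f"
    and p_bdd: "\<And>n. \<exists>C. \<forall>f. sqint M f \<longrightarrow> p n f \<le> C * nrm2 M f"
    and pointwise: "\<And>f. sqint M f \<Longrightarrow> \<exists>K. \<forall>n::nat. p n f \<le> K"
  shows "\<exists>K. \<forall>n f. sqint M f \<longrightarrow> p n f \<le> K * nrm2 M f"
proof (rule ccontr)
  assume unbounded: "\<not> ?thesis"
  \<comment> \<open>\<open>N n\<close>, the infimum of the admissible constants, is the operator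
    norm of \<open>p n\<close>; the claim is that these norms are bounded.\<close>
  define B where "B n = {C. 0 \<le> C \<and> (\<forall>f. sqint M f \<longrightarrow> p n f \<le> C * nrm2 M f)}" for n
  define N where "N n = Inf (B n)" for n
  have bne: "B n \<noteq> {}" for n
  proof -
    obtain C where "\<And>f. sqint M f \<Longrightarrow> p n f \<le> C * nrm2 M f" using p_bdd by blast
    then have "\<bar>C\<bar> \<in> B n"
      unfolding B_def by (auto, meson abs_ge_self mult_right_mono nrm2_nonneg order_trans)
    then show ?thesis by blast
  qed
  have bb: "bdd_below (B n)" for n by (auto simp: B_def bdd_below_def)
  have N0: "0 \<le> N n" for n unfolding N_def using bne by (intro cInf_greatest) (auto simp: B_def)
  have pN: "p n f \<le> N n * nrm2 M f" if f: "sqint M f" for n f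
  proof (cases "nrm2 M f = 0")
    case True
    then show ?thesis using bne[of n] f by (auto simp: B_def)
  next
    case False
    then have pos: "0 < nrm2 M f" by (simp add: less_le)
    have "p n f / nrm2 M f \<le> N n"
      unfolding N_def using bne f pos by (intro cInf_greatest) (auto simp: B_def divide_simps)
    with pos show ?thesis by (simp add: divide_simps)
  qed
  \<comment> \<open>A constant below \<open>N n\<close> is not admissible, so some \<open>f\<close>
    violates it, and a multiple of \<open>f\<close> has the prescribed norm \<open>r\<close>. The
    factor 2 / 3 has to exceed the share 1 / 2 that the later humps can take away.\<close>
  have near: "\<exists>f. sqint M f \<and> nrm2 M f = r \<and> 2 / 3 * N n * r \<le> p n f" if N: "0 < N n" and r: "0 < r" for n r
  proof -
    have "2 / 3 * N n \<notin> B n"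
    proof
      assume "2 / 3 * N n \<in> B n"
      then have "N n \<le> 2 / 3 * N n" unfolding N_def by (intro cInf_lower bb)
      with N show False by simp
    qed
    then obtain f where f: "sqint M f" "2 / 3 * N n * nrm2 M f < p n f"
      using N by (auto simp: B_def not_le)
    have pos: "0 < nrm2 M f"
      using f pN[of f n] by (cases "nrm2 M f = 0") (auto simp: less_le)
    define g where "g x = r / nrm2 M f * f x" for x
    have "sqint M g" unfolding g_def by (intro sqint_cmult f)
    moreover have "nrm2 M g = r" using r pos unfolding g_def nrm2_cmult by simp
    moreover have pg: "p n g = r / nrm2 M f * p n f" unfolding g_def p_cmult[OF f(1)] using r pos by simp
    have "r / nrm2 M f * (2 / 3 * N n * nrm2 M f) \<le> r / nrm2 M f * p n f"
      using f(2) pos r by (intro mult_left_mono) auto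
    then have "2 / 3 * N n * r \<le> p n g" unfolding pg using pos by (simp add: mult.commute)
    ultimately show ?thesis by blast
  qed
  have big: "\<exists>n. K < N n" for K
  proof (rule ccontr)
    assume "\<nexists>n. K < N n"
    then have "N n \<le> K" for n by (simp add: not_less)
    then have "p n f \<le> K * nrm2 M f" if "sqint M f" for n f
      using pN[OF that, of n] by (meson mult_right_mono nrm2_nonneg order_trans)
    with unbounded show False by blast
  qed
  \<comment> \<open>Hump \<open>k\<close> yields at least 2 / 3 of
    \<open>N (\<nu> k) * (1 / 3) ^ k\<close>, and the later ones cost at most 1 / 2 of it. The
    remaining sixth has to exceed \<open>Suc k\<close>.\<close>
  define \<nu> where "\<nu> k = (SOME n. 6 * 3 ^ k * real (Suc k) < N n)" for k :: nat
  have \<nu>: "6 * 3 ^ k * real (Suc k) < N (\<nu> k)" for k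
    unfolding \<nu>_def by (rule someI_ex) (rule big)
  have "0 < N (\<nu> k)" for k by (rule le_less_trans[OF _ \<nu>]) simp
  then have "\<exists>f. sqint M f \<and> nrm2 M f = (1 / 3) ^ k \<and> 2 / 3 * N (\<nu> k) * (1 / 3) ^ k \<le> p (\<nu> k) f" for k
    by (intro near) auto
  then obtain f where f: "\<And>k. sqint M (f k)" "\<And>k. nrm2 M (f k) = (1 / 3) ^ k"
      "\<And>k. 2 / 3 * N (\<nu> k) * (1 / 3) ^ k \<le> p (\<nu> k) (f k)" by metis
  have step: "\<exists>y. sqint M y \<and> nrm2 M (\<lambda>t. y t - x t) = (1 / 3) ^ k \<and> 2 / 3 * N (\<nu> k) * (1 / 3) ^ k \<le> p (\<nu> k) y"
    if x: "sqint M x" for x k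
  proof -
    define y z where "y t = x t + f k t" and "z t = x t - f k t" for t
    have sq: "sqint M y" "sqint M z" unfolding y_def z_def by (intro sqint_add sqint_diff x f)+
    have "2 * p (\<nu> k) (f k) = p (\<nu> k) (\<lambda>t. 2 * f k t)" by (simp add: p_cmult f)
    also have "(\<lambda>t. 2 * f k t) = (\<lambda>t. y t + (- 1) * z t)" by (auto simp: y_def z_def)
    also have "p (\<nu> k) \<dots> \<le> p (\<nu> k) y + p (\<nu> k) z"
      using p_add[OF sq(1) sqint_cmult[OF sq(2)], of "\<nu> k" "- 1"] p_cmult[OF sq(2), of "\<nu> k" "- 1"] by simp
    finally have "p (\<nu> k) (f k) \<le> p (\<nu> k) y \<or> p (\<nu> k) (f k) \<le> p (\<nu> k) z" by linarith
    then have "2 / 3 * N (\<nu> k) * (1 / 3) ^ k \<le> p (\<nu> k) y \<or> 2 / 3 * N (\<nu> k) * (1 / 3) ^ k \<le> p (\<nu> k) z"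
      using f(3)[of k] by linarith
    moreover have "nrm2 M (\<lambda>t. y t - x t) = (1 / 3) ^ k" "nrm2 M (\<lambda>t. z t - x t) = (1 / 3) ^ k"
      using f(2)[of k] by (simp_all add: y_def z_def nrm2_def)
    ultimately show ?thesis using sq by blast
  qed
  have "\<exists>x. \<forall>k. sqint M (x k) \<and> nrm2 M (\<lambda>t. x (Suc k) t - x k t) = (1 / 3) ^ k
      \<and> 2 / 3 * N (\<nu> k) * (1 / 3) ^ k \<le> p (\<nu> k) (x (Suc k))"
    using dependent_nat_choice[of "\<lambda>_. sqint M" "\<lambda>k x y. nrm2 M (\<lambda>t. y t - x t) = (1 / 3) ^ k
      \<and> 2 / 3 * N (\<nu> k) * (1 / 3) ^ k \<le> p (\<nu> k) y"] step sqint_zero[of M] by blast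
  then obtain x where x: "\<And>k. sqint M (x k)" "\<And>k. nrm2 M (\<lambda>t. x (Suc k) t - x k t) = (1 / 3) ^ k"
      "\<And>k. 2 / 3 * N (\<nu> k) * (1 / 3) ^ k \<le> p (\<nu> k) (x (Suc k))" by blast
  have "summable (\<lambda>n. nrm2 M (\<lambda>t. x (Suc n) t - x n t))" unfolding x(2) by (rule summable_geometric) simp
  then obtain g where g: "sqint M g"
    "\<And>n. nrm2 M (\<lambda>t. g t - x n t) \<le> (\<Sum>k. nrm2 M (\<lambda>t. x (Suc (k + n)) t - x (k + n) t))"
    by (rule L2_complete[OF x(1)]) simp
  \<comment> \<open>The step from \<open>x n\<close> to \<open>x (Suc n)\<close> has norm
    \<open>(1 / 3) ^ n\<close>, so the steps from index \<open>Suc n\<close> on have total norm at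
    most \<open>(1 / 3) ^ Suc n * (3 / 2)\<close>.\<close>
  have tail: "nrm2 M (\<lambda>t. x (Suc n) t - g t) \<le> (1 / 3) ^ n / 2" for n
  proof -
    have "(\<lambda>k. (1 / 3) ^ k * (1 / 3) ^ Suc n) sums ((1 / (1 - 1 / 3)) * (1 / 3 :: real) ^ Suc n)"
      by (intro sums_mult2 geometric_sums) simp
    then have "(\<Sum>k. (1 / 3) ^ (k + Suc n)) = (1 / 3 :: real) ^ n / 2"
      by (simp add: sums_iff power_add)
    with g(2)[of "Suc n"] show ?thesis unfolding x(2) by (simp add: nrm2_commute)
  qed
  obtain K where K: "\<And>n. p n g \<le> K" using pointwise[OF g(1)] by blast
  have "real (Suc k) \<le> K" for k
  proof -
    have "p (\<nu> k) (\<lambda>t. g t + (x (Suc k) t - g t)) \<le> p (\<nu> k) g + p (\<nu> k) (\<lambda>t. x (Suc k) t - g t)"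
      by (intro p_add g sqint_diff x)
    moreover have "p (\<nu> k) (\<lambda>t. x (Suc k) t - g t) \<le> N (\<nu> k) * ((1 / 3) ^ k / 2)"
      by (rule order_trans[OF pN mult_left_mono[OF tail N0]]) (intro g sqint_diff x)
    ultimately have "N (\<nu> k) * (1 / 3) ^ k / 6 \<le> p (\<nu> k) g" using x(3)[of k] by simp
    moreover have "real (Suc k) \<le> N (\<nu> k) * (1 / 3) ^ k / 6"
      using \<nu>[of k] by (simp add: field_simps)
    ultimately show ?thesis using K[of "\<nu> k"] by linarith
  qed
  moreover obtain k :: nat where "K < real k" using reals_Archimedean2 by blast
  moreover have "real k \<le> real (Suc k)" by simp
  ultimately show False by (meson not_le order_trans)
qed

section \<open>Strongly continuous semigroups on L2\<close>

text \<open>A substitute for the monotonicity criterion by derivatives, for functions with a right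
  upper estimate that is uniform in \<open>s\<close>. The interval is cut into equal steps shorter
  than \<open>d\<close>, and the errors \<open>e / t * r\<close> add up to \<open>e\<close>.\<close>

lemma telescoping_le:
  fixes u :: "real \<Rightarrow> real"
  assumes t: "0 \<le> t"
    and step: "\<And>e. 0 < e \<Longrightarrow> \<exists>d>0. \<forall>s r. 0 \<le> s \<longrightarrow> 0 < r \<longrightarrow> r < d \<longrightarrow> s + r \<le> t \<longrightarrow> u (s + r) - u s \<le> e * r"
  shows "u t \<le> u 0"
proof (cases "t = 0")
  case False
  with t have t: "0 < t" by simp
  show ?thesis
  proof (rule field_le_epsilon)
    fix e :: real assume e: "0 < e"
    then obtain d where d: "0 < d"
      "\<And>s r. 0 \<le> s \<Longrightarrow> 0 < r \<Longrightarrow> r < d \<Longrightarrow> s + r \<le> t \<Longrightarrow> u (s + r) - u s \<le> e / t * r"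
      using step[of "e / t"] t by auto
    obtain n :: nat where n: "t / d < real n" using reals_Archimedean2 by blast
    then have n0: "0 < n" using t d by (cases n) (auto simp: divide_less_0_iff)
    define r where "r = t / n"
    have r: "0 < r" "r < d" "real n * r = t" using n n0 t d by (auto simp: r_def field_simps)
    have "u (real k * r) - u 0 \<le> real k * (e / t * r)" if "k \<le> n" for k
      using that
    proof (induction k)
      case (Suc k)
      have "real k * r + r \<le> real n * r"
        using Suc.prems r(1) mult_right_mono[of "real (Suc k)" "real n" r] by (simp add: algebra_simps)
      then have "u (real k * r + r) - u (real k * r) \<le> e / t * r"
        using r by (intro d) auto
      with Suc show ?case by (simp add: algebra_simps add_divide_distrib)
    qed simp
    from this[of n] r(3) t n0 show "u t \<le> u 0 + e" by (simp add: r_def)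
  qed
qed simp

text \<open>The abstract setting of \<open>form_semigroup\<close>, over a probability measure. The
  constant in \<open>P_bounded\<close> depends on \<open>t\<close>. Of the form there remain the
  symmetry of its generator, the value 0 on the function 1 and the density of the domain.\<close>

locale L2_semigroup = finite_measure M for M :: "'a measure" +
  fixes P :: "real \<Rightarrow> ('a \<Rightarrow> real) \<Rightarrow> 'a \<Rightarrow> real"
    and Gen :: "('a \<Rightarrow> real) \<Rightarrow> ('a \<Rightarrow> real) \<Rightarrow> bool"
  assumes mass_one: "measure M (space M) = 1"
    and P_sqint: "0 \<le> t \<Longrightarrow> sqint M f \<Longrightarrow> sqint M (P t f)"
    and P_linear: "0 \<le> t \<Longrightarrow> sqint M f \<Longrightarrow> sqint M g \<Longrightarrow>
      AE x in M. P t (\<lambda>y. c * f y + g y) x = c * P t f x + P t g x"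
    and P_bounded: "0 \<le> t \<Longrightarrow> \<exists>C. \<forall>f. sqint M f \<longrightarrow> nrm2 M (P t f) \<le> C * nrm2 M f"
    and P_zero: "sqint M f \<Longrightarrow> AE x in M. P 0 f x = f x"
    and P_add: "0 \<le> s \<Longrightarrow> 0 \<le> t \<Longrightarrow> sqint M f \<Longrightarrow> AE x in M. P (s + t) f x = P t (P s f) x"
    and P_cont: "sqint M f \<Longrightarrow> ((\<lambda>t. nrm2 M (\<lambda>x. P t f x - f x)) \<longlongrightarrow> 0) (at_right 0)"
    and P_gen: "sqint M f \<Longrightarrow> sqint M h \<Longrightarrow>
      ((\<lambda>t. nrm2 M (\<lambda>x. (P t f x - f x) / t - h x)) \<longlongrightarrow> 0) (at_right 0) \<longleftrightarrow> Gen f h"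
    and Gen_sqint: "Gen f h \<Longrightarrow> sqint M f \<and> sqint M h"
    and Gen_sym: "Gen f h \<Longrightarrow> Gen g k \<Longrightarrow> (\<integral>x. h x * g x \<partial>M) = (\<integral>x. f x * k x \<partial>M)"
    and Gen_one: "Gen (\<lambda>x. 1) (\<lambda>x. 0)"
    and Gen_dense: "sqint M f \<Longrightarrow> 0 < e \<Longrightarrow> \<exists>g h. Gen g h \<and> nrm2 M (\<lambda>x. f x - g x) < e"
begin

lemma sqint_const: "sqint M (\<lambda>x. c)"
  by (simp add: sqint_def)

lemma P_cmult: assumes "0 \<le> t" "sqint M f" shows "AE x in M. P t (\<lambda>y. c * f y) x = c * P t f x"
proof -
  \<comment> \<open>Linearity is given for \<open>c * f + g\<close>; with \<open>c = - 1\<close> and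
    two zero functions it says that \<open>P t\<close> of 0 is \<open>- z + z\<close> for the same
    \<open>z\<close>, hence 0.\<close>
  have 0: "AE x in M. P t (\<lambda>y. 0) x = 0"
    using P_linear[OF assms(1) sqint_zero sqint_zero, of "- 1"] by (auto elim: eventually_mono)
  have "AE x in M. P t (\<lambda>y. c * f y + 0) x = c * P t f x + P t (\<lambda>y. 0) x"
    by (rule P_linear[OF assms sqint_zero])
  with 0 show ?thesis by eventually_elim simp
qed

lemma P_diff: assumes "0 \<le> t" "sqint M f" "sqint M g"
  shows "AE x in M. P t (\<lambda>y. f y - g y) x = P t f x - P t g x"
proof -
  have "AE x in M. P t (\<lambda>y. (- 1) * g y + f y) x = (- 1) * P t g x + P t f x"
    by (rule P_linear[OF assms(1,3,2)])
  then show ?thesis by eventually_elim (simp add: add.commute)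
qed

lemma P_plus: assumes "0 \<le> t" "sqint M f" "sqint M g"
  shows "AE x in M. P t (\<lambda>y. f y + g y) x = P t f x + P t g x"
  using P_linear[OF assms, of 1] by simp

text \<open>Otherwise there are times \<open>t n\<close> tending to 0 for which the operators
  \<open>P (t n)\<close> are not uniformly bounded. For a fixed \<open>g\<close>, however, strong
  continuity at 0 bounds \<open>P (t n) g\<close> for all large \<open>n\<close>, and the other
  \<open>n\<close> are finitely many, so the uniform boundedness principle applies.\<close>

lemma local_bound: "\<exists>d>0. \<exists>K. \<forall>t f. 0 \<le> t \<longrightarrow> t \<le> d \<longrightarrow> sqint M f \<longrightarrow> nrm2 M (P t f) \<le> K * nrm2 M f"
proof (rule ccontr)
  assume "\<not> ?thesis"
  then have "\<exists>t f. 0 \<le> t \<and> t \<le> 1 / real (Suc n) \<and> sqint M f \<and> real n * nrm2 M f < nrm2 M (P t f)" for n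
    using not_le by (metis of_nat_0_less_iff zero_less_Suc zero_less_divide_1_iff)
  then obtain t f where t: "\<And>n. 0 \<le> t n" "\<And>n. t n \<le> 1 / real (Suc n)"
    and f: "\<And>n. sqint M (f n)" "\<And>n. real n * nrm2 M (f n) < nrm2 M (P (t n) (f n))" by metis
  have "\<exists>K. \<forall>n f. sqint M f \<longrightarrow> nrm2 M (P (t n) f) \<le> K * nrm2 M f"
  proof (rule uniform_boundedness_L2)
    fix n g h assume g: "sqint M g" and h: "sqint M h"
    have "nrm2 M (P (t n) (\<lambda>x. g x + h x)) = nrm2 M (\<lambda>x. P (t n) g x + P (t n) h x)"
      by (intro nrm2_cong_AE P_plus P_sqint sqint_add g h t)
    also have "\<dots> \<le> nrm2 M (P (t n) g) + nrm2 M (P (t n) h)" by (intro nrm2_triangle P_sqint g h t)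
    finally show "nrm2 M (P (t n) (\<lambda>x. g x + h x)) \<le> nrm2 M (P (t n) g) + nrm2 M (P (t n) h)" .
  next
    fix n g c assume g: "sqint M g"
    have "nrm2 M (P (t n) (\<lambda>x. c * g x)) = nrm2 M (\<lambda>x. c * P (t n) g x)"
      by (intro nrm2_cong_AE P_cmult P_sqint sqint_cmult g t)
    then show "nrm2 M (P (t n) (\<lambda>x. c * g x)) = \<bar>c\<bar> * nrm2 M (P (t n) g)" by (simp add: nrm2_cmult)
  next
    fix g assume g: "sqint M g"
    from tendstoD[OF P_cont[OF g], of 1] obtain b where b: "0 < b"
      "\<And>s. 0 < s \<Longrightarrow> s < b \<Longrightarrow> nrm2 M (\<lambda>x. P s g x - g x) < 1"
      by (auto simp: eventually_at_right_field)
    have small: "nrm2 M (P s g) \<le> nrm2 M g + 1" if s: "0 \<le> s" "s < b" for s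
    proof (cases "s = 0")
      case True
      have "nrm2 M (P 0 g) = nrm2 M g" by (intro nrm2_cong_AE P_sqint P_zero g) simp
      with True show ?thesis by simp
    next
      case False
      with b(2)[of s] s nrm2_triangle_rev[OF P_sqint[OF s(1) g] g] show ?thesis by simp
    qed
    obtain m :: nat where m: "1 / b < real m" using reals_Archimedean2 by blast
    show "\<exists>K. \<forall>n. nrm2 M (P (t n) g) \<le> K"
    proof (intro exI allI)
      fix n
      show "nrm2 M (P (t n) g) \<le> (nrm2 M g + 1) + (\<Sum>k<m. nrm2 M (P (t k) g))"
      proof (cases "n < m")
        case True
        then have "nrm2 M (P (t n) g) \<le> (\<Sum>k<m. nrm2 M (P (t k) g))"
          by (intro member_le_sum) auto
        then show ?thesis by (simp add: add_increasing)
      next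
        case False
        then have "1 / b < real (Suc n)" using m by linarith
        then have "1 / real (Suc n) < b" using b(1) by (simp add: field_simps)
        then have "t n < b" using t(2)[of n] by linarith
        then have "nrm2 M (P (t n) g) \<le> nrm2 M g + 1" by (intro small t)
        moreover have "0 \<le> (\<Sum>k<m. nrm2 M (P (t k) g))" by (intro sum_nonneg) simp
        ultimately show ?thesis by simp
      qed
    qed
  qed (auto simp: P_bounded t)
  then obtain K where K: "\<And>n f. sqint M f \<Longrightarrow> nrm2 M (P (t n) f) \<le> K * nrm2 M f" by blast
  obtain n :: nat where n: "K < real n" using reals_Archimedean2 by blast
  have "K * nrm2 M (f n) \<le> real n * nrm2 M (f n)" using n by (intro mult_right_mono) auto
  with K[OF f(1), of n n] f(2)[of n] show False by simp
qed

text \<open>By the semigroup law the local bound is raised to a power, one factor for each step of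
  length \<open>d\<close>. Enlarging it to \<open>L \<ge> 1\<close> makes the powers increasing, so
  one exponent serves all times up to \<open>T\<close>.\<close>

lemma uniform_bound:
  assumes T: "0 \<le> T"
  obtains K where "0 \<le> K" "\<And>t f. 0 \<le> t \<Longrightarrow> t \<le> T \<Longrightarrow> sqint M f \<Longrightarrow> nrm2 M (P t f) \<le> K * nrm2 M f"
proof -
  obtain d K where d: "0 < d"
    and K: "\<And>t f. 0 \<le> t \<Longrightarrow> t \<le> d \<Longrightarrow> sqint M f \<Longrightarrow> nrm2 M (P t f) \<le> K * nrm2 M f"
    using local_bound by blast
  define L where "L = max 1 K"
  have L: "1 \<le> L" by (simp add: L_def)
  have KL: "nrm2 M (P t f) \<le> L * nrm2 M f" if "0 \<le> t" "t \<le> d" "sqint M f" for t f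
    by (rule order_trans[OF K[OF that]]) (auto simp: L_def intro: mult_right_mono)
  have main: "nrm2 M (P t f) \<le> L ^ Suc n * nrm2 M f" if "0 \<le> t" "t \<le> real (Suc n) * d" "sqint M f" for n t f
    using that
  proof (induction n arbitrary: t f)
    case 0
    then show ?case using KL by simp
  next
    case (Suc n)
    show ?case
    proof (cases "t \<le> d")
      case True
      have "nrm2 M (P t f) \<le> L * nrm2 M f" using KL True Suc.prems by simp
      also have "\<dots> \<le> L ^ Suc (Suc n) * nrm2 M f"
        using L by (intro mult_right_mono) (auto intro!: self_le_power simp del: power_Suc)
      finally show ?thesis .
    next
      case False
      have "nrm2 M (P (d + (t - d)) f) = nrm2 M (P (t - d) (P d f))"
        using False Suc.prems d by (intro nrm2_cong_AE P_add P_sqint) auto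
      also have "\<dots> \<le> L ^ Suc n * nrm2 M (P d f)"
        using False Suc.prems d by (intro Suc.IH P_sqint) (auto simp: algebra_simps)
      also have "\<dots> \<le> L ^ Suc n * (L * nrm2 M f)"
        using L d Suc.prems by (intro mult_left_mono KL) auto
      finally show ?thesis by (simp add: mult_ac)
    qed
  qed
  obtain n :: nat where n: "T / d < real n" using reals_Archimedean2 by blast
  show ?thesis
  proof
    show "0 \<le> L ^ Suc n" using L by simp
    fix t f assume "0 \<le> t" "t \<le> T" "sqint M f"
    moreover have "T \<le> real (Suc n) * d" using n d by (simp add: field_simps)
    ultimately show "nrm2 M (P t f) \<le> L ^ Suc n * nrm2 M f" by (intro main) auto
  qed
qed

text \<open>The function in the norm is \<open>P s\<close> applied to
  \<open>P r f - f - r * h\<close>, so the first-order error at time 0 is carried to every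
  \<open>s \<le> T\<close> at the price of the factor from \<open>uniform_bound\<close>. That
  \<open>d\<close> is independent of \<open>s\<close> is what \<open>telescoping_le\<close> asks
  for.\<close>

lemma increment:
  assumes G: "Gen f h" and T: "0 \<le> T" and e: "0 < e"
  obtains d where "0 < d" "\<And>s r. 0 \<le> s \<Longrightarrow> s \<le> T \<Longrightarrow> 0 < r \<Longrightarrow> r < d \<Longrightarrow>
    nrm2 M (\<lambda>x. P (s + r) f x - (P s f x + r * P s h x)) \<le> e * r"
proof -
  have f: "sqint M f" and h: "sqint M h" using Gen_sqint[OF G] by auto
  obtain K where K: "0 \<le> K" "\<And>t f. 0 \<le> t \<Longrightarrow> t \<le> T \<Longrightarrow> sqint M f \<Longrightarrow> nrm2 M (P t f) \<le> K * nrm2 M f"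
    using uniform_bound[OF T] by blast
  have "((\<lambda>t. nrm2 M (\<lambda>x. (P t f x - f x) / t - h x)) \<longlongrightarrow> 0) (at_right 0)"
    using P_gen[OF f h] G by simp
  \<comment> \<open>Dividing by \<open>K + 1\<close> and not by \<open>K\<close>, which may be
    0.\<close>
  from tendstoD[OF this, of "e / (K + 1)"] e K(1) obtain d where d: "0 < d"
      "\<And>s. 0 < s \<Longrightarrow> s < d \<Longrightarrow> nrm2 M (\<lambda>x. (P s f x - f x) / s - h x) < e / (K + 1)"
    by (auto simp: eventually_at_right_field)
  show ?thesis
  proof
    fix s r assume s: "0 \<le> s" "s \<le> T" and r: "0 < r" "r < d"
    have r0: "0 \<le> r" using r by simp
    note sq = P_sqint[OF s(1)] P_sqint[OF r0] sqint_diff sqint_cmult sqint_add f h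
    have sqw: "sqint M (\<lambda>x. P r f x - f x)" "sqint M (\<lambda>x. (P r f x - f x) - r * h x)" by (intro sq)+
    have "AE x in M. P (s + r) f x = P s (P r f) x" using P_add[OF r0 s(1) f] by (simp add: add.commute)
    moreover have "AE x in M. P s (\<lambda>x. (P r f x - f x) - r * h x) x = P s (\<lambda>x. P r f x - f x) x - P s (\<lambda>x. r * h x) x"
      by (intro P_diff sq s)
    moreover have "AE x in M. P s (\<lambda>x. P r f x - f x) x = P s (P r f) x - P s f x" by (intro P_diff sq s)
    moreover have "AE x in M. P s (\<lambda>x. r * h x) x = r * P s h x" by (intro P_cmult s h)
    ultimately have "AE x in M. P (s + r) f x - (P s f x + r * P s h x) = P s (\<lambda>x. (P r f x - f x) - r * h x) x"
      by eventually_elim simp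
    then have "nrm2 M (\<lambda>x. P (s + r) f x - (P s f x + r * P s h x)) = nrm2 M (P s (\<lambda>x. (P r f x - f x) - r * h x))"
      using s r by (intro nrm2_cong_AE sq P_sqint) auto
    also have "\<dots> \<le> K * nrm2 M (\<lambda>x. (P r f x - f x) - r * h x)" by (intro K s sqw)
    also have "(\<lambda>x. (P r f x - f x) - r * h x) = (\<lambda>x. r * ((P r f x - f x) / r - h x))"
      using r by (auto simp: field_simps)
    also have "nrm2 M \<dots> = r * nrm2 M (\<lambda>x. (P r f x - f x) / r - h x)" using r by (simp only: nrm2_cmult abs_of_pos)
    also have "K * \<dots> \<le> (K + 1) * (r * (e / (K + 1)))"
      using K r d(2)[OF r] e by (intro mult_mono mult_left_mono) (auto simp: less_imp_le)
    also have "\<dots> = e * r" using K by simp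
    finally show "nrm2 M (\<lambda>x. P (s + r) f x - (P s f x + r * P s h x)) \<le> e * r" .
  qed (rule d)
qed

text \<open>The difference quotient of \<open>P s f\<close> at time 0 is the increment of the orbit
  of \<open>f\<close> at time \<open>s\<close>, divided by \<open>r\<close>. So the domain is
  invariant, and symmetry or coercivity of \<open>Gen\<close> can be used along the whole
  orbit.\<close>

lemma Gen_P:
  assumes G: "Gen f h" and s: "0 \<le> s"
  shows "Gen (P s f) (P s h)"
proof -
  have f: "sqint M f" and h: "sqint M h" using Gen_sqint[OF G] by auto
  note sq = P_sqint[OF s] f h
  have "((\<lambda>t. nrm2 M (\<lambda>x. (P t (P s f) x - P s f x) / t - P s h x)) \<longlongrightarrow> 0) (at_right 0)"
  proof (rule tendstoI)
    fix e :: real assume "0 < e"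
    then have e: "0 < e / 2" by simp
    obtain d where d: "0 < d" "\<And>q r. 0 \<le> q \<Longrightarrow> q \<le> s \<Longrightarrow> 0 < r \<Longrightarrow> r < d \<Longrightarrow>
      nrm2 M (\<lambda>x. P (q + r) f x - (P q f x + r * P q h x)) \<le> e / 2 * r"
      using increment[OF G s e] by blast
    have "nrm2 M (\<lambda>x. (P r (P s f) x - P s f x) / r - P s h x) < e" if r: "0 < r" "r < d" for r
    proof -
      have r0: "0 \<le> r" "0 \<le> s + r" using r s by auto
      have "AE x in M. P (s + r) f x = P r (P s f) x" by (intro P_add s f r0)
      then have "AE x in M. (P r (P s f) x - P s f x) / r - P s h x = (1 / r) * (P (s + r) f x - (P s f x + r * P s h x))"
        by eventually_elim (use r in \<open>simp add: field_simps\<close>)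
      then have "nrm2 M (\<lambda>x. (P r (P s f) x - P s f x) / r - P s h x)
          = nrm2 M (\<lambda>x. (1 / r) * (P (s + r) f x - (P s f x + r * P s h x)))"
        by (intro nrm2_cong_AE sqint_diff sqint_divide sqint_cmult sqint_add P_sqint sq r0)
      also have "\<dots> = (1 / r) * nrm2 M (\<lambda>x. P (s + r) f x - (P s f x + r * P s h x))"
        using r by (simp only: nrm2_cmult) simp
      also have "\<dots> \<le> (1 / r) * (e / 2 * r)" using r s by (intro mult_left_mono d) auto
      also have "\<dots> < e" using r \<open>0 < e\<close> by simp
      finally show ?thesis .
    qed
    then show "\<forall>\<^sub>F r in at_right 0. dist (nrm2 M (\<lambda>x. (P r (P s f) x - P s f x) / r - P s h x)) 0 < e"
      using d(1) by (auto simp: eventually_at_right_field)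
  qed
  then show ?thesis using P_gen[of "P s f" "P s h"] sq by simp
qed

text \<open>The inner product \<open>u s\<close> of \<open>P s f\<close> and
  \<open>P (t - s) g\<close> has derivative 0 by \<open>Gen_P\<close> and \<open>Gen_sym\<close>. An
  inequality between its end values suffices, since the roles of \<open>f\<close> and
  \<open>g\<close> can be exchanged.\<close>

lemma P_symmetric_Gen:
  assumes Gf: "Gen f h" and Gg: "Gen g k" and t: "0 \<le> t"
  shows "(\<integral>x. P t f x * g x \<partial>M) \<le> (\<integral>x. f x * P t g x \<partial>M)"
proof -
  have f: "sqint M f" and h: "sqint M h" and g: "sqint M g" and k: "sqint M k"
    using Gen_sqint[OF Gf] Gen_sqint[OF Gg] by auto
  obtain K where K: "0 \<le> K" "\<And>s f. 0 \<le> s \<Longrightarrow> s \<le> t \<Longrightarrow> sqint M f \<Longrightarrow> nrm2 M (P s f) \<le> K * nrm2 M f"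
    using uniform_bound[OF t] by blast
  define C where "C = K * (nrm2 M f + nrm2 M g) + 1"
  have C: "0 < C" unfolding C_def using K by (intro add_nonneg_pos mult_nonneg_nonneg add_nonneg_nonneg) auto
  define u where "u s = (\<integral>x. P s f x * P (t - s) g x \<partial>M)" for s
  have "u t \<le> u 0"
  proof (rule telescoping_le[OF t])
    fix e :: real assume "0 < e"
    then have e: "0 < e / C" using C by simp
    obtain d1 where d1: "0 < d1" "\<And>s r. 0 \<le> s \<Longrightarrow> s \<le> t \<Longrightarrow> 0 < r \<Longrightarrow> r < d1 \<Longrightarrow>
        nrm2 M (\<lambda>x. P (s + r) f x - (P s f x + r * P s h x)) \<le> e / C * r"
      using increment[OF Gf t e] by blast
    obtain d2 where d2: "0 < d2" "\<And>s r. 0 \<le> s \<Longrightarrow> s \<le> t \<Longrightarrow> 0 < r \<Longrightarrow> r < d2 \<Longrightarrow>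
        nrm2 M (\<lambda>x. P (s + r) g x - (P s g x + r * P s k x)) \<le> e / C * r"
      using increment[OF Gg t e] by blast
    have "u (s + r) - u s \<le> e * r" if s: "0 \<le> s" and r: "0 < r" "r < min d1 d2" "s + r \<le> t" for s r
    proof -
      \<comment> \<open>Both inner products are expanded at the same pair of times, \<open>s\<close>
        for \<open>f\<close> and \<open>q\<close> for \<open>g\<close>: the terms of order 0
        coincide and those of order 1 cancel exactly by \<open>Gen_sym\<close>.\<close>
      define q where "q = t - s - r"
      have q: "0 \<le> q" "q \<le> t" "t - s = q + r" "t - (s + r) = q" "s \<le> t" and sr: "0 \<le> s + r" "0 \<le> q + r"
        using s r by (auto simp: q_def)
      define F F' G G' where "F = P s f" and "F' = P s h" and "G = P q g" and "G' = P q k"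
      define E1 where "E1 x = P (s + r) f x - (F x + r * F' x)" for x
      define E2 where "E2 x = P (q + r) g x - (G x + r * G' x)" for x
      have sq: "sqint M F" "sqint M F'" "sqint M G" "sqint M G'"
        unfolding F_def F'_def G_def G'_def by (intro P_sqint s q f g h k)+
      have sqE: "sqint M E1" "sqint M E2" unfolding E1_def E2_def
        by (intro sqint_diff sqint_add sqint_cmult P_sqint sr sq f g)+
      note int = sqint_mult[OF sq(1) sq(3)] sqint_mult[OF sq(2) sq(3)] sqint_mult[OF sq(1) sq(4)]
        sqint_mult[OF sqE(1) sq(3)] sqint_mult[OF sq(1) sqE(2)]
      have "u (s + r) = (\<integral>x. F x * G x + r * (F' x * G x) + E1 x * G x \<partial>M)"
        unfolding u_def q(4) by (intro Bochner_Integration.integral_cong) (auto simp: E1_def G_def algebra_simps)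
      moreover have "u s = (\<integral>x. F x * G x + r * (F x * G' x) + F x * E2 x \<partial>M)"
        unfolding u_def q(3) by (intro Bochner_Integration.integral_cong) (auto simp: E2_def F_def algebra_simps)
      moreover have "(\<integral>x. F' x * G x \<partial>M) = (\<integral>x. F x * G' x \<partial>M)"
        unfolding F_def F'_def G_def G'_def by (intro Gen_sym Gen_P Gf Gg s q)
      ultimately have "u (s + r) - u s = (\<integral>x. E1 x * G x \<partial>M) - (\<integral>x. F x * E2 x \<partial>M)"
        using int by simp
      also have "\<dots> \<le> nrm2 M E1 * nrm2 M G + nrm2 M F * nrm2 M E2"
        using cauchy_schwarz_L2[OF sqE(1) sq(3)] cauchy_schwarz_L2[OF sq(1) sqE(2)] by linarith
      also have "\<dots> \<le> (e / C * r) * (K * nrm2 M g) + (K * nrm2 M f) * (e / C * r)"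
      proof (intro add_mono mult_mono)
        show "nrm2 M E1 \<le> e / C * r" unfolding E1_def F_def F'_def using s r q by (intro d1) auto
        show "nrm2 M E2 \<le> e / C * r" unfolding E2_def G_def G'_def using s r q by (intro d2) auto
        show "nrm2 M G \<le> K * nrm2 M g" unfolding G_def by (intro K q g)
        show "nrm2 M F \<le> K * nrm2 M f" unfolding F_def by (intro K q s f)
      qed (use K \<open>0 < e\<close> C r in \<open>simp_all add: divide_nonneg_pos\<close>)
      also have "\<dots> = (e / C * r) * (C - 1)" by (simp add: C_def algebra_simps add_divide_distrib)
      also have "\<dots> \<le> (e / C * r) * C" using C \<open>0 < e\<close> r by (intro mult_left_mono) auto
      also have "\<dots> = e * r" using C by simp
      finally show ?thesis .
    qed
    then show "\<exists>d>0. \<forall>s r. 0 \<le> s \<longrightarrow> 0 < r \<longrightarrow> r < d \<longrightarrow> s + r \<le> t \<longrightarrow> u (s + r) - u s \<le> e * r"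
      using d1(1) d2(1) by (intro exI[of _ "min d1 d2"]) auto
  qed
  moreover have "u t = (\<integral>x. P t f x * g x \<partial>M)" unfolding u_def
    using P_zero[OF g] sqint_measurable[OF P_sqint[OF t f]] sqint_measurable[OF P_sqint[OF order_refl g]] sqint_measurable[OF g]
    by (intro integral_cong_AE) auto
  moreover have "u 0 = (\<integral>x. f x * P t g x \<partial>M)" unfolding u_def
    using P_zero[OF f] sqint_measurable[OF P_sqint[OF t g]] sqint_measurable[OF P_sqint[OF order_refl f]] sqint_measurable[OF f]
    by (intro integral_cong_AE) auto
  ultimately show ?thesis by simp
qed

text \<open>Lets identities and bounds proved on the domain of \<open>Gen\<close> pass to all of L2,
  as \<open>P t\<close> is continuous.\<close>

lemma P_approx:
  assumes f: "sqint M f" and t: "0 \<le> t"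
  obtains g h where "\<And>n::nat. Gen (g n) (h n)"
    "(\<lambda>n. nrm2 M (\<lambda>x. g n x - f x)) \<longlonglongrightarrow> 0"
    "(\<lambda>n. nrm2 M (\<lambda>x. P t (g n) x - P t f x)) \<longlonglongrightarrow> 0"
proof -
  have "\<exists>g h. Gen g h \<and> nrm2 M (\<lambda>x. f x - g x) < 1 / real (Suc n)" for n
    by (intro Gen_dense f) simp
  then obtain g h where g: "\<And>n::nat. Gen (g n) (h n)" "\<And>n. nrm2 M (\<lambda>x. f x - g n x) < 1 / real (Suc n)"
    by metis
  have gs: "sqint M (g n)" for n using Gen_sqint[OF g(1)] by simp
  have lim: "(\<lambda>n. nrm2 M (\<lambda>x. g n x - f x)) \<longlonglongrightarrow> 0"
  proof (rule tendsto_sandwich[OF _ _ tendsto_const])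
    show "(\<lambda>n. 1 / real (Suc n)) \<longlonglongrightarrow> 0" using LIMSEQ_inverse_real_of_nat by (simp add: inverse_eq_divide)
    show "\<forall>\<^sub>F n in sequentially. nrm2 M (\<lambda>x. g n x - f x) \<le> 1 / real (Suc n)"
      using g(2) by (auto simp: nrm2_commute[of M _ f] less_imp_le)
  qed auto
  obtain K where K: "0 \<le> K" "\<And>s f. 0 \<le> s \<Longrightarrow> s \<le> t \<Longrightarrow> sqint M f \<Longrightarrow> nrm2 M (P s f) \<le> K * nrm2 M f"
    using uniform_bound[OF t] by blast
  have "nrm2 M (\<lambda>x. P t (g n) x - P t f x) \<le> K * nrm2 M (\<lambda>x. g n x - f x)" for n
  proof -
    have "nrm2 M (\<lambda>x. P t (g n) x - P t f x) = nrm2 M (P t (\<lambda>x. g n x - f x))"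
      using P_diff[OF t gs f, of n]
      by (intro nrm2_cong_AE sqint_diff P_sqint t gs f) (auto elim: eventually_mono)
    also have "\<dots> \<le> K * nrm2 M (\<lambda>x. g n x - f x)" by (intro K t sqint_diff gs f) simp
    finally show ?thesis .
  qed
  then have "(\<lambda>n. nrm2 M (\<lambda>x. P t (g n) x - P t f x)) \<longlonglongrightarrow> 0"
    by (intro tendsto_sandwich[OF _ _ tendsto_const tendsto_mult_right_zero[OF lim, of K]]) auto
  with g(1) lim that show ?thesis by blast
qed

end

lemma tendsto_ip_L2:
  assumes f: "\<And>n::nat. sqint M (f n)" "sqint M F" and g: "\<And>n. sqint M (g n)" "sqint M G"
    and lf: "(\<lambda>n. nrm2 M (\<lambda>x. f n x - F x)) \<longlonglongrightarrow> 0" and lg: "(\<lambda>n. nrm2 M (\<lambda>x. g n x - G x)) \<longlonglongrightarrow> 0"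
  shows "(\<lambda>n. \<integral>x. f n x * g n x \<partial>M) \<longlonglongrightarrow> (\<integral>x. F x * G x \<partial>M)"
proof -
  have bound: "\<bar>(\<integral>x. f n x * g n x \<partial>M) - (\<integral>x. F x * G x \<partial>M)\<bar>
      \<le> nrm2 M (\<lambda>x. f n x - F x) * (nrm2 M (\<lambda>x. g n x - G x) + nrm2 M G) + nrm2 M F * nrm2 M (\<lambda>x. g n x - G x)" for n
  proof -
    note df = sqint_diff[OF f(1,2), of n] and dg = sqint_diff[OF g(1,2), of n]
    have "(\<integral>x. f n x * g n x \<partial>M) = (\<integral>x. (f n x - F x) * g n x + (F x * (g n x - G x) + F x * G x) \<partial>M)"
      by (intro Bochner_Integration.integral_cong) (auto simp: algebra_simps)
    also have "\<dots> = (\<integral>x. (f n x - F x) * g n x \<partial>M) + ((\<integral>x. F x * (g n x - G x) \<partial>M) + (\<integral>x. F x * G x \<partial>M))"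
      using sqint_mult[OF df g(1)] sqint_mult[OF f(2) dg] sqint_mult[OF f(2) g(2)]
      by (simp only: Bochner_Integration.integral_add Bochner_Integration.integrable_add)
    finally have "(\<integral>x. f n x * g n x \<partial>M) - (\<integral>x. F x * G x \<partial>M) = (\<integral>x. (f n x - F x) * g n x \<partial>M) + (\<integral>x. F x * (g n x - G x) \<partial>M)"
      by simp
    moreover have "\<bar>\<integral>x. (f n x - F x) * g n x \<partial>M\<bar> \<le> nrm2 M (\<lambda>x. f n x - F x) * (nrm2 M (\<lambda>x. g n x - G x) + nrm2 M G)"
      by (rule order_trans[OF cauchy_schwarz_L2[OF df g(1)]])
        (use nrm2_triangle_rev[OF g(1,2), of n] in \<open>auto intro!: mult_left_mono\<close>)
    moreover have "\<bar>\<integral>x. F x * (g n x - G x) \<partial>M\<bar> \<le> nrm2 M F * nrm2 M (\<lambda>x. g n x - G x)"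
      by (rule cauchy_schwarz_L2[OF f(2) dg])
    ultimately show ?thesis by linarith
  qed
  have lim0: "(\<lambda>n. nrm2 M (\<lambda>x. f n x - F x) * (nrm2 M (\<lambda>x. g n x - G x) + nrm2 M G)
      + nrm2 M F * nrm2 M (\<lambda>x. g n x - G x)) \<longlonglongrightarrow> 0 * (0 + nrm2 M G) + nrm2 M F * 0"
    by (intro tendsto_intros lf lg)
  have "(\<lambda>n. (\<integral>x. f n x * g n x \<partial>M) - (\<integral>x. F x * G x \<partial>M)) \<longlonglongrightarrow> 0"
  proof (rule Lim_null_comparison)
    show "\<forall>\<^sub>F n in sequentially. norm ((\<integral>x. f n x * g n x \<partial>M) - (\<integral>x. F x * G x \<partial>M))
      \<le> nrm2 M (\<lambda>x. f n x - F x) * (nrm2 M (\<lambda>x. g n x - G x) + nrm2 M G) + nrm2 M F * nrm2 M (\<lambda>x. g n x - G x)"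
      using bound by (intro always_eventually allI) (simp only: real_norm_def)
    show "(\<lambda>n. nrm2 M (\<lambda>x. f n x - F x) * (nrm2 M (\<lambda>x. g n x - G x) + nrm2 M G)
      + nrm2 M F * nrm2 M (\<lambda>x. g n x - G x)) \<longlonglongrightarrow> 0"
      using lim0 by (simp only: mult_zero_left mult_zero_right add_0_right)
  qed
  then show ?thesis by (simp add: LIM_zero_iff)
qed

lemma tendsto_nrm2:
  assumes f: "\<And>n::nat. sqint M (f n)" "sqint M F"
    and lf: "(\<lambda>n. nrm2 M (\<lambda>x. f n x - F x)) \<longlonglongrightarrow> 0"
  shows "(\<lambda>n. nrm2 M (f n)) \<longlonglongrightarrow> nrm2 M F"
  using tendsto_ip_L2[OF f f lf lf] unfolding nrm2_def power2_eq_square by (intro tendsto_real_sqrt)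

section \<open>Symmetry, conservation of mass and exponential decay\<close>

context L2_semigroup
begin

theorem P_symmetric:
  assumes t: "0 \<le> t" and f: "sqint M f" and g: "sqint M g"
  shows "(\<integral>x. P t f x * g x \<partial>M) = (\<integral>x. f x * P t g x \<partial>M)"
proof -
  obtain f' h where f': "\<And>n::nat. Gen (f' n) (h n)" "(\<lambda>n. nrm2 M (\<lambda>x. f' n x - f x)) \<longlonglongrightarrow> 0"
    "(\<lambda>n. nrm2 M (\<lambda>x. P t (f' n) x - P t f x)) \<longlonglongrightarrow> 0" using P_approx[OF f t] by blast
  obtain g' k where g': "\<And>n::nat. Gen (g' n) (k n)" "(\<lambda>n. nrm2 M (\<lambda>x. g' n x - g x)) \<longlonglongrightarrow> 0"
    "(\<lambda>n. nrm2 M (\<lambda>x. P t (g' n) x - P t g x)) \<longlonglongrightarrow> 0" using P_approx[OF g t] by blast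
  have sq: "sqint M (f' n)" "sqint M (g' n)" for n using f'(1) g'(1) Gen_sqint by blast+
  have "(\<integral>x. P t (f' n) x * g' n x \<partial>M) = (\<integral>x. f' n x * P t (g' n) x \<partial>M)" for n
    using P_symmetric_Gen[OF f'(1) g'(1) t, of n n] P_symmetric_Gen[OF g'(1) f'(1) t, of n n]
    by (simp add: mult.commute)
  moreover have "(\<lambda>n. \<integral>x. P t (f' n) x * g' n x \<partial>M) \<longlonglongrightarrow> (\<integral>x. P t f x * g x \<partial>M)"
    by (intro tendsto_ip_L2 P_sqint t sq f g f' g')
  moreover have "(\<lambda>n. \<integral>x. f' n x * P t (g' n) x \<partial>M) \<longlonglongrightarrow> (\<integral>x. f x * P t g x \<partial>M)"
    by (intro tendsto_ip_L2 P_sqint t sq f g f' g')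
  ultimately show ?thesis by (simp add: LIMSEQ_unique)
qed

text \<open>As the generator sends 1 to 0, the distance \<open>u s\<close> of the orbit of 1 from 1
  grows by at most \<open>e * r\<close> over a short step of length \<open>r\<close>, for every
  \<open>e\<close>; and \<open>u 0 = 0\<close>.\<close>

lemma P_one: assumes t: "0 \<le> t" shows "AE x in M. P t (\<lambda>x. 1) x = 1"
proof -
  have sq: "0 \<le> s \<Longrightarrow> sqint M (P s (\<lambda>x. c))" for s c by (intro P_sqint sqint_const)
  have 0: "AE x in M. P s (\<lambda>x. 0) x = 0" if "0 \<le> s" for s
    using P_cmult[OF that sqint_const, of 0 0] by simp
  define u where "u s = nrm2 M (\<lambda>x. P s (\<lambda>x. 1) x - 1)" for s
  have "u t \<le> u 0"
  proof (rule telescoping_le[OF t])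
    fix e :: real assume e: "0 < e"
    obtain d where d: "0 < d" "\<And>s r. 0 \<le> s \<Longrightarrow> s \<le> t \<Longrightarrow> 0 < r \<Longrightarrow> r < d \<Longrightarrow>
        nrm2 M (\<lambda>x. P (s + r) (\<lambda>x. 1) x - (P s (\<lambda>x. 1) x + r * P s (\<lambda>x. 0) x)) \<le> e * r"
      using increment[OF Gen_one t e] by blast
    have "u (s + r) - u s \<le> e * r" if s: "0 \<le> s" and r: "0 < r" "r < d" "s + r \<le> t" for s r
    proof -
      have s': "0 \<le> s + r" using s r by simp
      have "u (s + r) \<le> nrm2 M (\<lambda>x. P (s + r) (\<lambda>x. 1) x - P s (\<lambda>x. 1) x) + u s"
        unfolding u_def by (intro nrm2_triangle_diff sq s s' sqint_const)
      also have "nrm2 M (\<lambda>x. P (s + r) (\<lambda>x. 1) x - P s (\<lambda>x. 1) x)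
          = nrm2 M (\<lambda>x. P (s + r) (\<lambda>x. 1) x - (P s (\<lambda>x. 1) x + r * P s (\<lambda>x. 0) x))"
        using 0[OF s] by (intro nrm2_cong_AE sqint_diff sqint_add sqint_cmult sq s s') (auto elim: eventually_mono)
      also have "\<dots> \<le> e * r" using s r by (intro d) auto
      finally show ?thesis by simp
    qed
    then show "\<exists>d>0. \<forall>s r. 0 \<le> s \<longrightarrow> 0 < r \<longrightarrow> r < d \<longrightarrow> s + r \<le> t \<longrightarrow> u (s + r) - u s \<le> e * r"
      using d(1) by blast
  qed
  also have "u 0 = 0"
    unfolding u_def using P_zero[OF sqint_const, of 1]
    by (subst nrm2_eq_0_iff) (auto intro!: sqint_diff sq sqint_const)
  finally have "u t = 0" using nrm2_nonneg[of M] unfolding u_def by (metis order_antisym)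
  then show ?thesis unfolding u_def using sqint_diff[OF sq[OF t] sqint_const, of 1 1]
    by (subst (asm) nrm2_eq_0_iff) auto
qed

lemma P_mean: assumes t: "0 \<le> t" and f: "sqint M f" shows "(\<integral>x. P t f x \<partial>M) = (\<integral>x. f x \<partial>M)"
proof -
  have "(\<integral>x. P t f x \<partial>M) = (\<integral>x. f x * P t (\<lambda>x. 1) x \<partial>M)"
    using P_symmetric[OF t f sqint_const, of 1] by simp
  also have "\<dots> = (\<integral>x. f x \<partial>M)"
    using P_one[OF t] sqint_measurable[OF f] sqint_measurable[OF P_sqint[OF t sqint_const, of 1]]
    by (intro integral_cong_AE) (auto elim: eventually_mono)
  finally show ?thesis .
qed

text \<open>For the centred orbit the squared norm has derivative twice the inner product with the
  generator, hence at most \<open>- 2 * a\<close> times itself. So its product with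
  \<open>exp (2 * a * s)\<close> does not increase. This is carried out by increments for
  \<open>f\<close> in the domain and extended by density.\<close>

theorem P_decay:
  assumes coercive: "\<And>f h. Gen f h \<Longrightarrow> (\<integral>x. h x * f x \<partial>M) \<le> - a * ((\<integral>x. (f x)\<^sup>2 \<partial>M) - (\<integral>x. f x \<partial>M)\<^sup>2)"
    and a: "0 < a" and t: "0 \<le> t" and f: "sqint M f"
  shows "nrm2 M (\<lambda>x. P t f x - (\<integral>y. f y \<partial>M)) \<le> exp (- a * t) * nrm2 M f"
proof -
  have center: "(nrm2 M (\<lambda>x. f x - (\<integral>y. f y \<partial>M)))\<^sup>2 = (\<integral>x. (f x)\<^sup>2 \<partial>M) - (\<integral>x. f x \<partial>M)\<^sup>2"
    if f: "sqint M f" for f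
  proof -
    have "integrable M f" using sqint_mult[OF f sqint_const, of 1] by simp
    moreover have "integrable M (\<lambda>x. (f x)\<^sup>2)" using f by (simp add: sqint_def)
    ultimately show ?thesis
      by (simp add: nrm2_sq power2_diff mass_one mult.assoc) (simp add: power2_eq_square)
  qed
  have main: "(nrm2 M (\<lambda>x. P t f x - (\<integral>y. f y \<partial>M)))\<^sup>2 * exp (2 * a * t) \<le> (nrm2 M (\<lambda>x. f x - (\<integral>y. f y \<partial>M)))\<^sup>2"
    if G: "Gen f h" for f h
  proof -
    have f: "sqint M f" and h: "sqint M h" using Gen_sqint[OF G] by auto
    define m where "m = (\<integral>y. f y \<partial>M)"
    obtain K where K: "0 \<le> K" "\<And>s f. 0 \<le> s \<Longrightarrow> s \<le> t \<Longrightarrow> sqint M f \<Longrightarrow> nrm2 M (P s f) \<le> K * nrm2 M f"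
      using uniform_bound[OF t] by blast
    \<comment> \<open>\<open>A\<close> bounds the norm of the first-order approximation
      \<open>v + r * G'\<close> of the centred orbit below, and \<open>B\<close> the squared norm of
      \<open>G'\<close>, uniformly over the times up to \<open>t\<close>.\<close>
    define A where "A = K * nrm2 M f + \<bar>m\<bar> + t * (K * nrm2 M h)"
    define B where "B = (K * nrm2 M h)\<^sup>2"
    have A: "0 \<le> A" and B: "0 \<le> B" unfolding A_def B_def using K t by (auto intro!: add_nonneg_nonneg mult_nonneg_nonneg)
    define u where "u s = (nrm2 M (\<lambda>x. P s f x - m))\<^sup>2 * exp (2 * a * s)" for s
    have "u t \<le> u 0"
    proof (rule telescoping_le[OF t])
      fix e :: real assume e: "0 < e"
      define X where "X = exp (2 * a * t)"
      have X: "1 \<le> X" unfolding X_def using a t by simp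
      \<comment> \<open>A step of length \<open>r\<close> costs
        \<open>r * (r * B + e1 * (2 * A + 1))\<close>, weighted by at most \<open>X\<close>. The
        choices of \<open>e1\<close> and \<open>d'\<close> make each of the two terms at most
        \<open>e / 3\<close>; \<open>e1 \<le> 1\<close> and \<open>r \<le> 1\<close> absorb the
        square of \<open>e1 * r\<close>.\<close>
      define e1 where "e1 = min 1 (e / (3 * X * (2 * A + 1)))"
      have e1: "0 < e1" "e1 \<le> 1" "e1 * (3 * X * (2 * A + 1)) \<le> e"
      proof -
        have p: "0 < 3 * X * (2 * A + 1)" using A X by (intro mult_pos_pos) auto
        show "0 < e1" "e1 \<le> 1" unfolding e1_def using p e by auto
        have "e1 \<le> e / (3 * X * (2 * A + 1))" unfolding e1_def by simp
        with p show "e1 * (3 * X * (2 * A + 1)) \<le> e" by (simp only: pos_le_divide_eq)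
      qed
      obtain d where d: "0 < d" "\<And>s r. 0 \<le> s \<Longrightarrow> s \<le> t \<Longrightarrow> 0 < r \<Longrightarrow> r < d \<Longrightarrow>
          nrm2 M (\<lambda>x. P (s + r) f x - (P s f x + r * P s h x)) \<le> e1 * r"
        using increment[OF G t e1(1)] by blast
      define d' where "d' = min (min d 1) (e / (3 * X * (B + 1)))"
      have d': "0 < d'" unfolding d'_def using d e X B by (auto intro!: divide_pos_pos mult_pos_pos)
      have "u (s + r) - u s \<le> e * r" if s: "0 \<le> s" and r: "0 < r" "r < d'" "s + r \<le> t" for s r
      proof -
        have st: "s \<le> t" "r < d" "r \<le> 1" "r \<le> t" "0 \<le> s + r" "0 \<le> r" "r \<le> e / (3 * X * (B + 1))"
          using s r by (auto simp: d'_def)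
        have rB: "r * (3 * X * (B + 1)) \<le> e"
        proof -
          have "0 < 3 * X * (B + 1)" using B X by (intro mult_pos_pos) auto
          with st(7) show ?thesis by (simp only: pos_le_divide_eq)
        qed
        define G G' where "G = P s f" and "G' = P s h"
        have sqG: "sqint M G" "sqint M G'" unfolding G_def G'_def by (intro P_sqint s f h)+
        have GG: "Gen G G'" unfolding G_def G'_def by (rule Gen_P[OF \<open>Gen f h\<close> s])
        define v where "v x = G x - m" for x
        have sqv: "sqint M v" unfolding v_def by (intro sqint_diff sqG sqint_const)
        have mG: "(\<integral>x. G x \<partial>M) = m" unfolding G_def m_def by (rule P_mean[OF s f])
        \<comment> \<open>Since \<open>G'\<close> has integral 0, centring \<open>G\<close> to
          \<open>v\<close> does not change the inner product with \<open>G'\<close>.\<close>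
        have G'0: "(\<integral>x. G' x \<partial>M) = 0" using Gen_sym[OF GG Gen_one] by simp
        have iG': "integrable M G'" using sqint_mult[OF sqG(2) sqint_const, of 1] by simp
        have "(\<integral>x. v x * G' x \<partial>M) = (\<integral>x. G' x * G x \<partial>M)"
          using sqint_mult[OF sqG(2) sqG(1)] iG' G'0 by (simp add: v_def algebra_simps)
        also have "\<dots> \<le> - a * (nrm2 M v)\<^sup>2"
          using coercive[OF GG] center[OF sqG(1)] by (simp add: v_def[abs_def] mG)
        finally have vG': "(\<integral>x. v x * G' x \<partial>M) \<le> - a * (nrm2 M v)\<^sup>2" .
        define W where "W = nrm2 M (\<lambda>x. v x + r * G' x)"
        have nG': "nrm2 M G' \<le> K * nrm2 M h" unfolding G'_def by (intro K s st h)
        have nG: "nrm2 M G \<le> K * nrm2 M f" unfolding G_def by (intro K s st f)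
        have "W \<le> nrm2 M v + r * nrm2 M G'"
          unfolding W_def using nrm2_triangle[OF sqv sqint_cmult[OF sqG(2)], of r] st by (simp add: nrm2_cmult)
        moreover have "nrm2 M v \<le> nrm2 M G + \<bar>m\<bar>"
          using nrm2_triangle[OF sqG(1) sqint_const, of "- m"] by (simp add: v_def[abs_def] nrm2_def[of M "\<lambda>x. - m"] mass_one)
        moreover have "r * nrm2 M G' \<le> t * (K * nrm2 M h)" using st t nG' by (intro mult_mono) auto
        ultimately have WA: "W \<le> A" using nG unfolding A_def by linarith
        have W2: "W\<^sup>2 \<le> (nrm2 M v)\<^sup>2 * (1 - 2 * a * r) + r\<^sup>2 * B"
        proof -
          have "W\<^sup>2 = (nrm2 M v)\<^sup>2 + 2 * r * (\<integral>x. v x * G' x \<partial>M) + r\<^sup>2 * (nrm2 M G')\<^sup>2"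
            unfolding W_def nrm2_sq_add[OF sqv sqint_cmult[OF sqG(2)]]
            by (simp add: nrm2_cmult power_mult_distrib mult.left_commute[of _ r])
          moreover have "r * (\<integral>x. v x * G' x \<partial>M) \<le> r * (- a * (nrm2 M v)\<^sup>2)"
            using vG' st by (intro mult_left_mono) auto
          moreover have "r\<^sup>2 * (nrm2 M G')\<^sup>2 \<le> r\<^sup>2 * B" unfolding B_def using nG' by (intro mult_left_mono power_mono) auto
          ultimately show ?thesis by (simp add: algebra_simps)
        qed
        have "nrm2 M (\<lambda>x. P (s + r) f x - m) \<le> nrm2 M (\<lambda>x. P (s + r) f x - (G x + r * G' x)) + nrm2 M (\<lambda>x. (G x + r * G' x) - m)"
          by (intro nrm2_triangle_diff P_sqint sqint_add sqint_cmult sqG sqint_const f st)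
        also have "(\<lambda>x. (G x + r * G' x) - m) = (\<lambda>x. v x + r * G' x)" by (auto simp: v_def)
        also have "nrm2 M (\<lambda>x. P (s + r) f x - (G x + r * G' x)) \<le> e1 * r"
          unfolding G_def G'_def using s st r by (intro d) auto
        finally have "nrm2 M (\<lambda>x. P (s + r) f x - m) \<le> e1 * r + W" by (simp add: W_def)
        then have "(nrm2 M (\<lambda>x. P (s + r) f x - m))\<^sup>2 \<le> (e1 * r + W)\<^sup>2" by (intro power_mono) auto
        also have "\<dots> = W\<^sup>2 + (e1 * r) * (2 * W + e1 * r)" by (simp add: power2_eq_square algebra_simps)
        also have "\<dots> \<le> W\<^sup>2 + (e1 * r) * (2 * A + 1)"
          using WA e1 st mult_mono[of e1 1 r 1] by (intro add_left_mono mult_left_mono) auto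
        also have "\<dots> \<le> (nrm2 M v)\<^sup>2 * (1 - 2 * a * r) + r\<^sup>2 * B + (e1 * r) * (2 * A + 1)" using W2 by simp
        \<comment> \<open>The factor \<open>exp (- 2 * a * r)\<close> is the one that turns the
          weight at time \<open>s + r\<close> into the weight at time \<open>s\<close>.\<close>
        also have "\<dots> \<le> (nrm2 M v)\<^sup>2 * exp (- 2 * a * r) + r * (r * B + e1 * (2 * A + 1))"
          using exp_ge_add_one_self[of "- 2 * a * r"] mult_left_mono[of "1 - 2 * a * r" "exp (- 2 * a * r)" "(nrm2 M v)\<^sup>2"]
          by (simp add: power2_eq_square algebra_simps)
        finally have fin: "(nrm2 M (\<lambda>x. P (s + r) f x - m))\<^sup>2 \<le> (nrm2 M v)\<^sup>2 * exp (- 2 * a * r) + r * (r * B + e1 * (2 * A + 1))" .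
        have "u (s + r) \<le> ((nrm2 M v)\<^sup>2 * exp (- 2 * a * r) + r * (r * B + e1 * (2 * A + 1))) * exp (2 * a * (s + r))"
          unfolding u_def using fin by (intro mult_right_mono) auto
        also have "\<dots> = (nrm2 M v)\<^sup>2 * (exp (- 2 * a * r) * exp (2 * a * (s + r))) + r * (r * B + e1 * (2 * A + 1)) * exp (2 * a * (s + r))"
          by (simp add: algebra_simps)
        also have "exp (- 2 * a * r) * exp (2 * a * (s + r)) = exp (2 * a * s)"
          by (simp add: exp_add[symmetric] algebra_simps)
        also have "(nrm2 M v)\<^sup>2 * exp (2 * a * s) = u s" by (simp add: u_def v_def[abs_def] G_def)
        also have "r * (r * B + e1 * (2 * A + 1)) * exp (2 * a * (s + r)) \<le> r * (r * B + e1 * (2 * A + 1)) * X"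
          unfolding X_def using a r st e1 A B by (intro mult_left_mono) auto
        also have "\<dots> = r * (r * (X * B) + e1 * (X * (2 * A + 1)))" by (simp add: algebra_simps)
        also have "\<dots> \<le> r * e"
        proof (intro mult_left_mono)
          have "r * (X * B) \<le> r * (X * (B + 1))" using st X by (intro mult_left_mono) auto
          also have "r * (X * (B + 1)) \<le> e / 3" using rB by (simp add: algebra_simps)
          finally have "r * (X * B) \<le> e / 3" .
          moreover have "e1 * (X * (2 * A + 1)) \<le> e / 3" using e1(3) by (simp add: algebra_simps)
          ultimately show "r * (X * B) + e1 * (X * (2 * A + 1)) \<le> e" using e by linarith
        qed (rule st)
        finally show ?thesis by (simp add: mult.commute)
      qed
      then show "\<exists>d>0. \<forall>s r. 0 \<le> s \<longrightarrow> 0 < r \<longrightarrow> r < d \<longrightarrow> s + r \<le> t \<longrightarrow> u (s + r) - u s \<le> e * r"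
        using d' by blast
    qed
    moreover have "nrm2 M (\<lambda>x. P 0 f x - m) = nrm2 M (\<lambda>x. f x - m)"
      using P_zero[OF f] by (intro nrm2_cong_AE sqint_diff P_sqint f sqint_const) auto
    ultimately show ?thesis by (simp add: u_def m_def)
  qed
  have mainsqrt: "nrm2 M (\<lambda>x. P t f x - (\<integral>y. f y \<partial>M)) \<le> exp (- a * t) * nrm2 M f" if G: "Gen f h" for f h
  proof (rule power2_le_imp_le)
    have f: "sqint M f" using Gen_sqint[OF G] by auto
    have "exp (- a * t) * exp (- a * t) * exp (2 * a * t) = 1"
      by (simp add: exp_add[symmetric])
    then have e: "exp (2 * a * t) * (exp (- a * t))\<^sup>2 = 1" by (simp add: power2_eq_square mult_ac)
    have "(nrm2 M (\<lambda>x. P t f x - (\<integral>y. f y \<partial>M)))\<^sup>2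
        = (nrm2 M (\<lambda>x. P t f x - (\<integral>y. f y \<partial>M)))\<^sup>2 * (exp (2 * a * t) * (exp (- a * t))\<^sup>2)" unfolding e by simp
    also have "\<dots> \<le> (nrm2 M (\<lambda>x. f x - (\<integral>y. f y \<partial>M)))\<^sup>2 * (exp (- a * t))\<^sup>2"
      using main[OF G] unfolding mult.assoc[symmetric] by (intro mult_right_mono) auto
    \<comment> \<open>Subtracting the mean does not increase the norm.\<close>
    also have "\<dots> \<le> (nrm2 M f)\<^sup>2 * (exp (- a * t))\<^sup>2"
      using center[OF f] by (intro mult_right_mono) (auto simp: nrm2_sq[of M f])
    finally show "(nrm2 M (\<lambda>x. P t f x - (\<integral>y. f y \<partial>M)))\<^sup>2 \<le> (exp (- a * t) * nrm2 M f)\<^sup>2"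
      by (simp add: power_mult_distrib mult.commute)
  qed simp
  obtain g h where g: "\<And>n::nat. Gen (g n) (h n)" "(\<lambda>n. nrm2 M (\<lambda>x. g n x - f x)) \<longlonglongrightarrow> 0"
    "(\<lambda>n. nrm2 M (\<lambda>x. P t (g n) x - P t f x)) \<longlonglongrightarrow> 0" using P_approx[OF f t] by blast
  have gs: "sqint M (g n)" for n using g(1) Gen_sqint by blast
  have mean: "(\<lambda>n. \<integral>y. g n y \<partial>M) \<longlonglongrightarrow> (\<integral>y. f y \<partial>M)"
    using tendsto_ip_L2[OF gs f sqint_const[of 1] sqint_const[of 1] g(2)] by (simp add: nrm2_def)
  have lim: "(\<lambda>n. nrm2 M (\<lambda>x. (P t (g n) x - (\<integral>y. g n y \<partial>M)) - (P t f x - (\<integral>y. f y \<partial>M)))) \<longlonglongrightarrow> 0"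
  proof (rule Lim_null_comparison)
    show "\<forall>\<^sub>F n in sequentially. norm (nrm2 M (\<lambda>x. (P t (g n) x - (\<integral>y. g n y \<partial>M)) - (P t f x - (\<integral>y. f y \<partial>M))))
       \<le> nrm2 M (\<lambda>x. P t (g n) x - P t f x) + \<bar>(\<integral>y. g n y \<partial>M) - (\<integral>y. f y \<partial>M)\<bar>"
    proof (intro always_eventually allI)
      fix n
      let ?c = "(\<integral>y. f y \<partial>M) - (\<integral>y. g n y \<partial>M)"
      have "nrm2 M (\<lambda>x. (P t (g n) x - P t f x) + ?c) \<le> nrm2 M (\<lambda>x. P t (g n) x - P t f x) + nrm2 M (\<lambda>x. ?c)"
        by (intro nrm2_triangle sqint_diff P_sqint gs f t sqint_const)
      moreover have "nrm2 M (\<lambda>x. ?c) = \<bar>?c\<bar>" by (simp add: nrm2_def mass_one)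
      ultimately show "norm (nrm2 M (\<lambda>x. (P t (g n) x - (\<integral>y. g n y \<partial>M)) - (P t f x - (\<integral>y. f y \<partial>M))))
         \<le> nrm2 M (\<lambda>x. P t (g n) x - P t f x) + \<bar>(\<integral>y. g n y \<partial>M) - (\<integral>y. f y \<partial>M)\<bar>"
        by (simp add: algebra_simps abs_minus_commute)
    qed
    have "(\<lambda>n. nrm2 M (\<lambda>x. P t (g n) x - P t f x) + \<bar>(\<integral>y. g n y \<partial>M) - (\<integral>y. f y \<partial>M)\<bar>) \<longlonglongrightarrow> 0 + \<bar>(\<integral>y. f y \<partial>M) - (\<integral>y. f y \<partial>M)\<bar>"
      by (intro tendsto_intros g mean)
    then show "(\<lambda>n. nrm2 M (\<lambda>x. P t (g n) x - P t f x) + \<bar>(\<integral>y. g n y \<partial>M) - (\<integral>y. f y \<partial>M)\<bar>) \<longlonglongrightarrow> 0" by simp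
  qed
  show ?thesis
  proof (rule LIMSEQ_le)
    show "(\<lambda>n. nrm2 M (\<lambda>x. P t (g n) x - (\<integral>y. g n y \<partial>M))) \<longlonglongrightarrow> nrm2 M (\<lambda>x. P t f x - (\<integral>y. f y \<partial>M))"
      by (intro tendsto_nrm2 sqint_diff P_sqint sqint_const gs f t lim)
    show "(\<lambda>n. exp (- a * t) * nrm2 M (g n)) \<longlonglongrightarrow> exp (- a * t) * nrm2 M f"
      by (intro tendsto_mult_left tendsto_nrm2 gs f g)
    show "\<exists>N. \<forall>n\<ge>N. nrm2 M (\<lambda>x. P t (g n) x - (\<integral>y. g n y \<partial>M)) \<le> exp (- a * t) * nrm2 M (g n)"
      using mainsqrt[OF g(1)] by blast
  qed
qed

end

section \<open>Partial derivatives\<close>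

text \<open>\<open>pd\<close> is built on \<open>deriv\<close>, which has some value even where no
  derivative exists; the relation also carries existence, at every point.\<close>

definition has_pd :: "'n \<Rightarrow> (real^'n \<Rightarrow> real) \<Rightarrow> (real^'n \<Rightarrow> real) \<Rightarrow> bool" where
  "has_pd i f f' \<longleftrightarrow> (\<forall>x. ((\<lambda>t. f (x + t *\<^sub>R axis i 1)) has_real_derivative f' x) (at 0))"

lemma has_pd_imp_pd: "has_pd i f f' \<Longrightarrow> pd i f = f'"
  by (auto simp: has_pd_def pd_def fun_eq_iff intro: DERIV_imp_deriv)

lemma has_pd_line:
  assumes "has_pd i f f'"
  shows "((\<lambda>t. f (x + t *\<^sub>R axis i 1)) has_real_derivative f' (x + t *\<^sub>R axis i 1)) (at t)"
proof -
  have "((\<lambda>s. f ((x + t *\<^sub>R axis i 1) + s *\<^sub>R axis i 1)) has_real_derivative f' (x + t *\<^sub>R axis i 1)) (at 0)"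
    using assms by (simp add: has_pd_def)
  then have "((\<lambda>s. f (x + (s + t) *\<^sub>R axis i 1)) has_real_derivative f' (x + t *\<^sub>R axis i 1)) (at 0)"
    by (simp add: scaleR_add_left add_ac)
  then show ?thesis using DERIV_shift[of "\<lambda>t. f (x + t *\<^sub>R axis i 1)" _ 0 t] by simp
qed

lemma has_pd_const [simp]: "has_pd i (\<lambda>x. c) (\<lambda>x. 0)"
  by (simp add: has_pd_def)

lemma has_pd_component: "has_pd i (\<lambda>x. x $ j) (\<lambda>x. if i = j then 1 else 0)"
  unfolding has_pd_def by (auto intro!: derivative_eq_intros simp: axis_def)

lemma has_pd_add: "has_pd i f f' \<Longrightarrow> has_pd i g g' \<Longrightarrow> has_pd i (\<lambda>x. f x + g x) (\<lambda>x. f' x + g' x)"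
  by (auto simp: has_pd_def intro: DERIV_add)

lemma has_pd_diff: "has_pd i f f' \<Longrightarrow> has_pd i g g' \<Longrightarrow> has_pd i (\<lambda>x. f x - g x) (\<lambda>x. f' x - g' x)"
  by (auto simp: has_pd_def intro: DERIV_diff)

lemma has_pd_mult: "has_pd i f f' \<Longrightarrow> has_pd i g g' \<Longrightarrow> has_pd i (\<lambda>x. f x * g x) (\<lambda>x. f x * g' x + f' x * g x)"
  unfolding has_pd_def by (auto intro!: derivative_eq_intros)

lemma has_pd_cmult: "has_pd i f f' \<Longrightarrow> has_pd i (\<lambda>x. c * f x) (\<lambda>x. c * f' x)"
  unfolding has_pd_def by (auto intro!: derivative_eq_intros)

lemma has_pd_sum: "(\<And>j. j \<in> J \<Longrightarrow> has_pd i (f j) (f' j)) \<Longrightarrow> has_pd i (\<lambda>x. \<Sum>j\<in>J. f j x) (\<lambda>x. \<Sum>j\<in>J. f' j x)"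
  unfolding has_pd_def by (auto intro!: DERIV_sum)

lemma has_pd_l1: "has_pd i l1 (\<lambda>x. 1)"
proof -
  have "has_pd i (\<lambda>x. \<Sum>j\<in>UNIV. x $ j) (\<lambda>x. \<Sum>j\<in>UNIV. if i = j then 1 else 0)"
    by (intro has_pd_sum has_pd_component)
  then show ?thesis by (simp add: l1_def[abs_def])
qed

text \<open>\<open>C2\<close> asks for continuity of the second derivatives; that of the function
  and of its gradient is recovered by this lemma. One moves from \<open>x\<close> to
  \<open>y\<close> one coordinate at a time, and each move is controlled by a bound for a partial
  derivative on a cube around \<open>x\<close>.\<close>

lemma continuous_if_partials_continuous:
  fixes f :: "real^'n \<Rightarrow> real"
  assumes pd: "\<And>i. has_pd i f (f' i)" and cont: "\<And>i. continuous_on UNIV (f' i)"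
  shows "continuous_on UNIV f"
proof (intro continuous_at_imp_continuous_on ballI)
  fix x :: "real^'n"
  let ?K = "cbox (\<chi> i. x $ i - 1) (\<chi> i. x $ i + 1)"
  have "\<exists>M. \<forall>z\<in>?K. \<bar>f' i z\<bar> \<le> M" for i
  proof -
    have "compact (f' i ` ?K)" by (intro compact_continuous_image continuous_on_subset[OF cont] compact_cbox) auto
    then show ?thesis by (auto dest!: compact_imp_bounded simp: bounded_iff)
  qed
  then obtain M where M: "\<And>i z. z \<in> ?K \<Longrightarrow> \<bar>f' i z\<bar> \<le> M i" by metis
  have bound: "\<bar>f y - f x\<bar> \<le> (\<Sum>i\<in>UNIV. M i * \<bar>y $ i - x $ i\<bar>)" if y: "y \<in> ?K" for y
  proof -
    \<comment> \<open>The corner reached once the coordinates in \<open>J\<close> have been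
      moved.\<close>
    define z where "z J = (\<chi> i. if i \<in> J then y $ i else x $ i)" for J
    have "\<bar>f (z J) - f x\<bar> \<le> (\<Sum>i\<in>J. M i * \<bar>y $ i - x $ i\<bar>)" if "finite J" for J
      using that
    proof induction
      case empty
      then show ?case by (simp add: z_def vec_lambda_eta)
    next
      case (insert i J)
      define c where "c = y $ i - x $ i"
      have zi: "z (insert i J) = z J + c *\<^sub>R axis i 1"
        using insert.hyps by (auto simp: z_def c_def vec_eq_iff axis_def)
      have "\<bar>f (z J + c *\<^sub>R axis i 1) - f (z J + 0 *\<^sub>R axis i 1)\<bar> \<le> M i * \<bar>c - 0\<bar>"
      proof -
        have "norm (f (z J + c *\<^sub>R axis i 1) - f (z J + 0 *\<^sub>R axis i 1)) \<le> M i * norm (c - 0)"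
        proof (rule field_differentiable_bound[where S = "closed_segment 0 c" and f' = "\<lambda>t. f' i (z J + t *\<^sub>R axis i 1)"])
          fix t assume t: "t \<in> closed_segment 0 c"
          show "((\<lambda>t. f (z J + t *\<^sub>R axis i 1)) has_field_derivative f' i (z J + t *\<^sub>R axis i 1)) (at t within closed_segment 0 c)"
            by (rule has_field_derivative_at_within[OF has_pd_line[OF pd]])
          have yi: "x $ j - 1 \<le> y $ j \<and> y $ j \<le> x $ j + 1" for j using y by (auto simp: mem_box_cart)
          have "\<bar>t\<bar> \<le> 1"
            using t yi[of i] by (auto simp: closed_segment_eq_real_ivl c_def split: if_splits)
          then have "z J + t *\<^sub>R axis i 1 \<in> ?K"
            using yi insert.hyps by (auto simp: mem_box_cart z_def axis_def abs_le_iff)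
          then show "norm (f' i (z J + t *\<^sub>R axis i 1)) \<le> M i" using M by simp
        qed auto
        then show ?thesis by simp
      qed
      then have "\<bar>f (z (insert i J)) - f (z J)\<bar> \<le> M i * \<bar>y $ i - x $ i\<bar>"
        unfolding zi by (simp add: c_def)
      with insert show ?case by simp
    qed
    from this[of UNIV] show ?thesis by (simp add: z_def vec_lambda_eta)
  qed
  have "\<forall>\<^sub>F y in at x. y \<in> box (\<chi> i. x $ i - 1) (\<chi> i. x $ i + 1)"
    by (intro eventually_at_in_open' open_box) (auto simp: mem_box_cart)
  then have ev: "\<forall>\<^sub>F y in at x. norm (f y - f x) \<le> (\<Sum>i\<in>UNIV. M i * \<bar>y $ i - x $ i\<bar>)"
    using bound box_subset_cbox by (auto elim!: eventually_mono)
  have "((\<lambda>y. \<Sum>i\<in>UNIV. M i * \<bar>y $ i - x $ i\<bar>) \<longlongrightarrow> (\<Sum>i\<in>UNIV. M i * \<bar>x $ i - x $ i\<bar>)) (at x)"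
    by (intro tendsto_intros)
  then have "((\<lambda>y. f y - f x) \<longlongrightarrow> 0) (at x)"
    by (intro Lim_null_comparison[OF ev]) simp
  then show "isCont f x" by (simp add: isCont_def LIM_zero_iff)
qed

lemma C2_has_pd:
  assumes "C2 f"
  shows "has_pd i f (pd i f)" "has_pd j (pd i f) (pd j (pd i f))"
  using assms by (auto simp: C2_def has_pd_def pd_def[of _ _ "_ :: real^'n"] DERIV_deriv_iff_real_differentiable
      pd_def[abs_def] intro!: DERIV_deriv_iff_real_differentiable[THEN iffD2])

lemma C2_I:
  assumes "\<And>i. has_pd i f (f1 i)" "\<And>i j. has_pd j (f1 i) (f2 i j)" "\<And>i j. continuous_on UNIV (f2 i j)"
  shows "C2 f"
proof -
  have 1: "pd i f = f1 i" for i by (rule has_pd_imp_pd[OF assms(1)])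
  have 2: "pd j (f1 i) = f2 i j" for i j by (rule has_pd_imp_pd[OF assms(2)])
  show ?thesis
    using assms unfolding C2_def 1 2 has_pd_def real_differentiable_def by blast
qed

lemma C2_continuous:
  assumes "C2 f"
  shows "continuous_on UNIV f" "continuous_on UNIV (pd i f)" "continuous_on UNIV (pd j (pd i f))"
proof -
  show 2: "continuous_on UNIV (pd j (pd i f))" for i j using assms by (simp add: C2_def)
  show 1: "continuous_on UNIV (pd i f)" for i
    by (rule continuous_if_partials_continuous[OF C2_has_pd(2)[OF assms] 2])
  show "continuous_on UNIV f"
    by (rule continuous_if_partials_continuous[OF C2_has_pd(1)[OF assms] 1])
qed

lemma C2_linear:
  assumes f: "C2 f" and g: "C2 g"
  shows "C2 (\<lambda>x. c * f x + d * g x)"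
    and "pd i (\<lambda>x. c * f x + d * g x) = (\<lambda>x. c * pd i f x + d * pd i g x)"
    and "pd j (pd i (\<lambda>x. c * f x + d * g x)) = (\<lambda>x. c * pd j (pd i f) x + d * pd j (pd i g) x)"
proof -
  have 1: "has_pd i (\<lambda>x. c * f x + d * g x) (\<lambda>x. c * pd i f x + d * pd i g x)" for i
    by (intro has_pd_add has_pd_cmult C2_has_pd f g)
  have 2: "has_pd j (\<lambda>x. c * pd i f x + d * pd i g x) (\<lambda>x. c * pd j (pd i f) x + d * pd j (pd i g) x)" for i j
    by (intro has_pd_add has_pd_cmult C2_has_pd f g)
  show "C2 (\<lambda>x. c * f x + d * g x)"
    by (rule C2_I[OF 1 2]) (intro continuous_intros C2_continuous f g)
  show *: "pd i (\<lambda>x. c * f x + d * g x) = (\<lambda>x. c * pd i f x + d * pd i g x)" for i by (rule has_pd_imp_pd[OF 1])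
  show "pd j (pd i (\<lambda>x. c * f x + d * g x)) = (\<lambda>x. c * pd j (pd i f) x + d * pd j (pd i g) x)"
    unfolding * by (rule has_pd_imp_pd[OF 2])
qed

lemma C2_const: "C2 (\<lambda>x. c)"
  by (rule C2_I[of _ "\<lambda>_ _. 0" "\<lambda>_ _ _. 0"]) auto

section \<open>The Dirichlet distribution\<close>

lemma nn_integral_lborel_prod_vec:
  fixes f :: "'n::finite \<Rightarrow> real \<Rightarrow> ennreal"
  assumes [measurable]: "\<And>i. f i \<in> borel_measurable borel"
  shows "(\<integral>\<^sup>+(x::real^'n). (\<Prod>i\<in>UNIV. f i (x $ i)) \<partial>lborel) = (\<Prod>i\<in>UNIV. \<integral>\<^sup>+x. f i x \<partial>lborel)"
proof -
  have B: "(Basis :: (real^'n) set) = (\<lambda>i. axis i 1) ` UNIV"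
    by (auto simp: Basis_vec_def)
  have inj: "inj_on (\<lambda>i::'n. axis i (1::real)) UNIV" by (auto simp: inj_on_def axis_eq_axis)
  have 1: "(\<Prod>b\<in>Basis. h (axis_index b) (x \<bullet> b)) = (\<Prod>i\<in>UNIV. h i (x $ i))"
    for x :: "real^'n" and h :: "'n \<Rightarrow> real \<Rightarrow> ennreal"
    unfolding B by (subst prod.reindex[OF inj]) (simp add: axis_index_axis inner_axis o_def)
  have 2: "(\<Prod>b\<in>(Basis :: (real^'n) set). h (axis_index b)) = (\<Prod>i\<in>UNIV. h i)" for h :: "'n \<Rightarrow> ennreal"
    unfolding B by (subst prod.reindex[OF inj]) (simp add: axis_index_axis o_def)
  have "(\<integral>\<^sup>+(x::real^'n). (\<Prod>b\<in>Basis. f (axis_index b) (x \<bullet> b)) \<partial>lborel) = (\<Prod>b\<in>(Basis :: (real^'n) set). \<integral>\<^sup>+x. f (axis_index b) x \<partial>lborel)"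
    by (rule nn_integral_lborel_prod) auto
  then show ?thesis by (simp only: 1 2[of "\<lambda>i. integral\<^sup>N lborel (f i)"])
qed

lemma continuous_on_l1 [continuous_intros]: "continuous_on S g \<Longrightarrow> continuous_on S (\<lambda>x. l1 (g x))"
  unfolding l1_def by (intro continuous_intros)

lemma l1_measurable [measurable]: "l1 \<in> borel_measurable borel"
  by (intro borel_measurable_continuous_onI continuous_intros)

lemma component_measurable [measurable]: "(\<lambda>x::real^'n. x $ i) \<in> borel_measurable borel"
  by (intro borel_measurable_continuous_onI continuous_intros)

lemma closed_dsimplex: "closed (dsimplex :: (real^'n) set)"
proof -
  have "dsimplex = (\<Inter>i. {x::real^'n. 0 \<le> x $ i}) \<inter> {x. l1 x \<le> 1}" by (auto simp: dsimplex_def)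
  moreover have "closed \<dots>" by (intro closed_Int closed_INT closed_Collect_le ballI continuous_intros)
  ultimately show ?thesis by simp
qed

lemma dsimplex_component: "x \<in> dsimplex \<Longrightarrow> 0 \<le> x $ i \<and> x $ i \<le> 1"
  using member_le_sum[of i UNIV "\<lambda>i. x $ i"] by (auto simp: dsimplex_def l1_def)

lemma compact_dsimplex: "compact (dsimplex :: (real^'n) set)"
proof -
  have "(dsimplex :: (real^'n) set) \<subseteq> cbox (\<chi> i. (0::real)) (\<chi> i. (1::real))"
    by (auto simp: mem_box_cart dsimplex_component)
  then have "bounded (dsimplex :: (real^'n) set)" using bounded_cbox bounded_subset by blast
  with closed_dsimplex show ?thesis by (simp add: compact_eq_bounded_closed)
qed

lemma dsimplex_measurable [measurable]: "dsimplex \<in> sets borel"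
  by (intro borel_closed closed_dsimplex)

lemma dir_density_measurable [measurable]: "dir_density al a \<in> borel_measurable borel"
  unfolding dir_density_def by measurable

text \<open>The open simplex carries all the mass, and continuous functions that agree a.e. agree on
  it; identities between polynomials are therefore stated here.\<close>

definition usimplex :: "(real^'n) set" where
  "usimplex = {x. (\<forall>i. 0 < x $ i) \<and> l1 x < 1}"

lemma open_usimplex: "open (usimplex :: (real^'n) set)"
proof -
  have "usimplex = (\<Inter>i\<in>UNIV. {x::real^'n. 0 < x $ i}) \<inter> {x. l1 x < 1}" by (auto simp: usimplex_def)
  moreover have "open \<dots>" by (intro open_Int open_INT open_Collect_less ballI continuous_intros) auto
  ultimately show ?thesis by simp
qed

lemma usimplex_subset: "usimplex \<subseteq> dsimplex"
  by (auto simp: usimplex_def dsimplex_def less_imp_le)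

text \<open>The convention \<open>0 powr z = 0\<close> makes the density vanish on the boundary of the simplex for all
  parameters, also where the true density is infinite.\<close>

lemma dir_density_zero: "x \<notin> usimplex \<Longrightarrow> dir_density al a x = 0"
proof (cases "x \<in> dsimplex")
  case True
  assume "x \<notin> usimplex"
  with True have "(\<exists>i. x $ i = 0) \<or> l1 x = 1"
    by (force simp: usimplex_def dsimplex_def less_le)
  then show ?thesis by (auto simp: dir_density_def intro!: prod_zero)
qed (simp add: dir_density_def)

section \<open>Total mass of the Dirichlet distribution and its L2 space\<close>

locale dirichlet_params =
  fixes al :: "real^'n" and a :: real
  assumes al_pos: "\<And>i. 0 < al $ i" and a_pos: "0 < a"
begin

abbreviation \<mu> :: "(real^'n) measure" where "\<mu> \<equiv> dirichlet al a"

definition dconst :: real where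
  "dconst = Gamma (l1 al + a) / ((\<Prod>i\<in>UNIV. Gamma (al $ i)) * Gamma a)"

lemma l1_al_pos: "0 < l1 al"
  unfolding l1_def using al_pos by (intro sum_pos) auto

lemma dconst_pos: "0 < dconst"
  unfolding dconst_def using al_pos a_pos l1_al_pos
  by (intro divide_pos_pos mult_pos_pos prod_pos Gamma_real_pos) auto

lemma dir_density_nonneg: "0 \<le> dir_density al a x"
  unfolding dir_density_def dconst_def[symmetric] using dconst_pos
  by (intro mult_nonneg_nonneg prod_nonneg) auto

lemma dir_density_pos: "x \<in> usimplex \<Longrightarrow> 0 < dir_density al a x"
  unfolding dir_density_def dconst_def[symmetric] using dconst_pos usimplex_subset
  by (auto simp: usimplex_def less_imp_neq[symmetric] intro!: mult_pos_pos prod_pos)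

lemma sets_\<mu> [measurable_cong, simp]: "sets \<mu> = sets borel"
  by (simp add: dirichlet_def)

lemma space_\<mu> [simp]: "space \<mu> = UNIV"
  by (simp add: dirichlet_def)

lemma AE_\<mu>_iff:
  assumes [measurable]: "Measurable.pred borel P"
  shows "(AE x in \<mu>. P x) \<longleftrightarrow> (AE x in lborel. x \<in> usimplex \<longrightarrow> P x)"
proof -
  have "0 < ennreal (dir_density al a x) \<longleftrightarrow> x \<in> usimplex" for x
    using dir_density_zero[of x al a] dir_density_pos[of x] by (cases "x \<in> usimplex") auto
  then show ?thesis unfolding dirichlet_def by (subst AE_density) auto
qed

lemma usimplex_measurable [measurable]: "usimplex \<in> sets borel"
  by (intro borel_open open_usimplex)

lemma AE_usimplex: "AE x in \<mu>. x \<in> usimplex"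
  by (subst AE_\<mu>_iff) auto

text \<open>If \<open>y\<^sub>i \<sim> \<Gamma>(\<alpha>\<^sub>i)\<close> and \<open>z \<sim> \<Gamma>(a)\<close> are independent, then \<open>s = \<bar>y\<bar>\<^sub>1 + z\<close> and
  \<open>x = y / s\<close> are independent, and \<open>x\<close> has the Dirichlet density.\<close>

lemma emeasure_\<mu>: "emeasure \<mu> UNIV = 1"
proof -
  define N where "N = real CARD('n)"
  \<comment> \<open>The unnormalised Gamma density, extended by 0 so that every integral runs over
    the whole line.\<close>
  define g where "g b t = indicator {0..} t * t powr (b - 1) / exp t" for b t :: real
  have [measurable]: "g b \<in> borel_measurable borel" for b unfolding g_def by measurable
  have g0: "0 \<le> g b t" for b t by (simp add: g_def)
  have Gam: "(\<integral>\<^sup>+t. ennreal (g b t) \<partial>lborel) = ennreal (Gamma b)" if "0 < b" for b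
    unfolding g_def using Gamma_conv_nn_integral_real[OF that] by simp
  define W where "W x = indicator dsimplex x * (1 - l1 x) powr (a - 1) * (\<Prod>i\<in>UNIV. (x $ i) powr (al $ i - 1))" for x :: "real^'n"
  have [measurable]: "W \<in> borel_measurable borel" unfolding W_def by measurable
  have W0: "0 \<le> W x" for x unfolding W_def by (intro mult_nonneg_nonneg prod_nonneg) auto
  define G where "G y = (\<Prod>i\<in>UNIV. g (al $ i) (y $ i))" for y :: "real^'n"
  have [measurable]: "G \<in> borel_measurable borel" unfolding G_def by measurable
  have G0: "0 \<le> G y" for y unfolding G_def by (intro prod_nonneg g0)
  \<comment> \<open>With the Jacobian \<open>s ^ CARD('n)\<close> of the scaling the variables
    separate: the exponents of \<open>s\<close> add up to \<open>l1 al + a - 1\<close> and the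
    exponentials multiply to \<open>exp (- s)\<close>.\<close>
  have sc: "G (s *\<^sub>R x) * g a (s - l1 (s *\<^sub>R x)) * s ^ CARD('n) = W x * g (l1 al + a) s" if s: "0 < s" for s x
  proof (cases "x \<in> dsimplex")
    case True
    then have x: "0 \<le> x $ i" "l1 x \<le> 1" for i by (auto simp: dsimplex_def)
    have "l1 (s *\<^sub>R x) = s * l1 x" by (simp add: l1_def sum_distrib_left)
    then have e1: "s - l1 (s *\<^sub>R x) = s * (1 - l1 x)" by (simp add: algebra_simps)
    have "G (s *\<^sub>R x) = (\<Prod>i\<in>UNIV. s powr (al $ i - 1) * ((x $ i) powr (al $ i - 1)) * exp (- (s * x $ i)))"
      unfolding G_def using s x by (intro prod.cong) (auto simp: g_def powr_mult exp_minus divide_inverse)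
    also have "\<dots> = (\<Prod>i\<in>UNIV. s powr (al $ i - 1)) * (\<Prod>i\<in>UNIV. (x $ i) powr (al $ i - 1)) * exp (- (s * l1 x))"
      by (simp add: prod.distrib exp_sum[symmetric] l1_def sum_distrib_left sum_negf)
    also have "(\<Prod>i\<in>UNIV. s powr (al $ i - 1)) = s powr (l1 al - N)"
      using s by (simp add: powr_sum[symmetric] sum_subtractf l1_def N_def)
    finally have G: "G (s *\<^sub>R x) = s powr (l1 al - N) * (\<Prod>i\<in>UNIV. (x $ i) powr (al $ i - 1)) * exp (- (s * l1 x))" .
    have ga: "g a (s - l1 (s *\<^sub>R x)) = s powr (a - 1) * (1 - l1 x) powr (a - 1) * exp (- (s * (1 - l1 x)))"
      unfolding e1 g_def using s x by (simp add: powr_mult exp_minus divide_inverse)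
    have pw: "s powr (l1 al - N) * s powr (a - 1) * s ^ CARD('n) = s powr (l1 al + a - 1)"
      using s by (simp add: powr_realpow[symmetric] powr_add[symmetric] N_def add_diff_eq)
    have ex: "exp (- (s * l1 x)) * exp (- (s * (1 - l1 x))) = inverse (exp s)"
      by (simp add: exp_add[symmetric] exp_minus[symmetric] algebra_simps)
    have "G (s *\<^sub>R x) * g a (s - l1 (s *\<^sub>R x)) * s ^ CARD('n)
      = (\<Prod>i\<in>UNIV. (x $ i) powr (al $ i - 1)) * (1 - l1 x) powr (a - 1)
        * (s powr (l1 al - N) * s powr (a - 1) * s ^ CARD('n)) * (exp (- (s * l1 x)) * exp (- (s * (1 - l1 x))))"
      unfolding G ga by (simp only: mult_ac)
    also have "\<dots> = W x * g (l1 al + a) s"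
      unfolding pw ex W_def g_def using True s by (simp add: divide_inverse mult_ac)
    finally show ?thesis .
  next
    case False
    have "G (s *\<^sub>R x) * g a (s - l1 (s *\<^sub>R x)) = 0"
    proof (cases "\<exists>i. x $ i < 0")
      case True
      then obtain i where "x $ i < 0" by blast
      then have "g (al $ i) ((s *\<^sub>R x) $ i) = 0" using s by (simp add: g_def mult_less_0_iff indicator_def not_le)
      then show ?thesis unfolding G_def by (subst prod_zero[of UNIV]) auto
    next
      case nonneg: False
      with False have "1 < l1 x" by (force simp: dsimplex_def not_less)
      moreover have "l1 (s *\<^sub>R x) = s * l1 x" by (simp add: l1_def sum_distrib_left)
      ultimately have "s - l1 (s *\<^sub>R x) < 0" using s by simp
      then show ?thesis by (simp add: g_def)
    qed
    then show ?thesis using False by (simp add: W_def)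
  qed
  \<comment> \<open>Scaling by \<open>s\<close> is not invertible at \<open>s = 0\<close>, a null
    set of the outer integral. For \<open>s < 0\<close> both sides are 0.\<close>
  have inner: "(\<integral>\<^sup>+y. ennreal (G y * g a (s - l1 y)) \<partial>lborel) = ennreal (g (l1 al + a) s) * (\<integral>\<^sup>+x. ennreal (W x) \<partial>lborel)"
    if s0: "s \<noteq> 0" for s
  proof (cases "0 < s")
    case True
    have "(\<integral>\<^sup>+y. ennreal (G y * g a (s - l1 y)) \<partial>lborel)
      = (\<integral>\<^sup>+y. ennreal (G y * g a (s - l1 y)) \<partial>density (distr lborel borel (\<lambda>x. 0 + s *\<^sub>R x)) (\<lambda>_. ennreal (\<bar>s\<bar> ^ DIM(real^'n))))"
      using lborel_affine[OF s0, of "0 :: real^'n"] True by (simp add: ennreal_power)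
    also have "\<dots> = (\<integral>\<^sup>+x. ennreal (s ^ CARD('n)) * ennreal (G (s *\<^sub>R x) * g a (s - l1 (s *\<^sub>R x))) \<partial>lborel)"
      using True by (subst nn_integral_density) (auto simp: nn_integral_distr)
    also have "\<dots> = (\<integral>\<^sup>+x. ennreal (g (l1 al + a) s) * ennreal (W x) \<partial>lborel)"
    proof (intro nn_integral_cong)
      fix x :: "real^'n"
      have "ennreal (s ^ CARD('n)) * ennreal (G (s *\<^sub>R x) * g a (s - l1 (s *\<^sub>R x)))
        = ennreal (G (s *\<^sub>R x) * g a (s - l1 (s *\<^sub>R x)) * s ^ CARD('n))"
        using True by (simp add: ennreal_mult'[symmetric] mult.commute)
      also have "\<dots> = ennreal (g (l1 al + a) s * W x)" by (simp only: sc[OF True]) (simp only: mult.commute)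
      finally show "ennreal (s ^ CARD('n)) * ennreal (G (s *\<^sub>R x) * g a (s - l1 (s *\<^sub>R x)))
        = ennreal (g (l1 al + a) s) * ennreal (W x)" by (simp only: ennreal_mult'[OF g0])
    qed
    also have "\<dots> = ennreal (g (l1 al + a) s) * (\<integral>\<^sup>+x. ennreal (W x) \<partial>lborel)" by (rule nn_integral_cmult) simp
    finally show ?thesis .
  next
    case False
    with s0 have s: "s < 0" by simp
    have prod0: "G y * g a (s - l1 y) = 0" for y
    proof (cases "\<exists>i. y $ i < 0")
      case True
      then obtain i where "y $ i < 0" by blast
      then have "g (al $ i) (y $ i) = 0" by (simp add: g_def)
      then show ?thesis unfolding G_def by (subst prod_zero[of UNIV]) auto
    next
      case False
      then have "0 \<le> l1 y" by (auto simp: l1_def not_less intro!: sum_nonneg)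
      with s have "s - l1 y < 0" by simp
      then show ?thesis by (simp add: g_def)
    qed
    have "g (l1 al + a) s = 0" using s by (simp add: g_def)
    then show ?thesis by (simp only: prod0) simp
  qed
  have "ennreal ((\<Prod>i\<in>UNIV. Gamma (al $ i)) * Gamma a) = (\<Prod>i\<in>UNIV. ennreal (Gamma (al $ i))) * ennreal (Gamma a)"
    using al_pos by (subst ennreal_mult') (auto simp: prod_ennreal Gamma_real_nonneg less_imp_le intro!: prod_nonneg)
  also have "\<dots> = (\<Prod>i\<in>UNIV. \<integral>\<^sup>+t. ennreal (g (al $ i) t) \<partial>lborel) * ennreal (Gamma a)"
    using al_pos by (simp add: Gam)
  also have "\<dots> = (\<integral>\<^sup>+(y::real^'n). (\<Prod>i\<in>UNIV. ennreal (g (al $ i) (y $ i))) \<partial>lborel) * ennreal (Gamma a)"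
    by (subst nn_integral_lborel_prod_vec) auto
  also have "\<dots> = (\<integral>\<^sup>+y. ennreal (G y) \<partial>lborel) * ennreal (Gamma a)"
    unfolding G_def by (simp add: prod_ennreal g0)
  also have "\<dots> = (\<integral>\<^sup>+y. ennreal (G y) * ennreal (Gamma a) \<partial>lborel)"
    by (rule nn_integral_multc[symmetric]) simp
  \<comment> \<open>The last Gamma variable is shifted by \<open>l1 y\<close>, so that
    \<open>s\<close> becomes the sum of all the variables.\<close>
  also have "\<dots> = (\<integral>\<^sup>+y. \<integral>\<^sup>+s. ennreal (G y * g a (s - l1 y)) \<partial>lborel \<partial>lborel)"
  proof (intro nn_integral_cong)
    fix y :: "real^'n"
    have "ennreal (Gamma a) = (\<integral>\<^sup>+s. ennreal (g a s) \<partial>lborel)" using Gam a_pos by simp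
    also have "\<dots> = (\<integral>\<^sup>+s. ennreal (g a (s - l1 y)) \<partial>lborel)"
      using nn_integral_real_affine[of "\<lambda>s. ennreal (g a s)" 1 "- l1 y"] by (simp add: add.commute)
    finally show "ennreal (G y) * ennreal (Gamma a) = (\<integral>\<^sup>+s. ennreal (G y * g a (s - l1 y)) \<partial>lborel)"
      by (simp add: nn_integral_cmult[symmetric] ennreal_mult' G0)
  qed
  also have "\<dots> = (\<integral>\<^sup>+s. \<integral>\<^sup>+y. ennreal (G y * g a (s - l1 y)) \<partial>lborel \<partial>lborel)"
    by (rule lborel_pair.Fubini') measurable
  also have "\<dots> = (\<integral>\<^sup>+s. ennreal (g (l1 al + a) s) * (\<integral>\<^sup>+x. ennreal (W x) \<partial>lborel) \<partial>lborel)"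
    using AE_lborel_singleton[of "0::real"] by (intro nn_integral_cong_AE) (auto elim!: eventually_mono simp: inner)
  also have "\<dots> = ennreal (Gamma (l1 al + a)) * (\<integral>\<^sup>+x. ennreal (W x) \<partial>lborel)"
    using l1_al_pos a_pos by (simp add: nn_integral_multc Gam)
  finally have key: "ennreal ((\<Prod>i\<in>UNIV. Gamma (al $ i)) * Gamma a) = ennreal (Gamma (l1 al + a)) * (\<integral>\<^sup>+x. ennreal (W x) \<partial>lborel)" .
  have pos: "0 < (\<Prod>i\<in>UNIV. Gamma (al $ i)) * Gamma a" "0 < Gamma (l1 al + a)"
    using al_pos a_pos l1_al_pos by (auto intro!: mult_pos_pos prod_pos Gamma_real_pos)
  have dd: "dir_density al a x = dconst * W x" for x
    by (simp add: dir_density_def W_def dconst_def)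
  have "emeasure \<mu> UNIV = (\<integral>\<^sup>+x. ennreal (dir_density al a x) \<partial>lborel)"
    unfolding dirichlet_def by (subst emeasure_density) auto
  also have "\<dots> = ennreal dconst * (\<integral>\<^sup>+x. ennreal (W x) \<partial>lborel)"
    unfolding dd using dconst_pos by (simp add: ennreal_mult' nn_integral_cmult)
  also have "\<dots> = ennreal (1 / ((\<Prod>i\<in>UNIV. Gamma (al $ i)) * Gamma a)) * (ennreal (Gamma (l1 al + a)) * (\<integral>\<^sup>+x. ennreal (W x) \<partial>lborel))"
    unfolding dconst_def using pos by (simp add: ennreal_mult'[symmetric] mult.assoc[symmetric])
  also have "\<dots> = ennreal (1 / ((\<Prod>i\<in>UNIV. Gamma (al $ i)) * Gamma a)) * ennreal ((\<Prod>i\<in>UNIV. Gamma (al $ i)) * Gamma a)"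
    unfolding key ..
  also have "\<dots> = 1"
  proof -
    have "ennreal (1 / Q) * ennreal Q = 1" if "0 < Q" for Q :: real
      using that by (simp add: ennreal_mult'[symmetric])
    from this[OF pos(1)] show ?thesis .
  qed
  finally show ?thesis .
qed

sublocale finite_measure \<mu>
  by (rule finite_measureI) (simp add: emeasure_\<mu>)

lemma measure_\<mu>: "measure \<mu> UNIV = 1"
  by (simp add: measure_def emeasure_\<mu>)

lemma bounded_on_dsimplex:
  fixes h :: "real^'n \<Rightarrow> real"
  assumes "continuous_on UNIV h"
  obtains B where "0 \<le> B" "\<And>x. x \<in> dsimplex \<Longrightarrow> \<bar>h x\<bar> \<le> B"
proof -
  have "compact (h ` dsimplex)"
    by (intro compact_continuous_image compact_dsimplex continuous_on_subset[OF assms]) auto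
  then obtain B where "\<forall>x\<in>dsimplex. \<bar>h x\<bar> \<le> B" by (auto dest!: compact_imp_bounded simp: bounded_iff)
  then show ?thesis using that[of "\<bar>B\<bar>"] by force
qed

lemma integrable_continuous:
  fixes h :: "real^'n \<Rightarrow> real"
  assumes h: "continuous_on UNIV h"
  shows "integrable \<mu> h"
proof -
  obtain B where B: "\<And>x. x \<in> dsimplex \<Longrightarrow> \<bar>h x\<bar> \<le> B" using bounded_on_dsimplex[OF h] by blast
  show ?thesis
  proof (rule integrable_const_bound)
    show "AE x in \<mu>. norm (h x) \<le> B" using AE_usimplex usimplex_subset B by (auto elim!: eventually_mono)
    show "h \<in> borel_measurable \<mu>" using borel_measurable_continuous_onI[OF h] by simp
  qed
qed

lemma sqint_continuous:
  fixes h :: "real^'n \<Rightarrow> real"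
  assumes h: "continuous_on UNIV h"
  shows "sqint \<mu> h"
  using integrable_continuous[of "\<lambda>x. (h x)\<^sup>2"] borel_measurable_continuous_onI[OF h]
  by (auto simp: sqint_def intro!: continuous_intros h)

text \<open>On the open simplex the density is positive, so the open set where \<open>h\<close> is
  nonzero would be Lebesgue null; a nonempty open set is not.\<close>

lemma AE_zero_imp_zero:
  fixes h :: "real^'n \<Rightarrow> real"
  assumes h: "continuous_on UNIV h" and ae: "AE x in \<mu>. h x = 0" and x: "x \<in> usimplex"
  shows "h x = 0"
proof (rule ccontr)
  assume hx: "h x \<noteq> 0"
  have [measurable]: "h \<in> borel_measurable borel" by (rule borel_measurable_continuous_onI[OF h])
  let ?V = "usimplex \<inter> {x. h x \<noteq> 0}"
  have "open ?V" by (intro open_Int open_usimplex open_Collect_neq h continuous_intros)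
  moreover have "x \<in> ?V" using x hx by simp
  moreover have "AE x in lborel. x \<in> usimplex \<longrightarrow> h x = 0" using ae by (subst (asm) AE_\<mu>_iff) auto
  then have "AE x in lborel. x \<notin> ?V" by (auto elim: eventually_mono)
  then have "?V \<in> null_sets lborel" by (subst (asm) AE_iff_null_sets[symmetric]) auto
  then have "negligible ?V" by (simp add: negligible_iff_null_sets null_sets_completionI)
  ultimately show False using open_not_negligible by blast
qed

lemma L2_iff_sqint: "L2 al a f \<longleftrightarrow> sqint \<mu> f"
proof -
  have "borel_measurable \<mu> = (borel_measurable borel :: (real^'n \<Rightarrow> real) set)"
    by (rule measurable_cong_sets) auto
  then show ?thesis by (simp add: L2_def sqint_def)
qed

lemma L2norm_eq_nrm2: "L2norm al a f = nrm2 \<mu> f"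
  by (simp add: L2norm_def nrm2_def)

end

section \<open>Integration by parts\<close>

text \<open>The cut-off \<open>max 0\<close> extends the one-dimensional factors of the density by 0
  to the whole line, with one derivative formula on both sides of the kink. A line through the
  simplex need not be split where it enters and leaves.\<close>

lemma DERIV_max_powr:
  assumes "y \<noteq> 0"
  shows "((\<lambda>y::real. max 0 y powr b) has_real_derivative b * max 0 y powr (b - 1)) (at y)"
proof (cases "0 < y")
  case True
  have "((\<lambda>y::real. y powr b) has_real_derivative b * y powr (b - 1)) (at y)"
    by (rule has_real_derivative_powr[OF True])
  then have "((\<lambda>y::real. max 0 y powr b) has_real_derivative b * y powr (b - 1)) (at y)"
    by (rule DERIV_cong_ev[OF refl _ refl, THEN iffD1, rotated])
      (use True in \<open>auto intro!: eventually_mono[OF eventually_nhds_in_open[of "{0<..}" y]]\<close>)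
  with True show ?thesis by simp
next
  case False
  with assms have y: "y < 0" by simp
  have "((\<lambda>y::real. 0) has_real_derivative 0) (at y)" by simp
  then have "((\<lambda>y::real. max 0 y powr b) has_real_derivative 0) (at y)"
    by (rule DERIV_cong_ev[OF refl _ refl, THEN iffD1, rotated])
      (use y in \<open>auto intro!: eventually_mono[OF eventually_nhds_in_open[of "{..<0}" y]]\<close>)
  with y show ?thesis by simp
qed

lemma powr_max_shift:
  assumes "y \<noteq> 0" shows "y * max 0 y powr (b - 1) = max 0 (y::real) powr b"
  using assms by (cases "0 < y") (auto simp: powr_diff max_def)

text \<open>A positive exponent gives continuity across 0. It is used for \<open>al $ n\<close> and
  \<open>a\<close>, the exponents that remain after the density is multiplied by
  \<open>x $ n * (1 - l1 x)\<close>, even where the density itself is unbounded.\<close>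

lemma continuous_max_powr:
  assumes "0 < b" "continuous_on S f"
  shows "continuous_on S (\<lambda>x. max 0 (f x) powr b :: real)"
  using assms by (intro continuous_on_powr' continuous_intros) auto

text \<open>The integral of a function over a line in direction \<open>e\<close> is an increment of \<open>F\<close>; by Fubini
  and translation invariance, \<open>\<integral> D = \<integral> (F (x + e) - F x) dx = 0\<close>.\<close>

lemma integral_directional_derivative_eq_0:
  fixes F D :: "'a::euclidean_space \<Rightarrow> real"
  assumes F: "integrable lborel F" and D: "integrable lborel D"
    and ftc: "\<And>x. ((\<lambda>t. D (x + t *\<^sub>R e)) has_integral (F (x + e) - F x)) {0..1}"
  shows "(\<integral>x. D x \<partial>lborel) = 0"
proof -
  have [measurable]: "F \<in> borel_measurable borel" "D \<in> borel_measurable borel" using F D by auto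
  have trans: "integrable lborel (\<lambda>x. f (x + c))" "(\<integral>x. f (x + c) \<partial>lborel) = (\<integral>x. f x \<partial>lborel)"
    if "integrable lborel f" for f :: "'a \<Rightarrow> real" and c
  proof -
    have "integrable (distr lborel borel ((+) c)) f" "(\<integral>x. f x \<partial>distr lborel borel ((+) c)) = (\<integral>x. f x \<partial>lborel)"
      using that unfolding lborel_distr_plus by auto
    then show "integrable lborel (\<lambda>x. f (x + c))" "(\<integral>x. f (x + c) \<partial>lborel) = (\<integral>x. f x \<partial>lborel)"
      using that by (auto simp: integrable_distr_eq integral_distr add.commute)
  qed
  \<comment> \<open>\<open>D\<close> is spread over the unit time interval. Each time slice is a
    translate of \<open>D\<close>, so \<open>H\<close> is integrable on the product and has the same
    total integral as \<open>D\<close>.\<close>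
  define H where "H p = indicator {0..1::real} (fst p) * D (snd p + fst p *\<^sub>R e)" for p
  have [measurable]: "H \<in> borel_measurable (lborel \<Otimes>\<^sub>M lborel)" unfolding H_def by measurable
  have int: "integrable (lborel \<Otimes>\<^sub>M lborel) H"
  proof (rule lborel_pair.Fubini_integrable)
    have "(\<integral>y. norm (H (t, y)) \<partial>lborel) = indicator {0..1} t * (\<integral>x. \<bar>D x\<bar> \<partial>lborel)" for t
      using trans(2)[of "\<lambda>x. \<bar>D x\<bar>" "t *\<^sub>R e"] D by (auto simp: H_def abs_mult)
    then show "integrable lborel (\<lambda>t. \<integral>y. norm (H (t, y)) \<partial>lborel)" by simp
    show "AE t in lborel. integrable lborel (\<lambda>y. H (t, y))"
      using trans(1)[OF D] by (auto simp: H_def)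
  qed simp
  have "(\<integral>y. H (t, y) \<partial>lborel) = indicator {0..1} t * (\<integral>x. D x \<partial>lborel)" for t
    using trans(2)[OF D, of "t *\<^sub>R e"] by (simp add: H_def)
  then have "(\<integral>t. (\<integral>y. H (t, y) \<partial>lborel) \<partial>lborel) = (\<integral>x. D x \<partial>lborel)"
    by simp
  moreover have "(\<integral>y. (\<integral>t. H (t, y) \<partial>lborel) \<partial>lborel) = (\<integral>t. (\<integral>y. H (t, y) \<partial>lborel) \<partial>lborel)"
    using lborel_pair.Fubini_integral[of "\<lambda>t y. H (t, y)"] int by simp
  moreover have "(\<integral>y. (\<integral>t. H (t, y) \<partial>lborel) \<partial>lborel) = (\<integral>y. F (y + e) - F y \<partial>lborel)"
  proof (rule integral_cong_AE)
    show "AE y in lborel. (\<integral>t. H (t, y) \<partial>lborel) = F (y + e) - F y"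
      using lborel_pair.AE_integrable_fst'[OF lborel_pair.integrable_product_swap[OF int]]
    proof eventually_elim
      case (elim y)
      then have "set_integrable lborel {0..1} (\<lambda>t. D (y + t *\<^sub>R e))"
        by (simp add: set_integrable_def H_def)
      from set_borel_integral_eq_integral(2)[OF this] ftc[of y] show ?case
        by (simp add: set_lebesgue_integral_def H_def integral_unique)
    qed
    show "(\<lambda>y. \<integral>t. H (t, y) \<partial>lborel) \<in> borel_measurable lborel"
      by measurable
  qed measurable
  moreover have "(\<integral>y. F (y + e) - F y \<partial>lborel) = 0"
    using trans[OF F, of e] F by simp
  ultimately show ?thesis by simp
qed

context dirichlet_params
begin

text \<open>With the other coordinates fixed, the density is a Beta weight of the moving coordinate
  on the interval from 0 to \<open>r\<close>. The \<open>max\<close> factors make the formula valid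
  for every \<open>t\<close>, also when \<open>r \<le> 0\<close>.\<close>

lemma density_line:
  fixes x :: "real^'n" and n :: 'n
  assumes pos: "\<And>j. j \<noteq> n \<Longrightarrow> 0 < x $ j"
  defines "K \<equiv> dconst * (\<Prod>i\<in>UNIV-{n}. (x $ i) powr (al $ i - 1))" and "r \<equiv> 1 - (l1 x - x $ n)"
  shows "dir_density al a (x + t *\<^sub>R axis n 1)
    = K * (max 0 (x $ n + t) powr (al $ n - 1) * max 0 (r - (x $ n + t)) powr (a - 1))"
proof -
  let ?x = "x + t *\<^sub>R axis n 1"
  have comp: "?x $ i = (if i = n then x $ n + t else x $ i)" for i by (simp add: axis_def)
  have l1: "l1 ?x = l1 x + t"
    by (simp add: l1_def sum.distrib axis_def if_distrib[of "\<lambda>z. t * z"] cong: if_cong)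
  have "?x \<in> dsimplex \<longleftrightarrow> 0 \<le> x $ n + t \<and> x $ n + t \<le> r"
  proof -
    have "(\<forall>i. 0 \<le> ?x $ i) \<longleftrightarrow> 0 \<le> x $ n + t"
      unfolding comp using pos by (auto simp: less_imp_le)
    then show ?thesis unfolding dsimplex_def mem_Collect_eq l1 r_def by auto
  qed
  moreover have "(\<Prod>i\<in>UNIV. (?x $ i) powr (al $ i - 1)) = (x $ n + t) powr (al $ n - 1) * (\<Prod>i\<in>UNIV-{n}. (x $ i) powr (al $ i - 1))"
    unfolding comp by (subst prod.remove[of _ n]) (auto intro!: prod.cong)
  moreover have "1 - l1 ?x = r - (x $ n + t)" by (simp add: l1 r_def)
  ultimately show ?thesis
    unfolding dir_density_def dconst_def[symmetric] K_def by (auto simp: indicator_def max_def not_le)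
qed

text \<open>The integrand times the density is the derivative in direction \<open>n\<close> of
  \<open>F\<close>: the weight \<open>(x $ n) powr (al $ n) * (1 - l1 x) powr a\<close> has
  logarithmic derivative \<open>al $ n / x $ n - a / (1 - l1 x)\<close>. Both exponents are
  positive, so \<open>F\<close> vanishes at the ends of each segment and no boundary terms
  arise.\<close>

lemma integration_by_parts_coordinate:
  assumes pd: "has_pd n \<phi> \<phi>'" and cont: "continuous_on UNIV \<phi>" "continuous_on UNIV \<phi>'"
  shows "(\<integral>x. x $ n * (1 - l1 x) * \<phi>' x + (al $ n * (1 - l1 x) - a * x $ n) * \<phi> x \<partial>\<mu>) = 0"
proof -
  define d where "d x = x $ n * (1 - l1 x) * \<phi>' x + (al $ n * (1 - l1 x) - a * x $ n) * \<phi> x" for x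
  define D where "D x = dir_density al a x * d x" for x
  define F where "F x = dir_density al a x * (x $ n * (1 - l1 x) * \<phi> x)" for x
  have conv: "integrable lborel (\<lambda>x. dir_density al a x * h x)"
    "(\<integral>x. h x \<partial>\<mu>) = (\<integral>x. dir_density al a x * h x \<partial>lborel)" if h: "continuous_on UNIV h" for h
  proof -
    have [measurable]: "h \<in> borel_measurable borel" by (rule borel_measurable_continuous_onI[OF h])
    show "integrable lborel (\<lambda>x. dir_density al a x * h x)"
      using integrable_continuous[OF h] unfolding dirichlet_def
      by (subst (asm) integrable_density) (auto simp: dir_density_nonneg)
    show "(\<integral>x. h x \<partial>\<mu>) = (\<integral>x. dir_density al a x * h x \<partial>lborel)"
      unfolding dirichlet_def by (subst integral_density) (auto simp: dir_density_nonneg)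
  qed
  have cd: "continuous_on UNIV d" unfolding d_def by (intro continuous_intros cont)
  have cF: "continuous_on UNIV (\<lambda>x. x $ n * (1 - l1 x) * \<phi> x)" by (intro continuous_intros cont)
  have "(\<integral>x. D x \<partial>lborel) = 0"
  proof (rule integral_directional_derivative_eq_0)
    show "integrable lborel F" unfolding F_def by (rule conv(1)[OF cF])
    show "integrable lborel D" unfolding D_def by (rule conv(1)[OF cd])
    fix x :: "real^'n"
    let ?e = "axis n 1 :: real^'n"
    show "((\<lambda>t. D (x + t *\<^sub>R ?e)) has_integral (F (x + ?e) - F x)) {0..1}"
    proof (cases "\<forall>j. j \<noteq> n \<longrightarrow> 0 < x $ j")
      case False
      then obtain j where j: "j \<noteq> n" "x $ j \<le> 0" by (auto simp: not_less)
      have "dir_density al a (x + t *\<^sub>R ?e) = 0" for t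
      proof (rule dir_density_zero)
        have "(x + t *\<^sub>R ?e) $ j \<le> 0" using j by (simp add: axis_def)
        then show "x + t *\<^sub>R ?e \<notin> usimplex" unfolding usimplex_def using not_less by blast
      qed
      then have "D (x + t *\<^sub>R ?e) = 0" "F (x + t *\<^sub>R ?e) = 0" for t by (simp_all add: D_def F_def)
      from this(1) this(2)[of 1] this(2)[of 0] show ?thesis by simp
    next
      case True
      define K where "K = dconst * (\<Prod>i\<in>UNIV-{n}. (x $ i) powr (al $ i - 1))"
      define r where "r = 1 - (l1 x - x $ n)"
      define p where "p t = \<phi> (x + t *\<^sub>R ?e)" for t
      define p' where "p' t = \<phi>' (x + t *\<^sub>R ?e)" for t
      have dens: "dir_density al a (x + t *\<^sub>R ?e) = K * (max 0 (x $ n + t) powr (al $ n - 1) * max 0 (r - (x $ n + t)) powr (a - 1))" for t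
        unfolding K_def r_def using True by (intro density_line) auto
      have comp: "(x + t *\<^sub>R ?e) $ n = x $ n + t" for t by (simp add: axis_def)
      have "l1 (x + t *\<^sub>R ?e) = l1 x + t" for t
        by (simp add: l1_def sum.distrib axis_def if_distrib[of "\<lambda>z. t * z"] cong: if_cong)
      then have l1: "1 - l1 (x + t *\<^sub>R ?e) = r - (x $ n + t)" for t by (simp add: r_def)
      define u where "u t = max 0 (x $ n + t) powr (al $ n)" for t
      define v where "v t = max 0 (r - (x $ n + t)) powr a" for t
      define u' where "u' t = al $ n * max 0 (x $ n + t) powr (al $ n - 1)" for t
      define v' where "v' t = - (a * max 0 (r - (x $ n + t)) powr (a - 1))" for t
      have mp: "y * max 0 y powr (b - 1) = max 0 y powr b" if "0 < b" for y b :: real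
        by (cases "y = 0") (use that in \<open>simp_all add: powr_max_shift\<close>)
      have Fu: "F (x + t *\<^sub>R ?e) = K * (u t * v t * p t)" for t
        unfolding F_def dens comp l1 u_def v_def p_def mp[OF a_pos, symmetric] mp[OF al_pos, symmetric] by (simp only: mult_ac)
      have Du: "D (x + t *\<^sub>R ?e) = K * (u t * v t * p' t + (u t * v' t + u' t * v t) * p t)" for t
        unfolding D_def d_def dens comp l1 u_def v_def u'_def v'_def p_def p'_def mp[OF a_pos, symmetric] mp[OF al_pos, symmetric]
        by (simp add: algebra_simps)
      have du: "(u has_real_derivative u' t) (at t)" if "x $ n + t \<noteq> 0" for t
      proof -
        have "((\<lambda>t. x $ n + t) has_real_derivative 1) (at t)" by (auto intro!: derivative_eq_intros)
        from DERIV_chain2[OF DERIV_max_powr[OF that] this] show ?thesis unfolding u_def u'_def by simp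
      qed
      have dv: "(v has_real_derivative v' t) (at t)" if "r - (x $ n + t) \<noteq> 0" for t
      proof -
        have "((\<lambda>t. r - (x $ n + t)) has_real_derivative - 1) (at t)" by (auto intro!: derivative_eq_intros)
        from DERIV_chain2[OF DERIV_max_powr[OF that] this] show ?thesis unfolding v_def v'_def by simp
      qed
      have dp: "(p has_real_derivative p' t) (at t)" for t
        unfolding p_def p'_def by (rule has_pd_line[OF pd])
      have "((\<lambda>t. D (x + t *\<^sub>R ?e)) has_integral (F (x + 1 *\<^sub>R ?e) - F (x + 0 *\<^sub>R ?e))) {0..1}"
      proof (rule fundamental_theorem_of_calculus_interior_strong)
        \<comment> \<open>The two times at which the line meets the hyperplanes
          \<open>x $ n = 0\<close> and \<open>l1 x = 1\<close>: there \<open>F\<close> is continuous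
          but possibly not differentiable.\<close>
        show "finite {- x $ n, r - x $ n}" by simp
        show "continuous_on {0..1} (\<lambda>t. F (x + t *\<^sub>R ?e))"
          unfolding Fu u_def v_def p_def using al_pos[of n] a_pos
          by (intro continuous_intros continuous_max_powr continuous_on_compose2[OF cont(1)]) auto
        fix t assume t: "t \<in> {0<..<1} - {- x $ n, r - x $ n}"
        then have nz: "x $ n + t \<noteq> 0" "r - (x $ n + t) \<noteq> 0" by auto
        have "((\<lambda>t. K * (u t * v t * p t)) has_real_derivative K * (u t * v t * p' t + (u t * v' t + u' t * v t) * p t)) (at t)"
          by (auto intro!: derivative_eq_intros du dv dp nz simp: algebra_simps)
        then show "((\<lambda>t. F (x + t *\<^sub>R ?e)) has_vector_derivative D (x + t *\<^sub>R ?e)) (at t)"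
          unfolding Fu Du has_real_derivative_iff_has_vector_derivative .
      qed simp
      then show ?thesis by simp
    qed
  qed
  then show ?thesis using conv(2)[OF cd] by (simp add: D_def d_def)
qed

text \<open>The coordinate identity for the product of \<open>f\<close> with \<open>pd n g\<close>,
  summed over \<open>n\<close>.\<close>

theorem integration_by_parts:
  assumes f: "C2 f" and g: "C2 g"
  shows "(\<integral>x. f x * Lop al a g x \<partial>\<mu>) = - E0 al a f g"
proof -
  note c = C2_continuous[OF f] C2_continuous[OF g]
  have 0: "(\<integral>x. x $ n * (1 - l1 x) * (f x * pd n (pd n g) x + pd n f x * pd n g x)
      + (al $ n * (1 - l1 x) - a * x $ n) * (f x * pd n g x) \<partial>\<mu>) = 0" for n
    by (intro integration_by_parts_coordinate has_pd_mult C2_has_pd f g continuous_intros c)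
  have "(\<integral>x. f x * Lop al a g x \<partial>\<mu>) + E0 al a f g
    = (\<integral>x. f x * Lop al a g x + (1 - l1 x) * (\<Sum>i\<in>UNIV. x $ i * pd i f x * pd i g x) \<partial>\<mu>)"
    unfolding E0_def Lop_def
    by (intro Bochner_Integration.integral_add[symmetric] integrable_continuous continuous_intros c)
  also have "\<dots> = (\<integral>x. (\<Sum>n\<in>UNIV. x $ n * (1 - l1 x) * (f x * pd n (pd n g) x + pd n f x * pd n g x)
      + (al $ n * (1 - l1 x) - a * x $ n) * (f x * pd n g x)) \<partial>\<mu>)"
    unfolding Lop_def sum_distrib_left sum.distrib[symmetric]
    by (intro Bochner_Integration.integral_cong sum.cong) (auto simp: algebra_simps)
  also have "\<dots> = (\<Sum>n\<in>UNIV. \<integral>x. x $ n * (1 - l1 x) * (f x * pd n (pd n g) x + pd n f x * pd n g x)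
      + (al $ n * (1 - l1 x) - a * x $ n) * (f x * pd n g x) \<partial>\<mu>)"
    by (intro Bochner_Integration.integral_sum integrable_continuous continuous_intros c)
  also have "\<dots> = 0" by (simp only: 0 sum.neutral_const)
  finally show ?thesis by simp
qed

lemma E0_commute: "E0 al a f g = E0 al a g f"
  unfolding E0_def by (simp add: mult_ac)

lemma E0_nonneg: "0 \<le> E0 al a f f"
  unfolding E0_def
proof (rule integral_nonneg_AE)
  show "AE x in \<mu>. 0 \<le> (1 - l1 x) * (\<Sum>i\<in>UNIV. x $ i * pd i f x * pd i f x)"
    using AE_usimplex
  proof eventually_elim
    case (elim x)
    then have "0 \<le> x $ i" "0 \<le> 1 - l1 x" for i by (auto simp: usimplex_def less_imp_le)
    then show ?case
      unfolding mult.assoc by (intro mult_nonneg_nonneg sum_nonneg zero_le_square)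
  qed
qed

lemma E0_linear:
  assumes f: "C2 f" and g: "C2 g" and h: "C2 h"
  shows "E0 al a (\<lambda>x. c * f x + d * g x) h = c * E0 al a f h + d * E0 al a g h"
    and "E0 al a h (\<lambda>x. c * f x + d * g x) = c * E0 al a h f + d * E0 al a h g"
proof -
  note c = C2_continuous[OF f] C2_continuous[OF g] C2_continuous[OF h]
  show 1: "E0 al a (\<lambda>x. c * f x + d * g x) h = c * E0 al a f h + d * E0 al a g h"
  proof -
    have "c * E0 al a f h + d * E0 al a g h
      = (\<integral>x. c * ((1 - l1 x) * (\<Sum>i\<in>UNIV. x $ i * pd i f x * pd i h x)) + d * ((1 - l1 x) * (\<Sum>i\<in>UNIV. x $ i * pd i g x * pd i h x)) \<partial>\<mu>)"
      unfolding E0_def by (subst Bochner_Integration.integral_add) (auto intro!: integrable_continuous continuous_intros c)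
    also have "\<dots> = E0 al a (\<lambda>x. c * f x + d * g x) h"
      unfolding E0_def C2_linear(2)[OF f g]
      by (intro Bochner_Integration.integral_cong) (auto simp: sum_distrib_left sum.distrib[symmetric] algebra_simps intro!: sum.cong)
    finally show ?thesis ..
  qed
  then show "E0 al a h (\<lambda>x. c * f x + d * g x) = c * E0 al a h f + d * E0 al a h g"
    by (simp add: E0_commute[of h])
qed

lemma Lop_continuous: "C2 f \<Longrightarrow> continuous_on UNIV (Lop al a f)"
  unfolding Lop_def by (intro continuous_intros C2_continuous)

end

section \<open>Polynomials\<close>

definition vmono :: "('n::finite \<Rightarrow> nat) \<Rightarrow> real^'n \<Rightarrow> real" where
  "vmono \<beta> x = (\<Prod>i\<in>UNIV. (x $ i) ^ \<beta> i)"

definition mdeg :: "('n::finite \<Rightarrow> nat) \<Rightarrow> nat" where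
  "mdeg \<beta> = (\<Sum>i\<in>UNIV. \<beta> i)"

definition polys :: "nat \<Rightarrow> (real^'n \<Rightarrow> real) set" where
  "polys k = {p. \<exists>c. p = (\<lambda>x. \<Sum>\<beta> | mdeg \<beta> \<le> k. c \<beta> * vmono \<beta> x)}"

lemma finite_mdeg: "finite {\<beta> :: 'n::finite \<Rightarrow> nat. mdeg \<beta> \<le> k}"
proof (rule finite_subset)
  show "{\<beta> :: 'n \<Rightarrow> nat. mdeg \<beta> \<le> k} \<subseteq> PiE UNIV (\<lambda>_. {..k})"
  proof
    fix \<beta> :: "'n \<Rightarrow> nat" assume "\<beta> \<in> {\<beta>. mdeg \<beta> \<le> k}"
    moreover have "\<beta> i \<le> mdeg \<beta>" for i unfolding mdeg_def by (rule member_le_sum) auto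
    ultimately show "\<beta> \<in> PiE UNIV (\<lambda>_. {..k})" by (auto intro: order_trans)
  qed
  show "finite (PiE (UNIV :: 'n set) (\<lambda>_. {..k}))" by (rule finite_PiE) auto
qed

lemma polys_lincomb:
  assumes "p \<in> polys k" "q \<in> polys k"
  shows "(\<lambda>x. c * p x + d * q x) \<in> polys k"
proof -
  obtain u v where "p = (\<lambda>x. \<Sum>\<beta> | mdeg \<beta> \<le> k. u \<beta> * vmono \<beta> x)" "q = (\<lambda>x. \<Sum>\<beta> | mdeg \<beta> \<le> k. v \<beta> * vmono \<beta> x)"
    using assms by (auto simp: polys_def)
  then have "(\<lambda>x. c * p x + d * q x) = (\<lambda>x. \<Sum>\<beta> | mdeg \<beta> \<le> k. (c * u \<beta> + d * v \<beta>) * vmono \<beta> x)"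
    by (auto simp: sum_distrib_left sum.distrib[symmetric] algebra_simps)
  then show ?thesis unfolding polys_def by (intro CollectI exI[of _ "\<lambda>\<beta>. c * u \<beta> + d * v \<beta>"])
qed

lemma polys_zero: "(\<lambda>x. 0) \<in> polys k"
  unfolding polys_def by (intro CollectI exI[of _ "\<lambda>_. 0"]) simp

lemma polys_cmult: "p \<in> polys k \<Longrightarrow> (\<lambda>x. c * p x) \<in> polys k"
  using polys_lincomb[of p k p c 0] by simp

lemma polys_add: "p \<in> polys k \<Longrightarrow> q \<in> polys k \<Longrightarrow> (\<lambda>x. p x + q x) \<in> polys k"
  using polys_lincomb[of p k q 1 1] by simp

lemma polys_sum: "(\<And>j. j \<in> J \<Longrightarrow> p j \<in> polys k) \<Longrightarrow> (\<lambda>x. \<Sum>j\<in>J. p j x) \<in> polys k"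
  by (induction J rule: infinite_finite_induct) (simp_all add: polys_add polys_zero)

lemma vmono_in_polys: "mdeg \<beta> \<le> k \<Longrightarrow> vmono \<beta> \<in> polys k"
  unfolding polys_def
  by (intro CollectI exI[of _ "\<lambda>\<gamma>. if \<gamma> = \<beta> then 1 else 0"])
    (auto simp: if_distrib[of "\<lambda>c. c * _"] sum.delta'[OF finite_mdeg] sum.delta[OF finite_mdeg] cong: if_cong)

lemma polys_mono:
  assumes "k \<le> l" shows "polys k \<subseteq> polys l"
proof
  fix p :: "real^'a \<Rightarrow> real" assume "p \<in> polys k"
  then obtain c where p: "p = (\<lambda>x. \<Sum>\<beta> | mdeg \<beta> \<le> k. c \<beta> * vmono \<beta> x)" by (auto simp: polys_def)
  show "p \<in> polys l" unfolding p using assms by (intro polys_sum polys_cmult vmono_in_polys) auto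
qed

lemma vmono_mult: "vmono \<beta> x * vmono \<gamma> x = vmono (\<lambda>i. \<beta> i + \<gamma> i) x"
  by (simp add: vmono_def power_add prod.distrib)

lemma polys_mult:
  assumes "p \<in> polys k" "q \<in> polys l"
  shows "(\<lambda>x. p x * q x) \<in> polys (k + l)"
proof -
  obtain u v where p: "p = (\<lambda>x. \<Sum>\<beta> | mdeg \<beta> \<le> k. u \<beta> * vmono \<beta> x)" and q: "q = (\<lambda>x. \<Sum>\<beta> | mdeg \<beta> \<le> l. v \<beta> * vmono \<beta> x)"
    using assms by (auto simp: polys_def)
  have "(\<lambda>x. \<Sum>\<beta> | mdeg \<beta> \<le> k. \<Sum>\<gamma> | mdeg \<gamma> \<le> l. (u \<beta> * v \<gamma>) * vmono (\<lambda>i. \<beta> i + \<gamma> i) x) \<in> polys (k + l)"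
    by (intro polys_sum polys_cmult vmono_in_polys) (auto simp: mdeg_def sum.distrib intro: add_mono)
  then show ?thesis unfolding p q sum_product by (simp add: vmono_mult[symmetric] mult_ac)
qed

lemma vmono_0: "vmono (\<lambda>_. 0) x = 1"
  by (simp add: vmono_def)

lemma polys_const: "(\<lambda>x. c) \<in> polys k"
  using polys_cmult[OF vmono_in_polys[of "\<lambda>_. 0" k], of c] by (simp add: vmono_0 mdeg_def)

lemma vmono_single: "vmono (\<lambda>j. if j = i then 1 else 0) x = x $ i"
  by (simp add: vmono_def if_distrib[of "\<lambda>e. _ ^ e"] prod.delta cong: if_cong)

lemma polys_component: "(\<lambda>x. x $ i) \<in> polys 1"
  using vmono_in_polys[of "\<lambda>j. if j = i then 1 else 0" 1] by (simp add: vmono_single[abs_def] mdeg_def)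

text \<open>The bridge to the Stone-Weierstrass theorem, whose polynomials are generated inductively
  and carry no degree.\<close>

lemma real_polynomial_function_in_polys:
  fixes p :: "real^'n \<Rightarrow> real"
  assumes "real_polynomial_function p"
  shows "\<exists>k. p \<in> polys k"
  using assms
proof induction
  case (linear f)
  have "f x = (\<Sum>i\<in>UNIV. f (axis i 1) * x $ i)" for x
  proof -
    interpret bounded_linear f by fact
    have "f x = f (\<Sum>i\<in>UNIV. (x $ i) *\<^sub>R axis i 1)"
      by (rule arg_cong[of _ _ f]) (simp add: vec_eq_iff axis_def if_distrib[of "\<lambda>z. _ * z"] cong: if_cong)
    then show ?thesis by (simp add: sum scaleR mult.commute)
  qed
  then have "f = (\<lambda>x. \<Sum>i\<in>UNIV. f (axis i 1) * x $ i)" by blast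
  moreover have "(\<lambda>x. \<Sum>i\<in>UNIV. f (axis i 1) * x $ i) \<in> polys 1"
    by (intro polys_sum polys_cmult polys_component)
  ultimately show ?case by metis
next
  case (const c)
  then show ?case using polys_const by blast
next
  case (add f g)
  then obtain k l where "f \<in> polys k" "g \<in> polys l" by blast
  then have "f \<in> polys (max k l)" "g \<in> polys (max k l)" using polys_mono[of k "max k l"] polys_mono[of l "max k l"] by auto
  then show ?case using polys_add by blast
next
  case (mult f g)
  then show ?case using polys_mult by blast
qed

text \<open>Truncated subtraction leaves a multi-index with \<open>\<beta> i = 0\<close> unchanged;
  such terms come with the factor \<open>real (\<beta> i)\<close>, hence vanish.\<close>

definition dec :: "('n \<Rightarrow> nat) \<Rightarrow> 'n \<Rightarrow> 'n \<Rightarrow> nat" where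
  "dec \<beta> i = \<beta>(i := \<beta> i - 1)"

lemma vmono_split: "vmono \<beta> x = (x $ i) ^ \<beta> i * (\<Prod>j\<in>UNIV-{i}. (x $ j) ^ \<beta> j)"
  unfolding vmono_def by (subst prod.remove[of _ i]) auto

lemma vmono_dec_split: "vmono (dec \<beta> i) x = (x $ i) ^ (\<beta> i - 1) * (\<Prod>j\<in>UNIV-{i}. (x $ j) ^ \<beta> j)"
  unfolding vmono_split[of _ _ i] by (auto simp: dec_def intro!: prod.cong)

lemma has_pd_vmono: "has_pd i (vmono \<beta>) (\<lambda>x. real (\<beta> i) * vmono (dec \<beta> i) x)"
  unfolding has_pd_def
proof
  fix x :: "real^'a"
  have "vmono \<beta> (x + t *\<^sub>R axis i 1) = (x $ i + t) ^ \<beta> i * (\<Prod>j\<in>UNIV-{i}. (x $ j) ^ \<beta> j)" for t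
    unfolding vmono_split[of _ _ i] by (auto simp: axis_def intro!: prod.cong)
  moreover have "((\<lambda>t. (x $ i + t) ^ \<beta> i * (\<Prod>j\<in>UNIV-{i}. (x $ j) ^ \<beta> j)) has_real_derivative
      real (\<beta> i) * (x $ i) ^ (\<beta> i - 1) * (\<Prod>j\<in>UNIV-{i}. (x $ j) ^ \<beta> j)) (at 0)"
    by (auto intro!: derivative_eq_intros)
  ultimately show "((\<lambda>t. vmono \<beta> (x + t *\<^sub>R axis i 1)) has_real_derivative real (\<beta> i) * vmono (dec \<beta> i) x) (at 0)"
    by (simp add: vmono_dec_split mult.assoc)
qed

lemma mdeg_split: "mdeg \<beta> = \<beta> i + (\<Sum>j\<in>UNIV-{i}. \<beta> j)"
  unfolding mdeg_def by (rule sum.remove) auto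

lemma mdeg_dec: "mdeg (dec \<beta> i) = \<beta> i - 1 + (\<Sum>j\<in>UNIV-{i}. \<beta> j)"
  unfolding mdeg_split[of _ i] by (auto simp: dec_def intro!: sum.cong)

lemma mdeg_dec_pos: "0 < \<beta> i \<Longrightarrow> Suc (mdeg (dec \<beta> i)) = mdeg \<beta>"
  unfolding mdeg_dec mdeg_split[of \<beta> i] by simp

lemma polys_has_pd:
  assumes "p \<in> polys k"
  shows "\<exists>p' \<in> polys k. has_pd i p p'"
proof -
  obtain c where p: "p = (\<lambda>x. \<Sum>\<beta> | mdeg \<beta> \<le> k. c \<beta> * vmono \<beta> x)" using assms by (auto simp: polys_def)
  have "has_pd i p (\<lambda>x. \<Sum>\<beta> | mdeg \<beta> \<le> k. c \<beta> * (real (\<beta> i) * vmono (dec \<beta> i) x))"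
    unfolding p by (intro has_pd_sum has_pd_cmult has_pd_vmono)
  moreover have "(\<lambda>x. \<Sum>\<beta> | mdeg \<beta> \<le> k. c \<beta> * (real (\<beta> i) * vmono (dec \<beta> i) x)) \<in> polys k"
  proof (intro polys_sum polys_cmult vmono_in_polys)
    fix \<beta> :: "'a \<Rightarrow> nat" assume "\<beta> \<in> {\<beta>. mdeg \<beta> \<le> k}"
    then show "mdeg (dec \<beta> i) \<le> k" by (auto simp: mdeg_dec mdeg_split[of \<beta> i])
  qed
  ultimately show ?thesis by blast
qed

lemma polys_pd: "p \<in> polys k \<Longrightarrow> pd i p \<in> polys k" "p \<in> polys k \<Longrightarrow> has_pd i p (pd i p)"
  using polys_has_pd[of p k i] has_pd_imp_pd by metis+

lemma vmono_continuous: "continuous_on S (vmono \<beta>)"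
  unfolding vmono_def[abs_def] by (intro continuous_intros)

lemma polys_continuous: "p \<in> polys k \<Longrightarrow> continuous_on S p"
  by (auto simp: polys_def intro!: continuous_intros vmono_continuous)

lemma polys_C2: "p \<in> polys k \<Longrightarrow> C2 p"
  by (rule C2_I[where ?f1.0 = "\<lambda>i. pd i p" and ?f2.0 = "\<lambda>i j. pd j (pd i p)"])
    (simp_all add: polys_pd(2) polys_continuous[OF polys_pd(1)[OF polys_pd(1)]] polys_pd(2)[OF polys_pd(1)])

lemma C2_sum:
  assumes f: "\<And>j. j \<in> J \<Longrightarrow> C2 (f j)"
  shows "C2 (\<lambda>x. \<Sum>j\<in>J. c j * f j x)"
    and "pd i (\<lambda>x. \<Sum>j\<in>J. c j * f j x) = (\<lambda>x. \<Sum>j\<in>J. c j * pd i (f j) x)"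
    and "pd l (pd i (\<lambda>x. \<Sum>j\<in>J. c j * f j x)) = (\<lambda>x. \<Sum>j\<in>J. c j * pd l (pd i (f j)) x)"
proof -
  have 1: "has_pd i (\<lambda>x. \<Sum>j\<in>J. c j * f j x) (\<lambda>x. \<Sum>j\<in>J. c j * pd i (f j) x)" for i
    by (intro has_pd_sum has_pd_cmult C2_has_pd f)
  have 2: "has_pd l (\<lambda>x. \<Sum>j\<in>J. c j * pd i (f j) x) (\<lambda>x. \<Sum>j\<in>J. c j * pd l (pd i (f j)) x)" for i l
    by (intro has_pd_sum has_pd_cmult C2_has_pd f)
  show "C2 (\<lambda>x. \<Sum>j\<in>J. c j * f j x)"
    by (rule C2_I[OF 1 2]) (intro continuous_intros C2_continuous f)
  show *: "pd i (\<lambda>x. \<Sum>j\<in>J. c j * f j x) = (\<lambda>x. \<Sum>j\<in>J. c j * pd i (f j) x)" for i by (rule has_pd_imp_pd[OF 1])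
  show "pd l (pd i (\<lambda>x. \<Sum>j\<in>J. c j * f j x)) = (\<lambda>x. \<Sum>j\<in>J. c j * pd l (pd i (f j)) x)"
    unfolding * by (rule has_pd_imp_pd[OF 2])
qed

section \<open>The operators D and E on polynomials and their commutation relations\<close>

definition Dop :: "real^'n \<Rightarrow> (real^'n \<Rightarrow> real) \<Rightarrow> real^'n \<Rightarrow> real" where
  "Dop al f x = (\<Sum>i\<in>UNIV. x $ i * pd i (pd i f) x + al $ i * pd i f x)"

definition Eop :: "(real^'n \<Rightarrow> real) \<Rightarrow> real^'n \<Rightarrow> real" where
  "Eop f x = (\<Sum>i\<in>UNIV. x $ i * pd i f x)"

lemma Lop_eq: "Lop al a f x = (1 - l1 x) * Dop al f x - a * Eop f x"
  unfolding Lop_def Dop_def Eop_def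
  by (simp add: sum_distrib_left sum_subtractf[symmetric] algebra_simps)

lemma Dop_sum:
  assumes f: "\<And>j. j \<in> J \<Longrightarrow> C2 (f j)"
  shows "Dop al (\<lambda>x. \<Sum>j\<in>J. c j * f j x) = (\<lambda>x. \<Sum>j\<in>J. c j * Dop al (f j) x)"
proof
  fix x
  have C: "pd i (\<lambda>x. \<Sum>j\<in>J. c j * f j x) = (\<lambda>x. \<Sum>j\<in>J. c j * pd i (f j) x)"
    "pd l (\<lambda>x. \<Sum>j\<in>J. c j * pd i (f j) x) = (\<lambda>x. \<Sum>j\<in>J. c j * pd l (pd i (f j)) x)" for i l
    using C2_sum(2,3)[of J f] f by auto
  show "Dop al (\<lambda>x. \<Sum>j\<in>J. c j * f j x) x = (\<Sum>j\<in>J. c j * Dop al (f j) x)"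
    unfolding Dop_def C sum_distrib_left sum.distrib[symmetric]
    by (subst sum.swap) (simp add: algebra_simps)
qed

lemma Eop_sum:
  assumes f: "\<And>j. j \<in> J \<Longrightarrow> C2 (f j)"
  shows "Eop (\<lambda>x. \<Sum>j\<in>J. c j * f j x) = (\<lambda>x. \<Sum>j\<in>J. c j * Eop (f j) x)"
proof
  fix x
  have C: "pd i (\<lambda>x. \<Sum>j\<in>J. c j * f j x) = (\<lambda>x. \<Sum>j\<in>J. c j * pd i (f j) x)" for i
    using C2_sum(2)[of J f] f by auto
  show "Eop (\<lambda>x. \<Sum>j\<in>J. c j * f j x) x = (\<Sum>j\<in>J. c j * Eop (f j) x)"
    unfolding Eop_def C sum_distrib_left
    by (subst sum.swap) (simp add: algebra_simps)
qed

lemma Lop_sum: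
  assumes f: "\<And>j. j \<in> J \<Longrightarrow> C2 (f j)"
  shows "Lop al a (\<lambda>x. \<Sum>j\<in>J. c j * f j x) = (\<lambda>x. \<Sum>j\<in>J. c j * Lop al a (f j) x)"
  unfolding Lop_eq[abs_def] using Dop_sum[of J f] Eop_sum[of J f] f
  by (simp add: sum_distrib_left sum_subtractf[symmetric] algebra_simps)

lemma pd_vmono: "pd i (vmono \<beta>) = (\<lambda>x. real (\<beta> i) * vmono (dec \<beta> i) x)"
  by (rule has_pd_imp_pd[OF has_pd_vmono])

lemma vmono_dec_mult: "real (\<beta> i) * (x $ i * vmono (dec \<beta> i) x) = real (\<beta> i) * vmono \<beta> x"
  unfolding vmono_dec_split vmono_split[of \<beta> x i] by (cases "\<beta> i") auto

lemma Eop_vmono: "Eop (vmono \<beta>) x = real (mdeg \<beta>) * vmono \<beta> x"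
proof -
  have "Eop (vmono \<beta>) x = (\<Sum>i\<in>UNIV. real (\<beta> i) * (x $ i * vmono (dec \<beta> i) x))"
    unfolding Eop_def pd_vmono by (simp add: mult.left_commute)
  then show ?thesis unfolding vmono_dec_mult by (simp add: mdeg_def sum_distrib_right)
qed

lemma Dop_vmono: "Dop al (vmono \<beta>) x = (\<Sum>i\<in>UNIV. real (\<beta> i) * (real (\<beta> i - 1) + al $ i) * vmono (dec \<beta> i) x)"
proof -
  have 2: "pd i (pd i (vmono \<beta>)) = (\<lambda>x. real (\<beta> i) * (real (\<beta> i - 1) * vmono (dec (dec \<beta> i) i) x))" for i
    unfolding pd_vmono by (subst has_pd_imp_pd[OF has_pd_cmult[OF has_pd_vmono]]) (simp add: dec_def)
  have 3: "real (\<beta> i - 1) * (x $ i * vmono (dec (dec \<beta> i) i) x) = real (\<beta> i - 1) * vmono (dec \<beta> i) x" for i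
    using vmono_dec_mult[of "dec \<beta> i" i x] by (simp add: dec_def)
  have "x $ i * pd i (pd i (vmono \<beta>)) x = real (\<beta> i) * (real (\<beta> i - 1) * (x $ i * vmono (dec (dec \<beta> i) i) x))" for i
    unfolding 2 by (simp only: mult_ac)
  then have "x $ i * pd i (pd i (vmono \<beta>)) x + al $ i * pd i (vmono \<beta>) x
      = real (\<beta> i) * (real (\<beta> i - 1) + al $ i) * vmono (dec \<beta> i) x" for i
    unfolding 3 by (simp add: pd_vmono algebra_simps)
  then show ?thesis by (simp add: Dop_def)
qed

text \<open>\<open>Dop\<close> lowers the degree by one and \<open>Eop\<close> multiplies by the
  degree. The real difference \<open>real (mdeg \<beta>) - 1\<close> is harmless at degree 0, where
  \<open>Dop\<close> of the monomial is 0.\<close>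

lemma Dop_vmono_homogeneous:
  "Eop (Dop al (vmono \<beta>)) x = (real (mdeg \<beta>) - 1) * Dop al (vmono \<beta>) x"
proof -
  have "Eop (Dop al (vmono \<beta>)) x = (\<Sum>i\<in>UNIV. (real (\<beta> i) * (real (\<beta> i - 1) + al $ i)) * Eop (vmono (dec \<beta> i)) x)"
    unfolding Dop_vmono[abs_def] by (subst Eop_sum) (auto intro: polys_C2 vmono_in_polys)
  also have "\<dots> = (\<Sum>i\<in>UNIV. (real (mdeg \<beta>) - 1) * (real (\<beta> i) * (real (\<beta> i - 1) + al $ i) * vmono (dec \<beta> i) x))"
  proof (rule sum.cong[OF refl])
    fix i
    show "(real (\<beta> i) * (real (\<beta> i - 1) + al $ i)) * Eop (vmono (dec \<beta> i)) x
        = (real (mdeg \<beta>) - 1) * (real (\<beta> i) * (real (\<beta> i - 1) + al $ i) * vmono (dec \<beta> i) x)"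
      using mdeg_dec_pos[of \<beta> i] by (cases "\<beta> i = 0") (simp_all add: Eop_vmono algebra_simps flip: mdeg_dec_pos)
  qed
  finally show ?thesis by (simp add: Dop_vmono sum_distrib_left)
qed

lemma Dop_in_polys:
  assumes "p \<in> polys k" shows "Dop al p \<in> polys k"
proof -
  obtain c where p: "p = (\<lambda>x. \<Sum>\<beta> | mdeg \<beta> \<le> k. c \<beta> * vmono \<beta> x)" using assms by (auto simp: polys_def)
  have "Dop al p = (\<lambda>x. \<Sum>\<beta> | mdeg \<beta> \<le> k. c \<beta> * (\<Sum>i\<in>UNIV. real (\<beta> i) * (real (\<beta> i - 1) + al $ i) * vmono (dec \<beta> i) x))"
    unfolding p by (subst Dop_sum) (auto intro: polys_C2 vmono_in_polys simp: Dop_vmono)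
  moreover have "\<dots> \<in> polys k"
  proof (intro polys_sum polys_cmult vmono_in_polys)
    fix \<beta> :: "'a \<Rightarrow> nat" and i assume "\<beta> \<in> {\<beta>. mdeg \<beta> \<le> k}"
    then show "mdeg (dec \<beta> i) \<le> k" by (auto simp: mdeg_dec mdeg_split[of \<beta> i])
  qed
  ultimately show ?thesis by simp
qed

text \<open>The factor \<open>1 - l1 x\<close> raises the degree by one, but only after
  \<open>Dop\<close> has lowered it.\<close>

lemma Lop_in_polys:
  assumes "p \<in> polys k" shows "Lop al a p \<in> polys k"
proof -
  obtain c where p: "p = (\<lambda>x. \<Sum>\<beta> | mdeg \<beta> \<le> k. c \<beta> * vmono \<beta> x)" using assms by (auto simp: polys_def)
  have "Lop al a (vmono \<beta>) \<in> polys k" if \<beta>: "mdeg \<beta> \<le> k" for \<beta>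
  proof -
    have "(\<lambda>x. real (\<beta> i) * (real (\<beta> i - 1) + al $ i) * ((1 - l1 x) * vmono (dec \<beta> i) x)) \<in> polys k" for i
    proof (cases "\<beta> i = 0")
      case True then show ?thesis by (simp add: polys_zero)
    next
      case False
      have "(\<lambda>x. 1 + (\<Sum>i\<in>UNIV. - 1 * x $ i)) \<in> polys 1"
        by (intro polys_add polys_const polys_sum polys_cmult polys_component)
      then have "(\<lambda>x. 1 - l1 x) \<in> polys 1" by (simp add: l1_def sum_negf)
      from polys_mult[OF this vmono_in_polys[OF order_refl, of "dec \<beta> i"]]
      have "(\<lambda>x. (1 - l1 x) * vmono (dec \<beta> i) x) \<in> polys (mdeg \<beta>)" using False mdeg_dec_pos[of \<beta> i] by simp
      then show ?thesis using polys_mono[OF \<beta>] by (intro polys_cmult) auto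
    qed
    then have "(\<lambda>x. (\<Sum>i\<in>UNIV. real (\<beta> i) * (real (\<beta> i - 1) + al $ i) * ((1 - l1 x) * vmono (dec \<beta> i) x))
        + (- a * real (mdeg \<beta>)) * vmono \<beta> x) \<in> polys k"
      by (rule polys_add[OF polys_sum polys_cmult[OF vmono_in_polys[OF \<beta>]]])
    moreover have "Lop al a (vmono \<beta>) = (\<lambda>x. (\<Sum>i\<in>UNIV. real (\<beta> i) * (real (\<beta> i - 1) + al $ i) * ((1 - l1 x) * vmono (dec \<beta> i) x))
        + (- a * real (mdeg \<beta>)) * vmono \<beta> x)"
      by (simp add: fun_eq_iff Lop_eq Dop_vmono Eop_vmono sum_distrib_left mult_ac)
    ultimately show ?thesis by simp
  qed
  then show ?thesis
    unfolding p by (subst Lop_sum) (auto intro!: polys_sum polys_cmult intro: polys_C2 vmono_in_polys)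
qed

text \<open>Leibniz rule: every first derivative of \<open>1 - l1 x\<close> is -1. The mixed
  second-order terms add up to \<open>- 2 * Eop f x\<close>, which later shifts \<open>a\<close> to
  \<open>a + 2\<close>, and the first-order terms of \<open>Dop\<close> contribute
  \<open>- l1 al * f x\<close>.\<close>

lemma Dop_one_minus_l1:
  assumes f: "C2 f"
  shows "Dop al (\<lambda>x. (1 - l1 x) * f x) x = (1 - l1 x) * Dop al f x - 2 * Eop f x - l1 al * f x"
proof -
  have l: "has_pd i (\<lambda>x. 1 - l1 x) (\<lambda>x. - 1)" for i :: 'a
    using has_pd_diff[OF has_pd_const has_pd_l1, of i 1] by simp
  have 1: "pd i (\<lambda>x. (1 - l1 x) * f x) = (\<lambda>x. (1 - l1 x) * pd i f x - f x)" for i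
    using has_pd_imp_pd[OF has_pd_mult[OF l C2_has_pd(1)[OF f]], of i] by simp
  have 2: "pd i (\<lambda>x. (1 - l1 x) * pd i f x - f x) = (\<lambda>x. (1 - l1 x) * pd i (pd i f) x - 2 * pd i f x)" for i
    using has_pd_imp_pd[OF has_pd_diff[OF has_pd_mult[OF l C2_has_pd(2)[OF f]] C2_has_pd(1)[OF f]], of i i] by (simp add: algebra_simps)
  have A: "l1 al * f x = (\<Sum>i\<in>UNIV. al $ i * f x)" by (simp add: l1_def sum_distrib_right)
  show ?thesis
    unfolding Dop_def 1 2 Eop_def A
    by (simp add: sum_distrib_left sum_subtractf[symmetric] algebra_simps)
qed

text \<open>On homogeneous polynomials of degree \<open>m\<close>, \<open>L\<^sub>a = (1 - \<bar>x\<bar>\<^sub>1) D - a m\<close>, and \<open>D\<close> lowers the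
  degree by one.\<close>

lemma Dop_Lop_intertwine:
  assumes "p \<in> polys k"
  shows "Dop al (Lop al a p) x = Lop al (a + 2) (Dop al p) x - (l1 al + a) * Dop al p x"
proof -
  obtain c where p: "p = (\<lambda>x. \<Sum>\<beta> | mdeg \<beta> \<le> k. c \<beta> * vmono \<beta> x)" using assms by (auto simp: polys_def)
  have C: "C2 (vmono \<beta>)" "C2 (Dop al (vmono \<beta>))" "C2 (Lop al a (vmono \<beta>))" for \<beta> :: "'a \<Rightarrow> nat"
    using vmono_in_polys[OF order_refl, of \<beta>] by (auto intro: polys_C2 Dop_in_polys Lop_in_polys)
  have key: "Dop al (Lop al a (vmono \<beta>)) x = Lop al (a + 2) (Dop al (vmono \<beta>)) x - (l1 al + a) * Dop al (vmono \<beta>) x" for \<beta>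
  proof -
    define Q where "Q = Dop al (vmono \<beta>)"
    \<comment> \<open>The sum over \<open>bool\<close> encodes two summands, so that
      \<open>Dop_sum\<close> applies.\<close>
    have "Lop al a (vmono \<beta>) = (\<lambda>x. \<Sum>b\<in>UNIV. (if b then 1 else - a * real (mdeg \<beta>)) * (if b then (\<lambda>x. (1 - l1 x) * Q x) else vmono \<beta>) x)"
      by (simp add: fun_eq_iff Lop_eq Eop_vmono Q_def UNIV_bool)
    moreover have "C2 (\<lambda>x. (1 - l1 x) * Q x)"
    proof -
      have "(\<lambda>x. 1 + (\<Sum>i\<in>UNIV. - 1 * x $ i)) \<in> polys 1"
        by (intro polys_add polys_const polys_sum polys_cmult polys_component)
      then have "(\<lambda>x. 1 - l1 x) \<in> polys 1" by (simp add: l1_def sum_negf)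
      moreover have "Q \<in> polys (mdeg \<beta>)" unfolding Q_def by (intro Dop_in_polys vmono_in_polys) simp
      ultimately show ?thesis using polys_mult polys_C2 by blast
    qed
    then have "Dop al (\<lambda>x. \<Sum>b\<in>UNIV. (if b then 1 else - a * real (mdeg \<beta>)) * (if b then (\<lambda>x. (1 - l1 x) * Q x) else vmono \<beta>) x)
      = (\<lambda>x. \<Sum>b\<in>UNIV. (if b then 1 else - a * real (mdeg \<beta>)) * Dop al (if b then (\<lambda>x. (1 - l1 x) * Q x) else vmono \<beta>) x)"
      by (intro Dop_sum) (auto simp: C)
    ultimately have "Dop al (Lop al a (vmono \<beta>)) x = Dop al (\<lambda>x. (1 - l1 x) * Q x) x - a * real (mdeg \<beta>) * Q x"
      by (simp add: UNIV_bool Q_def)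
    also have "\<dots> = (1 - l1 x) * Dop al Q x - 2 * Eop Q x - l1 al * Q x - a * real (mdeg \<beta>) * Q x"
      using C(2)[of \<beta>] by (subst Dop_one_minus_l1) (auto simp: Q_def)
    \<comment> \<open>As \<open>Q\<close> is homogeneous of degree one less than
      \<open>\<beta>\<close>, the term \<open>a * real (mdeg \<beta>) * Q x\<close> splits into
      \<open>a * Eop Q x\<close>, which joins \<open>2 * Eop Q x\<close>, and
      \<open>a * Q x\<close>.\<close>
    also have "\<dots> = Lop al (a + 2) Q x - (l1 al + a) * Q x"
      unfolding Lop_eq Q_def Dop_vmono_homogeneous by (simp add: algebra_simps)
    finally show ?thesis unfolding Q_def .
  qed
  show ?thesis
    unfolding p Lop_sum[OF C(1)] Dop_sum[OF C(3)] Dop_sum[OF C(1)] Lop_sum[OF C(2)] key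
    by (simp add: sum_distrib_left sum_subtractf[symmetric] algebra_simps)
qed

section \<open>The spectral gap on polynomials\<close>

lemma pd_const [simp]: "pd i (\<lambda>x. c) = (\<lambda>x. 0)"
  by (rule has_pd_imp_pd[OF has_pd_const])

text \<open>Differentiation is local, so an equation known on the open simplex alone may be
  differentiated there.\<close>

lemma pd_cong_open:
  assumes U: "open U" "x \<in> U" and eq: "\<And>y. y \<in> U \<Longrightarrow> f y = g y"
  shows "pd i f x = pd i g x"
  unfolding pd_def
proof (rule deriv_cong_ev[OF _ refl])
  have "((\<lambda>t::real. x + t *\<^sub>R axis i 1) \<longlongrightarrow> x + 0 *\<^sub>R axis i 1) (nhds 0)"
    by (intro tendsto_intros filterlim_ident)
  then have "\<forall>\<^sub>F t in nhds (0::real). x + t *\<^sub>R axis i 1 \<in> U"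
    by (rule topological_tendstoD) (use U in auto)
  then show "\<forall>\<^sub>F t in nhds (0::real). f (x + t *\<^sub>R axis i 1) = g (x + t *\<^sub>R axis i 1)"
    by eventually_elim (rule eq)
qed

lemma Dop_cong_open:
  assumes U: "open U" "x \<in> U" and eq: "\<And>y. y \<in> U \<Longrightarrow> f y = g y"
  shows "Dop al f x = Dop al g x"
  unfolding Dop_def by (intro sum.cong refl) (simp add: pd_cong_open[OF U eq] pd_cong_open[OF U pd_cong_open[OF U(1) _ eq]])

section \<open>Inner product, orthonormal bases and Rayleigh quotients of polynomials\<close>

context dirichlet_params
begin

definition ip :: "(real^'n \<Rightarrow> real) \<Rightarrow> (real^'n \<Rightarrow> real) \<Rightarrow> real" where
  "ip f g = (\<integral>x. f x * g x \<partial>\<mu>)"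

lemma ip_commute: "ip f g = ip g f"
  by (simp add: ip_def mult.commute)

lemma ip_sum_left:
  assumes "\<And>i. i \<in> I \<Longrightarrow> continuous_on UNIV (f i)" "continuous_on UNIV g"
  shows "ip (\<lambda>x. \<Sum>i\<in>I. c i * f i x) g = (\<Sum>i\<in>I. c i * ip (f i) g)"
proof -
  have "ip (\<lambda>x. \<Sum>i\<in>I. c i * f i x) g = (\<integral>x. (\<Sum>i\<in>I. c i * (f i x * g x)) \<partial>\<mu>)"
    by (simp add: ip_def sum_distrib_right mult.assoc)
  also have "\<dots> = (\<Sum>i\<in>I. \<integral>x. c i * (f i x * g x) \<partial>\<mu>)"
    by (intro Bochner_Integration.integral_sum integrable_continuous continuous_intros assms)
  finally show ?thesis by (simp add: ip_def)
qed

lemma ip_sum_right: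
  assumes "\<And>i. i \<in> I \<Longrightarrow> continuous_on UNIV (f i)" "continuous_on UNIV g"
  shows "ip g (\<lambda>x. \<Sum>i\<in>I. c i * f i x) = (\<Sum>i\<in>I. c i * ip g (f i))"
  using ip_sum_left[of I f g c] assms by (simp add: ip_commute)

lemma ip_lincomb:
  assumes "continuous_on UNIV f" "continuous_on UNIV g" "continuous_on UNIV h"
  shows "ip (\<lambda>x. c * f x + d * g x) h = c * ip f h + d * ip g h"
    and "ip h (\<lambda>x. c * f x + d * g x) = c * ip h f + d * ip h g"
proof -
  have "ip (\<lambda>x. c * f x + d * g x) h = (\<integral>x. c * (f x * h x) + d * (g x * h x) \<partial>\<mu>)"
    by (simp add: ip_def algebra_simps)
  also have "\<dots> = (\<integral>x. c * (f x * h x) \<partial>\<mu>) + (\<integral>x. d * (g x * h x) \<partial>\<mu>)"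
    by (intro Bochner_Integration.integral_add integrable_continuous continuous_intros assms)
  finally show "ip (\<lambda>x. c * f x + d * g x) h = c * ip f h + d * ip g h" by (simp add: ip_def)
  then show "ip h (\<lambda>x. c * f x + d * g x) = c * ip h f + d * ip h g" by (simp add: ip_commute)
qed

lemma ip_diff:
  assumes "continuous_on UNIV f" "continuous_on UNIV g" "continuous_on UNIV h"
  shows "ip (\<lambda>x. f x - g x) h = ip f h - ip g h" and "ip h (\<lambda>x. f x - g x) = ip h f - ip h g"
  using ip_lincomb[OF assms, of 1 "- 1"] by simp_all

lemma ip_self: "ip f f = (nrm2 \<mu> f)\<^sup>2"
  unfolding ip_def nrm2_sq by (simp add: power2_eq_square)

lemma ip_self_eq_0:
  assumes f: "continuous_on UNIV f" and 0: "ip f f = 0" and x: "x \<in> usimplex"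
  shows "f x = 0"
proof -
  have "AE x in \<mu>. f x = 0" using 0 nrm2_eq_0_iff[OF sqint_continuous[OF f]] by (simp add: ip_self)
  then show ?thesis by (rule AE_zero_imp_zero[OF f _ x])
qed

lemma ip_cong:
  assumes "\<And>x. x \<in> usimplex \<Longrightarrow> f x = f' x" "continuous_on UNIV f" "continuous_on UNIV f'" "continuous_on UNIV g"
  shows "ip f g = ip f' g"
proof -
  have [measurable]: "f \<in> borel_measurable borel" "f' \<in> borel_measurable borel" "g \<in> borel_measurable borel"
    using assms by (auto intro: borel_measurable_continuous_onI)
  show ?thesis unfolding ip_def
    using AE_usimplex by (intro integral_cong_AE) (auto elim!: eventually_mono simp: assms(1))
qed

lemma ip_Lop:
  assumes "C2 f" "C2 g" shows "ip f (Lop al a g) = - E0 al a f g"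
  unfolding ip_def by (rule integration_by_parts[OF assms])

lemma E0_sum:
  assumes f: "\<And>i. i \<in> I \<Longrightarrow> C2 (f i)" and g: "C2 g"
  shows "E0 al a (\<lambda>x. \<Sum>i\<in>I. c i * f i x) g = (\<Sum>i\<in>I. c i * E0 al a (f i) g)"
proof -
  have "C2 (\<lambda>x. \<Sum>i\<in>I. c i * f i x)" using f by (rule C2_sum(1))
  then have "- E0 al a (\<lambda>x. \<Sum>i\<in>I. c i * f i x) g = ip (\<lambda>x. \<Sum>i\<in>I. c i * f i x) (Lop al a g)"
    using ip_Lop g by simp
  also have "\<dots> = (\<Sum>i\<in>I. c i * ip (f i) (Lop al a g))"
    by (intro ip_sum_left C2_continuous Lop_continuous f g)
  also have "\<dots> = (\<Sum>i\<in>I. - (c i * E0 al a (f i) g))"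
    by (intro sum.cong refl) (simp add: ip_Lop f g)
  finally show ?thesis by (simp add: sum_negf)
qed

text \<open>After integration by parts all derivatives fall on \<open>g\<close>, so the values of
  \<open>f\<close> on the open simplex decide.\<close>

lemma E0_cong:
  assumes eq: "\<And>x. x \<in> usimplex \<Longrightarrow> f x = f' x" and C: "C2 f" "C2 f'" "C2 g"
  shows "E0 al a f g = E0 al a f' g"
  using ip_cong[OF eq C2_continuous(1)[OF C(1)] C2_continuous(1)[OF C(2)] Lop_continuous[OF C(3)]]
  by (simp add: ip_Lop C)

text \<open>\<open>B\<close> may be linearly dependent: a residual of norm 0 is dropped, any other
  is normalised and appended. A residual of norm 0 is known to vanish on the open simplex, hence the
  restriction in the expansion.\<close>

lemma gram_schmidt:
  assumes "finite B" "B \<subseteq> polys k"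
  shows "\<exists>m (e :: nat \<Rightarrow> _). (\<forall>i<m. e i \<in> polys k) \<and> (\<forall>i<m. \<forall>j<m. ip (e i) (e j) = (if i = j then 1 else 0))
    \<and> (\<forall>b\<in>B. \<forall>x\<in>usimplex. b x = (\<Sum>i<m. ip b (e i) * e i x))"
  using assms
proof induction
  case empty
  then show ?case by (intro exI[of _ 0]) auto
next
  case (insert b B)
  then have "B \<subseteq> polys k" by simp
  from insert.IH[OF this] obtain m and e :: "nat \<Rightarrow> real^'n \<Rightarrow> real" where E: "(\<forall>i<m. e i \<in> polys k) \<and>
    (\<forall>i<m. \<forall>j<m. ip (e i) (e j) = (if i = j then 1 else 0)) \<and> (\<forall>b\<in>B. \<forall>x\<in>usimplex. b x = (\<Sum>i<m. ip b (e i) * e i x))"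
    by (elim exE) (rule that)
  have e: "i < m \<Longrightarrow> e i \<in> polys k" for i using conjunct1[OF E] by blast
  have orth: "i < m \<Longrightarrow> j < m \<Longrightarrow> ip (e i) (e j) = (if i = j then 1 else 0)" for i j
    using conjunct1[OF conjunct2[OF E]] by blast
  have B: "b \<in> B \<Longrightarrow> x \<in> usimplex \<Longrightarrow> b x = (\<Sum>i<m. ip b (e i) * e i x)" for b x
    using conjunct2[OF conjunct2[OF E]] by blast
  have b: "b \<in> polys k" and Bk: "B \<subseteq> polys k" using insert.prems by auto
  note cont = polys_continuous[of _ k UNIV]
  have ce: "i < m \<Longrightarrow> continuous_on UNIV (e i)" for i by (intro cont e)
  define s where "s x = (\<Sum>i<m. ip b (e i) * e i x)" for x
  define r where "r x = b x - s x" for x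
  have s: "s \<in> polys k" unfolding s_def[abs_def] by (intro polys_sum polys_cmult e) simp
  have r: "r \<in> polys k" using polys_lincomb[OF b s, of 1 "- 1"] by (simp add: r_def[abs_def])
  have re: "ip r (e j) = 0" if j: "j < m" for j
  proof -
    have "ip s (e j) = (\<Sum>i<m. ip b (e i) * ip (e i) (e j))"
      unfolding s_def[abs_def] using ce j by (intro ip_sum_left) auto
    also have "\<dots> = (\<Sum>i<m. if i = j then ip b (e i) else 0)" by (intro sum.cong) (auto simp: orth j)
    also have "\<dots> = ip b (e j)" using j by (simp add: sum.delta')
    finally show ?thesis unfolding r_def[abs_def] using ip_diff(1)[OF cont[OF b] cont[OF s] ce[OF j]] by simp
  qed
  show ?case
  proof (cases "ip r r = 0")
    case True
    have "b x = (\<Sum>i<m. ip b (e i) * e i x)" if "x \<in> usimplex" for x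
      using ip_self_eq_0[OF cont[OF r] True that] by (simp add: r_def s_def)
    with E have "(\<forall>i<m. e i \<in> polys k) \<and> (\<forall>i<m. \<forall>j<m. ip (e i) (e j) = (if i = j then 1 else 0))
      \<and> (\<forall>c\<in>insert b B. \<forall>x\<in>usimplex. c x = (\<Sum>i<m. ip c (e i) * e i x))" by blast
    then show ?thesis by (intro exI)
  next
    case False
    define R where "R = nrm2 \<mu> r"
    have R: "R\<^sup>2 = ip r r" "0 < R" using False by (auto simp: R_def ip_self less_le)
    define e' where "e' = e(m := (\<lambda>x. (1 / R) * r x))"
    have e'm: "e' m = (\<lambda>x. (1 / R) * r x)" and e'i: "i < m \<Longrightarrow> e' i = e i" for i by (auto simp: e'_def)
    have ipm: "ip f (e' m) = ip f r / R" if f: "continuous_on UNIV f" for f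
      unfolding e'm using ip_lincomb(2)[OF cont[OF r] cont[OF r] f, of "1 / R" 0] by simp
    have e'mp: "e' m \<in> polys k" unfolding e'm by (rule polys_cmult[OF r])
    with e e'i have "\<forall>i<Suc m. e' i \<in> polys k" by (metis less_Suc_eq)
    moreover have "\<forall>i<Suc m. \<forall>j<Suc m. ip (e' i) (e' j) = (if i = j then 1 else 0)"
    proof -
      have "ip (e' m) (e' m) = ip (e' m) r / R" by (rule ipm[OF cont[OF e'mp]])
      also have "ip (e' m) r = ip r (e' m)" by (rule ip_commute)
      also have "\<dots> = ip r r / R" by (rule ipm[OF cont[OF r]])
      finally have "ip (e' m) (e' m) = 1" using R False by (simp add: power2_eq_square)
      moreover have "ip (e i) (e' m) = 0" "ip (e' m) (e i) = 0" if "i < m" for i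
        using ipm[OF ce[OF that]] re[OF that] by (simp_all add: ip_commute[of _ r] ip_commute[of "e' m"])
      ultimately show ?thesis by (auto simp: less_Suc_eq e'i orth)
    qed
    moreover have "c x = (\<Sum>i<Suc m. ip c (e' i) * e' i x)" if c: "c \<in> insert b B" and x: "x \<in> usimplex" for c x
    proof -
      have split: "(\<Sum>i<Suc m. ip c (e' i) * e' i x) = (\<Sum>i<m. ip c (e i) * e i x) + ip c (e' m) * e' m x"
        by (simp add: e'i)
      show ?thesis
      proof (cases "c \<in> B")
        case True
        have "ip c r = ip (\<lambda>x. \<Sum>i<m. ip c (e i) * e i x) r"
          using True Bk cont r ce by (intro ip_cong B) (auto intro!: continuous_intros)
        also have "\<dots> = (\<Sum>i<m. ip c (e i) * ip (e i) r)"
          using cont[OF r] ce by (intro ip_sum_left) auto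
        also have "\<dots> = 0" by (intro sum.neutral) (auto simp: ip_commute[of _ r] re)
        finally have "ip c (e' m) = 0" using True Bk by (subst ipm) (auto intro: cont)
        then show ?thesis unfolding split using B[OF True x] by simp
      next
        case False
        with c have [simp]: "c = b" by simp
        have "ip b r = ip r r + ip s r"
          using ip_diff(1)[OF cont[OF b] cont[OF s] cont[OF r]] by (simp add: r_def[abs_def, symmetric])
        also have "ip s r = (\<Sum>i<m. ip b (e i) * ip (e i) r)"
          unfolding s_def[abs_def] using cont[OF r] ce by (intro ip_sum_left) auto
        also have "\<dots> = 0" by (intro sum.neutral) (auto simp: ip_commute[of _ r] re)
        finally have "ip b (e' m) = R" using R by (subst ipm) (auto intro: cont b simp: power2_eq_square field_simps)
        then have "ip b (e' m) * e' m x = r x" using R by (simp add: e'm)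
        then show ?thesis unfolding split by (simp add: r_def s_def)
      qed
    qed
    ultimately have "(\<forall>i<Suc m. e' i \<in> polys k) \<and> (\<forall>i<Suc m. \<forall>j<Suc m. ip (e' i) (e' j) = (if i = j then 1 else 0))
      \<and> (\<forall>c\<in>insert b B. \<forall>x\<in>usimplex. c x = (\<Sum>i<Suc m. ip c (e' i) * e' i x))" by blast
    then show ?thesis by (intro exI)
  qed
qed

definition onb :: "nat \<Rightarrow> nat \<Rightarrow> (nat \<Rightarrow> real^'n \<Rightarrow> real) \<Rightarrow> bool" where
  "onb k m e \<longleftrightarrow> (\<forall>i<m. e i \<in> polys k) \<and> (\<forall>i<m. \<forall>j<m. ip (e i) (e j) = (if i = j then 1 else 0)) \<and>
    (\<forall>p\<in>polys k. \<forall>x\<in>usimplex. p x = (\<Sum>i<m. ip p (e i) * e i x))"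

lemma polys_orthonormal_basis: "\<exists>m e. onb k m e"
proof -
  have "finite (vmono ` {\<beta> :: 'n \<Rightarrow> nat. mdeg \<beta> \<le> k})" by (intro finite_imageI finite_mdeg)
  moreover have "vmono ` {\<beta> :: 'n \<Rightarrow> nat. mdeg \<beta> \<le> k} \<subseteq> polys k" by (auto intro: vmono_in_polys)
  ultimately obtain m and e :: "nat \<Rightarrow> real^'n \<Rightarrow> real" where E: "(\<forall>i<m. e i \<in> polys k) \<and>
    (\<forall>i<m. \<forall>j<m. ip (e i) (e j) = (if i = j then 1 else 0)) \<and>
    (\<forall>b\<in>vmono ` {\<beta>. mdeg \<beta> \<le> k}. \<forall>x\<in>usimplex. b x = (\<Sum>i<m. ip b (e i) * e i x))"
    by (rule exE[OF gram_schmidt]) (elim exE, rule that)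
  have e: "i < m \<Longrightarrow> e i \<in> polys k" for i using conjunct1[OF E] by blast
  have B: "b \<in> vmono ` {\<beta>. mdeg \<beta> \<le> k} \<Longrightarrow> x \<in> usimplex \<Longrightarrow> b x = (\<Sum>i<m. ip b (e i) * e i x)" for b x
    using conjunct2[OF conjunct2[OF E]] by blast
  have "p x = (\<Sum>i<m. ip p (e i) * e i x)" if p: "p \<in> polys k" and x: "x \<in> usimplex" for p x
  proof -
    obtain c where c: "p = (\<lambda>x. \<Sum>\<beta> | mdeg \<beta> \<le> k. c \<beta> * vmono \<beta> x)" using p by (auto simp: polys_def)
    have ipe: "ip p (e i) = (\<Sum>\<beta> | mdeg \<beta> \<le> k. c \<beta> * ip (vmono \<beta>) (e i))" if "i < m" for i
      unfolding c by (intro ip_sum_left vmono_continuous polys_continuous[OF e] that)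
    have "p x = (\<Sum>\<beta> | mdeg \<beta> \<le> k. c \<beta> * (\<Sum>i<m. ip (vmono \<beta>) (e i) * e i x))"
      unfolding c by (intro sum.cong refl) (subst B[OF _ x], auto)
    also have "\<dots> = (\<Sum>i<m. \<Sum>\<beta> | mdeg \<beta> \<le> k. c \<beta> * (ip (vmono \<beta>) (e i) * e i x))"
      unfolding sum_distrib_left by (rule sum.swap)
    also have "\<dots> = (\<Sum>i<m. ip p (e i) * e i x)"
      by (intro sum.cong refl) (simp add: ipe sum_distrib_right mult.assoc)
    finally show ?thesis .
  qed
  with E have "onb k m e" unfolding onb_def by blast
  then show ?thesis by (intro exI)
qed

text \<open>The dimension \<open>m\<close> is a number and not a type, so coefficient vectors are
  functions on \<open>nat\<close> that vanish from \<open>m\<close> on; the box is a product of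
  compact sets in the product topology.\<close>

lemma compact_coefficient_box: "compact {c :: nat \<Rightarrow> real. \<forall>i. c i \<in> (if i < m then {- 1..1} else {0})}"
proof -
  have "compactin (product_topology (\<lambda>i. euclidean :: real topology) UNIV) (PiE UNIV (\<lambda>i::nat. if i < m then {- 1..1} else {0}))"
    by (subst compactin_PiE) auto
  then show ?thesis
    unfolding euclidean_product_topology by (simp add: PiE_UNIV_domain Pi_def)
qed

text \<open>In coordinates for an orthonormal basis the squared norm is a sum of squares, the mean
  is linear (\<open>M\<close>) and the energy quadratic (\<open>Q\<close>). The unit sphere of
  mean-zero polynomials becomes the compact set \<open>S\<close>, nonempty because of
  \<open>p0\<close>, and \<open>Q\<close> attains its minimum there.\<close>

lemma polys_minimizer:
  assumes p0: "p0 \<in> polys k" "ip p0 (\<lambda>x. 1) = 0" "ip p0 p0 \<noteq> 0"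
  obtains \<phi> where "\<phi> \<in> polys k" "ip \<phi> (\<lambda>x. 1) = 0" "ip \<phi> \<phi> = 1"
    "\<And>p. p \<in> polys k \<Longrightarrow> ip p (\<lambda>x. 1) = 0 \<Longrightarrow> E0 al a \<phi> \<phi> * ip p p \<le> E0 al a p p"
proof -
  obtain m e where E: "onb k m e" using polys_orthonormal_basis by blast
  have e: "i < m \<Longrightarrow> e i \<in> polys k" for i using E unfolding onb_def by blast
  have orth: "i < m \<Longrightarrow> j < m \<Longrightarrow> ip (e i) (e j) = (if i = j then 1 else 0)" for i j
    using E unfolding onb_def by blast
  have expand: "p \<in> polys k \<Longrightarrow> x \<in> usimplex \<Longrightarrow> p x = (\<Sum>i<m. ip p (e i) * e i x)" for p x
    using E unfolding onb_def by blast
  define comb where "comb c = (\<lambda>x. \<Sum>i<m. c i * e i x)" for c :: "nat \<Rightarrow> real"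
  have comb: "comb c \<in> polys k" for c unfolding comb_def by (intro polys_sum polys_cmult e) simp
  note cont = polys_continuous[of _ k UNIV]
  have ce: "i < m \<Longrightarrow> continuous_on UNIV (e i)" for i by (intro cont e)
  have ip_comb: "ip (comb c) f = (\<Sum>i<m. c i * ip (e i) f)" if "continuous_on UNIV f" for c f
    unfolding comb_def using ce that by (intro ip_sum_left) auto
  have ip_comb2: "ip (comb c) (comb c) = (\<Sum>i<m. (c i)\<^sup>2)" for c
  proof -
    have "ip (e i) (comb c) = c i" if "i < m" for i
    proof -
      have "ip (comb c) (e i) = (\<Sum>j<m. c j * ip (e j) (e i))" by (rule ip_comb[OF ce[OF that]])
      also have "\<dots> = (\<Sum>j<m. if j = i then c j else 0)" by (intro sum.cong) (auto simp: orth that)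
      also have "\<dots> = c i" using that by (simp add: sum.delta')
      finally show ?thesis by (simp add: ip_commute)
    qed
    then show ?thesis by (subst ip_comb[OF cont[OF comb]]) (auto simp: power2_eq_square intro!: sum.cong)
  qed
  define M where "M c = (\<Sum>i<m. c i * ip (e i) (\<lambda>x. 1))" for c
  define Q where "Q c = (\<Sum>i<m. c i * (\<Sum>j<m. c j * E0 al a (e j) (e i)))" for c
  have E_comb: "E0 al a (comb c) (comb c) = Q c" for c
  proof -
    have ec: "i < m \<Longrightarrow> C2 (e i)" for i using polys_C2[OF e] .
    have "E0 al a (e i) (comb c) = (\<Sum>j<m. c j * E0 al a (e j) (e i))" if "i < m" for i
      unfolding E0_commute[of "e i"] comb_def using ec that by (intro E0_sum) auto
    then show ?thesis
      unfolding Q_def comb_def using ec polys_C2[OF comb[of c]]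
      by (subst E0_sum) (auto simp: comb_def)
  qed
  have expand': "ip p p = (\<Sum>i<m. (ip p (e i))\<^sup>2)" "ip p (\<lambda>x. 1) = M (\<lambda>i. ip p (e i))"
    "E0 al a p p = Q (\<lambda>i. ip p (e i))" if p: "p \<in> polys k" for p
  proof -
    let ?q = "comb (\<lambda>i. ip p (e i))"
    have eq: "\<And>x. x \<in> usimplex \<Longrightarrow> p x = ?q x" unfolding comb_def by (rule expand[OF p])
    have "ip p p = ip ?q p" by (intro ip_cong eq cont p comb)
    also have "\<dots> = ip ?q ?q" unfolding ip_commute[of ?q p] by (intro ip_cong eq cont p comb)
    finally show "ip p p = (\<Sum>i<m. (ip p (e i))\<^sup>2)" by (simp add: ip_comb2)
    have "ip p (\<lambda>x. 1) = ip ?q (\<lambda>x. 1)" by (intro ip_cong eq cont p comb continuous_intros)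
    then show "ip p (\<lambda>x. 1) = M (\<lambda>i. ip p (e i))" by (simp add: ip_comb M_def)
    have "E0 al a p p = E0 al a ?q p" by (intro E0_cong eq polys_C2[OF p] polys_C2[OF comb])
    also have "\<dots> = E0 al a ?q ?q" unfolding E0_commute[of ?q p] by (intro E0_cong eq polys_C2[OF p] polys_C2[OF comb])
    finally show "E0 al a p p = Q (\<lambda>i. ip p (e i))" by (simp add: E_comb)
  qed
  define S where "S = {c :: nat \<Rightarrow> real. \<forall>i. c i \<in> (if i < m then {- 1..1} else {0})} \<inter> {c. (\<Sum>i<m. (c i)\<^sup>2) = 1} \<inter> {c. M c = 0}"
  have cc: "continuous_on UNIV (\<lambda>c :: nat \<Rightarrow> real. c i)" for i by simp
  have "compact S" unfolding S_def M_def
    by (intro compact_Int_closed compact_coefficient_box closed_Collect_eq continuous_intros cc)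
  \<comment> \<open>Scales by \<open>s\<close> and cuts off at \<open>m\<close>: with
    \<open>s\<close> the inverse norm, the coefficients of a mean-zero polynomial of nonzero norm
    land in \<open>S\<close>.\<close>
  define restr where "restr s c = (\<lambda>i. if i < m then s * c i else 0)" for s and c :: "nat \<Rightarrow> real"
  have restr: "restr s c \<in> S" "Q (restr s c) = s\<^sup>2 * Q c" if c: "M c = 0" "s\<^sup>2 * (\<Sum>i<m. (c i)\<^sup>2) = 1" for c s
  proof -
    have 1: "(\<Sum>i<m. (restr s c i)\<^sup>2) = 1" using c(2) by (simp add: restr_def power_mult_distrib sum_distrib_left)
    have "\<bar>restr s c i\<bar> \<le> 1" if "i < m" for i
    proof -
      have "(restr s c i)\<^sup>2 \<le> (\<Sum>i<m. (restr s c i)\<^sup>2)" using that by (intro member_le_sum) auto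
      then show ?thesis unfolding 1 by (simp add: abs_square_le_1)
    qed
    then have box: "\<forall>i. restr s c i \<in> (if i < m then {- 1..1} else {0})" by (auto simp: abs_le_iff restr_def)
    have "M (restr s c) = s * M c" by (simp add: M_def restr_def sum_distrib_left mult.assoc)
    with c(1) 1 box show "restr s c \<in> S" by (simp add: S_def)
    show "Q (restr s c) = s\<^sup>2 * Q c"
      unfolding Q_def restr_def power2_eq_square by (simp add: sum_distrib_left mult_ac)
  qed
  have scale: "(1 / sqrt z)\<^sup>2 * z = 1" if "0 < z" for z :: real using that by (simp add: power_divide)
  have ne: "S \<noteq> {}"
  proof -
    have "0 \<le> ip p0 p0" by (simp add: ip_self)
    with p0(3) have "0 < ip p0 p0" by simp
    from restr(1)[of "\<lambda>i. ip p0 (e i)" "1 / sqrt (ip p0 p0)"] scale[OF this] p0(2) show ?thesis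
      unfolding expand'(1,2)[OF p0(1)] by (metis empty_iff)
  qed
  have "continuous_on S Q" unfolding Q_def by (intro continuous_intros continuous_on_subset[OF cc]) auto
  then obtain c where c: "c \<in> S" "\<And>d. d \<in> S \<Longrightarrow> Q c \<le> Q d"
    using continuous_attains_inf[OF \<open>compact S\<close> ne] by blast
  show ?thesis
  proof
    show "comb c \<in> polys k" by (rule comb)
    show "ip (comb c) (\<lambda>x. 1) = 0" using c(1) by (simp add: ip_comb S_def M_def)
    show "ip (comb c) (comb c) = 1" using c(1) by (simp add: ip_comb2 S_def)
    fix p assume p: "p \<in> polys k" "ip p (\<lambda>x. 1) = 0"
    show "E0 al a (comb c) (comb c) * ip p p \<le> E0 al a p p"
    proof (cases "ip p p = 0")
      case True
      then show ?thesis by (simp add: E0_nonneg)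
    next
      case False
      have "0 \<le> ip p p" by (simp add: ip_self)
      with False have pos: "0 < ip p p" by simp
      from restr[of "\<lambda>i. ip p (e i)" "1 / sqrt (ip p p)"] scale[OF pos] p(2)
      have "restr (1 / sqrt (ip p p)) (\<lambda>i. ip p (e i)) \<in> S"
        "Q (restr (1 / sqrt (ip p p)) (\<lambda>i. ip p (e i))) = (1 / sqrt (ip p p))\<^sup>2 * E0 al a p p"
        unfolding expand'(2,3)[OF p(1)] using expand'(1)[OF p(1)] by auto
      with c(2) have "Q c \<le> (1 / sqrt (ip p p))\<^sup>2 * E0 al a p p" by metis
      then have "Q c * ip p p \<le> (1 / sqrt (ip p p))\<^sup>2 * E0 al a p p * ip p p" using pos by (intro mult_right_mono) auto
      also have "\<dots> = (1 / sqrt (ip p p))\<^sup>2 * ip p p * E0 al a p p" by (simp only: mult_ac)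
      finally show ?thesis unfolding scale[OF pos] E_comb by simp
    qed
  qed
qed

text \<open>For a mean-zero \<open>q\<close> the expression \<open>E0\<close> minus
  \<open>lam\<close> times the squared norm, at \<open>\<phi> + t * q\<close>, is nonnegative in
  \<open>t\<close> and 0 at \<open>t = 0\<close>, so its linear coefficient vanishes. Subtracting
  means extends this to all of \<open>polys k\<close>, and the test function
  \<open>Lop al a \<phi> + lam * \<phi>\<close>, which lies in \<open>polys k\<close> by invariance,
  then has norm 0.\<close>

lemma minimizer_eigenfunction:
  assumes \<phi>: "\<phi> \<in> polys k" "ip \<phi> (\<lambda>x. 1) = 0" "ip \<phi> \<phi> = 1"
    and min: "\<And>p. p \<in> polys k \<Longrightarrow> ip p (\<lambda>x. 1) = 0 \<Longrightarrow> E0 al a \<phi> \<phi> * ip p p \<le> E0 al a p p"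
    and x: "x \<in> usimplex"
  shows "Lop al a \<phi> x = - E0 al a \<phi> \<phi> * \<phi> x"
proof -
  define lam where "lam = E0 al a \<phi> \<phi>"
  note cont = polys_continuous[of _ k UNIV]
  have var0: "E0 al a \<phi> q = lam * ip \<phi> q" if q: "q \<in> polys k" "ip q (\<lambda>x. 1) = 0" for q
  proof -
    note C = polys_C2[OF \<phi>(1)] polys_C2[OF q(1)]
    note c = cont[OF \<phi>(1)] cont[OF q(1)]
    have "(E0 al a \<phi> q - lam * ip \<phi> q)\<^sup>2 \<le> 0 * (E0 al a q q - lam * ip q q)"
    proof (rule discriminant_bound)
      fix t
      let ?p = "\<lambda>x. 1 * \<phi> x + t * q x"
      have P: "?p \<in> polys k" by (rule polys_lincomb[OF \<phi>(1) q(1)])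
      have "ip ?p (\<lambda>x. 1) = 0"
        using \<phi>(2) q(2) by (subst ip_lincomb) (auto intro!: c)
      from min[OF P this] have "0 \<le> E0 al a ?p ?p - lam * ip ?p ?p" by (simp add: lam_def)
      also have "E0 al a ?p ?p = lam + 2 * t * E0 al a \<phi> q + t\<^sup>2 * E0 al a q q"
        using E0_linear(1)[OF C polys_C2[OF P], of 1 t] E0_linear(2)[OF C C(1), of 1 t] E0_linear(2)[OF C C(2), of 1 t]
        by (simp add: E0_commute[of q \<phi>] lam_def power2_eq_square algebra_simps)
      also have "ip ?p ?p = 1 + 2 * t * ip \<phi> q + t\<^sup>2 * ip q q"
        using ip_lincomb(1)[OF c cont[OF P], of 1 t] ip_lincomb(2)[OF c c(1), of 1 t] ip_lincomb(2)[OF c c(2), of 1 t] \<phi>(3)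
        by (simp add: ip_commute[of q \<phi>] power2_eq_square algebra_simps)
      finally show "0 \<le> 0 + 2 * t * (E0 al a \<phi> q - lam * ip \<phi> q) + t\<^sup>2 * (E0 al a q q - lam * ip q q)"
        by (simp add: algebra_simps)
    qed
    then show ?thesis by simp
  qed
  have var: "E0 al a \<phi> q = lam * ip \<phi> q" if q: "q \<in> polys k" for q
  proof -
    define m where "m = ip q (\<lambda>x. 1)"
    note one = polys_const[of 1 k]
    let ?q = "\<lambda>x. 1 * q x + (- m) * 1"
    have q': "?q \<in> polys k" by (rule polys_lincomb[OF q one])
    have "ip (\<lambda>x. 1) (\<lambda>x. 1) = 1" by (simp add: ip_def measure_\<mu>)
    then have "ip ?q (\<lambda>x. 1) = 0" using ip_lincomb(1)[OF cont[OF q] cont[OF one] cont[OF one], of 1 "- m"] by (simp add: m_def)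
    from var0[OF q' this]
    have "E0 al a \<phi> q + (- m) * E0 al a \<phi> (\<lambda>x. 1) = lam * (ip \<phi> q + (- m) * ip \<phi> (\<lambda>x. 1))"
      unfolding E0_linear(2)[OF polys_C2[OF q] polys_C2[OF one] polys_C2[OF \<phi>(1)]]
        ip_lincomb(2)[OF cont[OF q] cont[OF one] cont[OF \<phi>(1)]] by simp
    moreover have "E0 al a \<phi> (\<lambda>x. 1) = 0"
      by (simp add: E0_def)
    ultimately show ?thesis using \<phi>(2) by simp
  qed
  let ?r = "\<lambda>x. 1 * Lop al a \<phi> x + lam * \<phi> x"
  note L = Lop_in_polys[OF \<phi>(1), of al a]
  have r: "?r \<in> polys k" by (rule polys_lincomb[OF L \<phi>(1)])
  have "ip ?r ?r = ip ?r (Lop al a \<phi>) + lam * ip ?r \<phi>"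
    using ip_lincomb(2)[OF cont[OF L] cont[OF \<phi>(1)] cont[OF r], of 1 lam] by simp
  also have "ip ?r (Lop al a \<phi>) = - E0 al a \<phi> ?r"
    by (subst ip_Lop[OF polys_C2[OF r] polys_C2[OF \<phi>(1)]]) (simp only: E0_commute)
  also have "\<dots> = - (lam * ip \<phi> ?r)" by (simp only: var[OF r])
  finally have "ip ?r ?r = 0" by (simp only: ip_commute[of \<phi>])
  from ip_self_eq_0[OF cont[OF r] this x] show ?thesis by (simp add: lam_def)
qed

lemma \<mu>_usimplex_nonempty: "usimplex \<noteq> ({} :: (real^'n) set)"
proof
  assume "usimplex = ({} :: (real^'n) set)"
  with AE_usimplex have "AE x in \<mu>. False" by simp
  then show False using emeasure_\<mu> by (simp add: AE_iff_measurable[of UNIV])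
qed

text \<open>The equation multiplies the homogeneous part \<open>h x j\<close> of degree
  \<open>j\<close> by \<open>a * j - lam\<close>, which is nonzero for \<open>j \<ge> 1\<close>. The
  parts are separated by moving \<open>x\<close> to \<open>t *\<^sub>R x\<close> with
  \<open>0 < t < 1\<close>, still in the open simplex: a polynomial in \<open>t\<close> with
  infinitely many zeros has zero coefficients.\<close>

lemma eigenfunction_Dop_zero_const:
  fixes \<phi> :: "real^'n \<Rightarrow> real"
  assumes \<phi>: "\<phi> \<in> polys k" and lam: "0 \<le> lam" "lam < a"
    and eig: "\<And>x. x \<in> usimplex \<Longrightarrow> a * Eop \<phi> x = lam * \<phi> x"
  shows "\<exists>c. \<forall>x\<in>usimplex. \<phi> x = c"
proof -
  obtain c where c: "\<phi> = (\<lambda>x. \<Sum>\<beta> | mdeg \<beta> \<le> k. c \<beta> * vmono \<beta> x)" using \<phi> by (auto simp: polys_def)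
  have fin: "finite {\<beta> :: 'n \<Rightarrow> nat. mdeg \<beta> \<le> k}" by (rule finite_mdeg)
  define h where "h x j = (\<Sum>\<beta> | mdeg \<beta> \<le> k \<and> mdeg \<beta> = j. c \<beta> * vmono \<beta> x)" for x :: "real^'n" and j
  have group: "(\<Sum>\<beta> | mdeg \<beta> \<le> k. g (mdeg \<beta>) * (c \<beta> * vmono \<beta> x)) = (\<Sum>j\<le>k. g j * h x j)" for g :: "nat \<Rightarrow> real" and x
  proof -
    have "(\<Sum>\<beta> | mdeg \<beta> \<le> k. g (mdeg \<beta>) * (c \<beta> * vmono \<beta> x))
      = (\<Sum>j\<le>k. \<Sum>\<beta> | \<beta> \<in> {\<beta>. mdeg \<beta> \<le> k} \<and> mdeg \<beta> = j. g (mdeg \<beta>) * (c \<beta> * vmono \<beta> x))"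
      by (rule sum.group[symmetric, OF fin]) auto
    also have "\<dots> = (\<Sum>j\<le>k. g j * h x j)"
      unfolding h_def sum_distrib_left by (intro sum.cong) auto
    finally show ?thesis .
  qed
  have hz: "h x j = 0" if x: "x \<in> usimplex" and j: "1 \<le> j" "j \<le> k" for x j
  proof -
    have poly0: "(\<Sum>i\<le>k. ((a * real i - lam) * h x i) * t ^ i) = 0" if t: "0 < t" "t < 1" for t
    proof -
      have sx: "0 < x $ i" "l1 x < 1" for i using x by (auto simp: usimplex_def)
      have "0 \<le> l1 x" unfolding l1_def using sx by (intro sum_nonneg) (auto simp: less_imp_le)
      then have "t * l1 x \<le> 1 * l1 x" using t by (intro mult_right_mono) auto
      then have tx: "t *\<^sub>R x \<in> usimplex"
        using sx t by (auto simp: usimplex_def l1_def sum_distrib_left[symmetric])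
      have vt: "vmono \<beta> (t *\<^sub>R x) = t ^ mdeg \<beta> * vmono \<beta> x" for \<beta>
        by (simp add: vmono_def mdeg_def power_mult_distrib prod.distrib power_sum)
      have "a * Eop \<phi> (t *\<^sub>R x) - lam * \<phi> (t *\<^sub>R x) = 0" using eig[OF tx] by simp
      also have "Eop \<phi> (t *\<^sub>R x) = (\<Sum>\<beta> | mdeg \<beta> \<le> k. c \<beta> * (real (mdeg \<beta>) * vmono \<beta> (t *\<^sub>R x)))"
        unfolding c by (subst Eop_sum) (auto intro: polys_C2 vmono_in_polys simp: Eop_vmono)
      finally have "(\<Sum>\<beta> | mdeg \<beta> \<le> k. ((a * real (mdeg \<beta>) - lam) * t ^ mdeg \<beta>) * (c \<beta> * vmono \<beta> x)) = 0"
        unfolding c vt by (simp add: sum_distrib_left sum_subtractf[symmetric] algebra_simps)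
      then show ?thesis using group[of "\<lambda>j. (a * real j - lam) * t ^ j" x] by (simp add: mult_ac)
    qed
    have "infinite {0<..<1::real}" by (rule infinite_Ioo) simp
    then have "infinite {t. (\<Sum>i\<le>k. ((a * real i - lam) * h x i) * t ^ i) = 0}"
      by (rule contrapos_nn) (rule finite_subset[rotated], auto simp: poly0)
    then have "(a * real j - lam) * h x j = 0"
      using polyfun_finite_roots[of "\<lambda>i. (a * real i - lam) * h x i" k] j by blast
    moreover have "a * 1 \<le> a * real j" using j a_pos by (intro mult_left_mono) auto
    then have "a * real j - lam \<noteq> 0" using lam(2) by linarith
    ultimately show ?thesis by simp
  qed
  have "\<phi> x = c (\<lambda>_. 0)" if x: "x \<in> usimplex" for x
  proof -
    have "\<phi> x = (\<Sum>j\<le>k. 1 * h x j)" unfolding c using group[of "\<lambda>_. 1" x] by simp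
    also have "\<dots> = (\<Sum>j\<in>{0}. 1 * h x j)" using hz[OF x] by (intro sum.mono_neutral_right) auto
    also have "\<dots> = h x 0" by simp
    also have "{\<beta> :: 'n \<Rightarrow> nat. mdeg \<beta> \<le> k \<and> mdeg \<beta> = 0} = {\<lambda>_. 0}" by (auto simp: mdeg_def)
    then have "h x 0 = c (\<lambda>_. 0)" by (simp add: h_def vmono_0)
    finally show ?thesis .
  qed
  then show ?thesis by blast
qed

text \<open>By the intertwining relation, \<open>D \<phi>\<close> is an eigenfunction for \<open>a + 2\<close> with \<open>\<lambda>\<close> lowered by
  \<open>\<bar>\<alpha>\<bar> + a\<close>; if \<open>D \<phi> = 0\<close>, then \<open>\<phi>\<close> is homogeneous of degree \<open>\<lambda> / a\<close>.\<close>

lemma eigenvalue_lower_bound: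
  assumes \<phi>: "\<phi> \<in> polys k" "ip \<phi> (\<lambda>x. 1) = 0" "ip \<phi> \<phi> = 1" and lam: "0 \<le> lam"
    and eig: "\<And>x. x \<in> usimplex \<Longrightarrow> Lop al a \<phi> x = - lam * \<phi> x"
  shows "a \<le> lam"
proof (cases "\<forall>x\<in>usimplex. Dop al \<phi> x = 0")
  case True
  show ?thesis
  proof (rule ccontr)
    assume "\<not> a \<le> lam"
    moreover have "a * Eop \<phi> x = lam * \<phi> x" if "x \<in> usimplex" for x
      using eig[OF that] True that by (simp add: Lop_eq)
    ultimately obtain c where c: "\<And>x. x \<in> usimplex \<Longrightarrow> \<phi> x = c"
      using eigenfunction_Dop_zero_const[OF \<phi>(1) lam] by auto
    note cont = polys_continuous[OF \<phi>(1), of UNIV]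
    have "ip \<phi> (\<lambda>x. 1) = ip (\<lambda>x. c) (\<lambda>x. 1)" by (intro ip_cong c cont continuous_intros)
    then have "c = 0" using \<phi>(2) by (simp add: ip_def measure_\<mu>)
    moreover have "ip \<phi> \<phi> = ip (\<lambda>x. c) \<phi>" by (intro ip_cong c cont continuous_intros)
    ultimately show False using \<phi>(3) by (simp add: ip_def)
  qed
next
  case False
  then obtain x0 where x0: "x0 \<in> usimplex" "Dop al \<phi> x0 \<noteq> 0" by blast
  define g where "g = Dop al \<phi>"
  have g: "g \<in> polys k" unfolding g_def by (rule Dop_in_polys[OF \<phi>(1)])
  \<comment> \<open>The function \<open>g\<close> is tested in the Dirichlet distribution with last
    parameter \<open>a + 2\<close>, where minus \<open>Lop al (a + 2)\<close> is nonnegative; this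
    yields \<open>lam \<ge> l1 al + a\<close>.\<close>
  interpret D2: dirichlet_params al "a + 2"
    by unfold_locales (use al_pos a_pos in auto)
  note cg = polys_continuous[OF g, of UNIV]
  have Lg: "Lop al (a + 2) g x = (l1 al + a - lam) * g x" if x: "x \<in> usimplex" for x
  proof -
    \<comment> \<open>The sum over \<open>unit\<close> brings a scalar multiple into the form of
      \<open>Dop_sum\<close>.\<close>
    have "Dop al (Lop al a \<phi>) x = Dop al (\<lambda>x. \<Sum>i\<in>UNIV. - lam * (\<lambda>_::unit. \<phi>) i x) x"
      by (rule Dop_cong_open[OF open_usimplex x]) (simp add: eig)
    also have "\<dots> = - lam * g x"
      using polys_C2[OF \<phi>(1)] by (subst Dop_sum) (auto simp: g_def)
    finally show ?thesis using Dop_Lop_intertwine[OF \<phi>(1), of al a x] by (simp add: g_def algebra_simps)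
  qed
  have "0 \<le> E0 al (a + 2) g g" by (rule D2.E0_nonneg)
  also have "E0 al (a + 2) g g = - D2.ip g (Lop al (a + 2) g)"
    using D2.ip_Lop[OF polys_C2[OF g] polys_C2[OF g]] by simp
  also have "D2.ip g (Lop al (a + 2) g) = D2.ip (\<lambda>x. (l1 al + a - lam) * g x + 0 * g x) g"
    unfolding D2.ip_commute[of g]
    by (intro D2.ip_cong D2.Lop_continuous polys_C2[OF g] continuous_intros cg) (simp add: Lg)
  also have "\<dots> = (l1 al + a - lam) * D2.ip g g"
    unfolding D2.ip_lincomb(1)[OF cg cg cg] by simp
  finally have ineq: "0 \<le> (lam - l1 al - a) * D2.ip g g" by (simp add: algebra_simps)
  have "D2.ip g g \<noteq> 0" using D2.ip_self_eq_0[OF cg _ x0(1)] x0(2) by (auto simp: g_def)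
  moreover have "0 \<le> D2.ip g g" by (simp add: D2.ip_self)
  ultimately have "0 < D2.ip g g" by simp
  with ineq have "0 \<le> lam - l1 al - a" by (simp add: zero_le_mult_iff)
  with l1_al_pos show ?thesis by simp
qed

lemma poincare_polys:
  assumes p: "p \<in> polys k" "ip p (\<lambda>x. 1) = 0"
  shows "a * ip p p \<le> E0 al a p p"
proof (cases "ip p p = 0")
  case True
  then show ?thesis by (simp add: E0_nonneg)
next
  case False
  obtain \<phi> where \<phi>: "\<phi> \<in> polys k" "ip \<phi> (\<lambda>x. 1) = 0" "ip \<phi> \<phi> = 1"
    and min: "\<And>p. p \<in> polys k \<Longrightarrow> ip p (\<lambda>x. 1) = 0 \<Longrightarrow> E0 al a \<phi> \<phi> * ip p p \<le> E0 al a p p"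
    using polys_minimizer[OF p False] by blast
  have "a \<le> E0 al a \<phi> \<phi>"
    using minimizer_eigenfunction[OF \<phi> min] by (intro eigenvalue_lower_bound[OF \<phi> E0_nonneg]) auto
  moreover have "0 \<le> ip p p" by (simp add: ip_self)
  ultimately show ?thesis using min[OF p] by (meson mult_right_mono order_trans)
qed

section \<open>From polynomials to twice differentiable functions\<close>

lemma polys_dense_continuous:
  assumes f: "continuous_on UNIV f" and e: "0 < e"
  obtains k p where "p \<in> polys k" "nrm2 \<mu> (\<lambda>x. f x - p x) \<le> e"
proof -
  obtain p where p: "real_polynomial_function p" "\<And>x. x \<in> dsimplex \<Longrightarrow> \<bar>f x - p x\<bar> < e"
    using Stone_Weierstrass_real_polynomial_function[OF compact_dsimplex continuous_on_subset[OF f] e] by blast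
  obtain k where k: "p \<in> polys k" using real_polynomial_function_in_polys[OF p(1)] by blast
  have c: "continuous_on UNIV (\<lambda>x. f x - p x)" by (intro continuous_intros f polys_continuous[OF k])
  have "(\<integral>x. (f x - p x)\<^sup>2 \<partial>\<mu>) \<le> (\<integral>x. e\<^sup>2 \<partial>\<mu>)"
  proof (rule integral_mono_AE)
    show "AE x in \<mu>. (f x - p x)\<^sup>2 \<le> e\<^sup>2"
      using AE_usimplex
    proof eventually_elim
      case (elim x)
      then have "\<bar>f x - p x\<bar> < e" using p(2) usimplex_subset by blast
      then show ?case using e by (simp add: abs_le_square_iff[symmetric])
    qed
    show "integrable \<mu> (\<lambda>x. (f x - p x)\<^sup>2)" using sqint_continuous[OF c] by (simp add: sqint_def)
  qed simp
  then have "nrm2 \<mu> (\<lambda>x. f x - p x) \<le> e"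
    unfolding nrm2_def using e by (intro real_le_lsqrt) (auto simp: measure_\<mu>)
  with k that show ?thesis by blast
qed

text \<open>Polynomial approximation in L2 suffices; none in energy is used. The remainder
  \<open>r\<close> of the projection \<open>p\<close> is orthogonal to \<open>Lop al a p\<close>, so
  the energy of \<open>p\<close> is at most that of \<open>f\<close>. The means of \<open>p\<close>
  and \<open>f\<close> agree, and the variance of \<open>f\<close> exceeds that of \<open>p\<close>
  by the squared norm of \<open>r\<close>, which is small.\<close>

theorem poincare_C2:
  assumes f: "C2 f"
  shows "a * ((\<integral>x. (f x)\<^sup>2 \<partial>\<mu>) - (\<integral>x. f x \<partial>\<mu>)\<^sup>2) \<le> E0 al a f f"
proof -
  have ff: "(\<integral>x. (f x)\<^sup>2 \<partial>\<mu>) = ip f f" and f1: "(\<integral>x. f x \<partial>\<mu>) = ip f (\<lambda>x. 1)"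
    by (simp_all add: ip_def power2_eq_square)
  note cf = C2_continuous(1)[OF f]
  have approx: "a * (ip f f - (ip f (\<lambda>x. 1))\<^sup>2) \<le> E0 al a f f + a * e\<^sup>2" if e: "0 < e" for e
  proof -
    obtain k q where q: "q \<in> polys k" "nrm2 \<mu> (\<lambda>x. f x - q x) \<le> e"
      using polys_dense_continuous[OF cf e] by blast
    obtain m b where E: "onb k m b" using polys_orthonormal_basis by blast
    have b: "i < m \<Longrightarrow> b i \<in> polys k" for i using E unfolding onb_def by blast
    have orth: "i < m \<Longrightarrow> j < m \<Longrightarrow> ip (b i) (b j) = (if i = j then 1 else 0)" for i j
      using E unfolding onb_def by blast
    have expand: "p \<in> polys k \<Longrightarrow> x \<in> usimplex \<Longrightarrow> p x = (\<Sum>i<m. ip p (b i) * b i x)" for p x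
      using E unfolding onb_def by blast
    note cont = polys_continuous[of _ k UNIV]
    define p where "p = (\<lambda>x. \<Sum>i<m. ip f (b i) * b i x)"
    have p: "p \<in> polys k" unfolding p_def by (intro polys_sum polys_cmult b) simp
    define r where "r = (\<lambda>x. 1 * f x + (- 1) * p x)"
    have r: "C2 r" unfolding r_def by (rule C2_linear(1)[OF f polys_C2[OF p]])
    note cr = C2_continuous(1)[OF r] and cp = cont[OF p]
    have ce: "i < m \<Longrightarrow> continuous_on UNIV (b i)" for i by (rule cont[OF b])
    have rb: "ip r (b j) = 0" if j: "j < m" for j
    proof -
      have "ip p (b j) = (\<Sum>i<m. ip f (b i) * ip (b i) (b j))"
        unfolding p_def using ce j by (intro ip_sum_left) auto
      also have "\<dots> = (\<Sum>i<m. if i = j then ip f (b i) else 0)" by (intro sum.cong) (auto simp: orth j)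
      also have "\<dots> = ip f (b j)" using j by (simp add: sum.delta')
      finally show ?thesis unfolding r_def ip_lincomb(1)[OF cf cp ce[OF j]] by simp
    qed
    have rV: "ip r v = 0" if v: "v \<in> polys k" for v
    proof -
      have sv: "(\<lambda>x. \<Sum>i<m. ip v (b i) * b i x) \<in> polys k" by (intro polys_sum polys_cmult b) simp
      have "ip r v = ip r (\<lambda>x. \<Sum>i<m. ip v (b i) * b i x)"
        unfolding ip_commute[of r] by (intro ip_cong expand v cont[OF v] cont[OF sv] cr)
      also have "\<dots> = (\<Sum>i<m. ip v (b i) * ip r (b i))" using ce by (intro ip_sum_right cr) auto
      also have "\<dots> = 0" by (intro sum.neutral) (auto simp: rb)
      finally show ?thesis .
    qed
    have fe: "f = (\<lambda>x. 1 * p x + 1 * r x)" by (auto simp: r_def)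
    have split: "ip f v = ip p v + ip r v" if "continuous_on UNIV v" for v
      using ip_lincomb(1)[OF cp cr that, of 1 1] fe by simp
    have "E0 al a r p = 0" using ip_Lop[OF r polys_C2[OF p]] rV[OF Lop_in_polys[OF p]] by simp
    moreover have "E0 al a f f = E0 al a p p + 2 * E0 al a r p + E0 al a r r"
    proof -
      have "E0 al a f f = E0 al a p f + E0 al a r f"
        using E0_linear(1)[OF polys_C2[OF p] r f, of 1 1] fe by simp
      moreover have "E0 al a p f = E0 al a p p + E0 al a p r"
        using E0_linear(2)[OF polys_C2[OF p] r polys_C2[OF p], of 1 1] fe by simp
      moreover have "E0 al a r f = E0 al a r p + E0 al a r r"
        using E0_linear(2)[OF polys_C2[OF p] r r, of 1 1] fe by simp
      ultimately show ?thesis by (simp add: E0_commute[of p r])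
    qed
    ultimately have Ep: "E0 al a p p \<le> E0 al a f f" using E0_nonneg[of r] by simp
    have "ip f f = ip p f + ip r f" by (rule split[OF cf])
    also have "ip p f = ip p p" using split[OF cp] rV[OF p] by (simp add: ip_commute[of p f])
    also have "ip r f = ip r r" using split[OF cr] rV[OF p] by (simp add: ip_commute[of r f] ip_commute[of p r])
    finally have Pyth: "ip f f = ip p p + ip r r" .
    \<comment> \<open>The projection is the best approximation in \<open>polys k\<close>, so it is
      at least as close to \<open>f\<close> as \<open>q\<close>.\<close>
    have "ip r r \<le> e\<^sup>2"
    proof -
      define s where "s = (\<lambda>x. f x - q x)"
      have cs: "continuous_on UNIV s" unfolding s_def by (intro continuous_intros cf cont[OF q(1)])
      have "ip r r = ip r s"
        unfolding s_def ip_diff(2)[OF cf cont[OF q(1)] cr] using rV[OF q(1)] split[OF cr] rV[OF p]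
        by (simp add: ip_commute[of r f] ip_commute[of p r])
      also have "\<dots> \<le> nrm2 \<mu> r * nrm2 \<mu> s"
        using cauchy_schwarz_L2[OF sqint_continuous[OF cr] sqint_continuous[OF cs]] by (simp add: ip_def)
      also have "\<dots> \<le> nrm2 \<mu> r * e" using q(2) by (intro mult_left_mono) (auto simp: s_def)
      finally have *: "(nrm2 \<mu> r)\<^sup>2 \<le> nrm2 \<mu> r * e" by (simp add: ip_self)
      have "nrm2 \<mu> r \<le> e"
      proof (cases "nrm2 \<mu> r = 0")
        case False
        then have "0 < nrm2 \<mu> r" by (simp add: less_le)
        with * show ?thesis by (simp add: power2_eq_square)
      qed (use e in simp)
      then show ?thesis unfolding ip_self using e by (intro power_mono) auto
    qed
    moreover have "a * (ip p p - (ip f (\<lambda>x. 1))\<^sup>2) \<le> E0 al a p p"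
    proof -
      define c where "c = ip f (\<lambda>x. 1)"
      note one = polys_const[of 1 k]
      have pc: "ip p (\<lambda>x. 1) = c" unfolding c_def using split[OF cont[OF one]] rV[OF one] by simp
      let ?p = "\<lambda>x. 1 * p x + (- c) * 1"
      have P: "?p \<in> polys k" by (rule polys_lincomb[OF p one])
      have 11: "ip (\<lambda>x. 1) (\<lambda>x. 1) = 1" by (simp add: ip_def measure_\<mu>)
      have P1: "ip ?p (\<lambda>x. 1) = 0"
        unfolding ip_lincomb(1)[OF cp cont[OF one] cont[OF one]] pc 11 by simp
      have "ip ?p ?p = ip ?p p"
        using ip_lincomb(2)[OF cp cont[OF one] cont[OF P], of 1 "- c"] P1 by simp
      also have "\<dots> = ip p p - c\<^sup>2"
        unfolding ip_lincomb(1)[OF cp cont[OF one] cp] ip_commute[of "\<lambda>x. 1" p] pc by (simp add: power2_eq_square)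
      finally have "ip ?p ?p = ip p p - c\<^sup>2" .
      moreover have "E0 al a ?p ?p = E0 al a p p"
      proof -
        have "E0 al a (\<lambda>x. 1) g = 0" for g by (simp add: E0_def)
        then show ?thesis
          unfolding E0_linear(1)[OF polys_C2[OF p] polys_C2[OF one] polys_C2[OF P]]
            E0_linear(2)[OF polys_C2[OF p] polys_C2[OF one] polys_C2[OF p]] E0_commute[of p "\<lambda>x. 1"] by simp
      qed
      ultimately show ?thesis using poincare_polys[OF P P1] by (simp add: c_def)
    qed
    moreover have "a * (ip f f - (ip f (\<lambda>x. 1))\<^sup>2) = a * (ip p p - (ip f (\<lambda>x. 1))\<^sup>2) + a * ip r r"
      unfolding Pyth by (simp add: algebra_simps)
    moreover have "a * ip r r \<le> a * e\<^sup>2" using \<open>ip r r \<le> e\<^sup>2\<close> a_pos by (intro mult_left_mono) auto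
    ultimately show ?thesis using Ep by linarith
  qed
  show ?thesis unfolding ff f1
  proof (rule field_le_epsilon)
    fix d :: real assume d: "0 < d"
    \<comment> \<open>For \<open>e = sqrt (d / a)\<close> the excess \<open>a * e\<^sup>2\<close>
      equals \<open>d\<close>.\<close>
    have "(sqrt (d / a))\<^sup>2 = d / a" using d a_pos by simp
    moreover have "0 < sqrt (d / a)" using d a_pos by simp
    ultimately show "a * (ip f f - (ip f (\<lambda>x. 1))\<^sup>2) \<le> E0 al a f f + d"
      using approx[of "sqrt (d / a)"] a_pos by simp
  qed
qed

section \<open>The closed form and its semigroup\<close>

lemma C2_diff: "C2 f \<Longrightarrow> C2 g \<Longrightarrow> C2 (\<lambda>x::real^'n. f x - g x)"
  using C2_linear(1)[of f g 1 "- 1"] by simp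

lemma E0_diff:
  assumes "C2 f" "C2 g" "C2 h"
  shows "E0 al a (\<lambda>x. f x - g x) h = E0 al a f h - E0 al a g h"
    and "E0 al a h (\<lambda>x. f x - g x) = E0 al a h f - E0 al a h g"
  using E0_linear[OF assms, of 1 "- 1"] by simp_all

definition en :: "(real^'n \<Rightarrow> real) \<Rightarrow> real" where "en f = sqrt (E0 al a f f)"

lemma en_nonneg [simp]: "0 \<le> en f"
  by (simp add: en_def E0_nonneg)

lemma en_sq: "(en f)\<^sup>2 = E0 al a f f"
  by (simp add: en_def E0_nonneg)

lemma E0_cauchy_schwarz:
  assumes f: "C2 f" and g: "C2 g"
  shows "\<bar>E0 al a f g\<bar> \<le> en f * en g"
proof -
  have "(E0 al a f g)\<^sup>2 \<le> E0 al a f f * E0 al a g g"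
  proof (rule discriminant_bound)
    fix t
    let ?h = "\<lambda>x. 1 * f x + t * g x"
    have h: "C2 ?h" by (rule C2_linear(1)[OF f g])
    have "E0 al a ?h ?h = E0 al a f f + 2 * t * E0 al a f g + t\<^sup>2 * E0 al a g g"
      using E0_linear(1)[OF f g h, of 1 t] E0_linear(2)[OF f g f, of 1 t] E0_linear(2)[OF f g g, of 1 t]
      by (simp add: E0_commute[of g f] power2_eq_square algebra_simps)
    then show "0 \<le> E0 al a f f + 2 * t * E0 al a f g + t\<^sup>2 * E0 al a g g"
      using E0_nonneg[of ?h] by simp
  qed
  then have "(E0 al a f g)\<^sup>2 \<le> (en f * en g)\<^sup>2" by (simp add: power_mult_distrib en_sq)
  then show ?thesis by (simp add: abs_le_square_iff[symmetric])
qed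

lemma en_triangle:
  assumes f: "C2 f" and g: "C2 g"
  shows "en (\<lambda>x. f x - g x) \<le> en f + en g"
proof (rule power2_le_imp_le)
  have "E0 al a (\<lambda>x. f x - g x) (\<lambda>x. f x - g x) = E0 al a f f - 2 * E0 al a f g + E0 al a g g"
    unfolding E0_diff(1)[OF f g C2_diff[OF f g]] E0_diff(2)[OF f g f] E0_diff(2)[OF f g g]
    by (simp add: E0_commute[of g f])
  then show "(en (\<lambda>x. f x - g x))\<^sup>2 \<le> (en f + en g)\<^sup>2"
    using E0_cauchy_schwarz[OF f g] by (simp add: en_sq power2_sum)
qed simp

lemma en_le_add:
  assumes f: "C2 f" and g: "C2 g"
  shows "en f \<le> en (\<lambda>x. f x - g x) + en g"
proof (rule power2_le_imp_le)
  define h where "h = (\<lambda>x. f x - g x)"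
  have h: "C2 h" unfolding h_def by (rule C2_diff[OF f g])
  have hf: "f = (\<lambda>x. 1 * h x + 1 * g x)" by (auto simp: h_def)
  have "E0 al a f f = E0 al a h f + E0 al a g f"
    using E0_linear(1)[OF h g f, of 1 1] hf by simp
  moreover have "E0 al a h f = E0 al a h h + E0 al a h g"
    using E0_linear(2)[OF h g h, of 1 1] hf by simp
  moreover have "E0 al a g f = E0 al a h g + E0 al a g g"
    using E0_linear(2)[OF h g g, of 1 1] hf by (simp add: E0_commute[of g h])
  ultimately show "(en f)\<^sup>2 \<le> (en (\<lambda>x. f x - g x) + en g)\<^sup>2"
    unfolding h_def[symmetric] using E0_cauchy_schwarz[OF h g] by (simp add: en_sq power2_sum)
qed simp

definition en_Cauchy :: "(nat \<Rightarrow> real^'n \<Rightarrow> real) \<Rightarrow> bool" where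
  "en_Cauchy s \<longleftrightarrow> (\<forall>e>0. \<exists>N. \<forall>m\<ge>N. \<forall>n\<ge>N. en (\<lambda>x. s n x - s m x) < e)"

lemma approx_seq_iff:
  "approx_seq al a f s \<longleftrightarrow> (\<forall>n. C2 (s n)) \<and> (\<lambda>n. nrm2 \<mu> (\<lambda>x. s n x - f x)) \<longlonglongrightarrow> 0 \<and> en_Cauchy s"
proof -
  have "(\<forall>e>0. \<exists>M. \<forall>m\<ge>M. \<forall>n\<ge>M. E0 al a (\<lambda>x. s n x - s m x) (\<lambda>x. s n x - s m x) < e) \<longleftrightarrow> en_Cauchy s"
    (is "?L \<longleftrightarrow> _")
  proof
    assume L: ?L
    show "en_Cauchy s" unfolding en_Cauchy_def
    proof (intro allI impI)
      fix e :: real assume e: "0 < e"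
      then have "0 < e\<^sup>2" by simp
      with L obtain M where M: "\<forall>m\<ge>M. \<forall>n\<ge>M. E0 al a (\<lambda>x. s n x - s m x) (\<lambda>x. s n x - s m x) < e\<^sup>2" by blast
      then have "\<forall>m\<ge>M. \<forall>n\<ge>M. en (\<lambda>x. s n x - s m x) < e"
        unfolding en_sq[symmetric] using e by (meson less_imp_le power2_less_imp_less)
      then show "\<exists>N. \<forall>m\<ge>N. \<forall>n\<ge>N. en (\<lambda>x. s n x - s m x) < e" by blast
    qed
  next
    assume C: "en_Cauchy s"
    show ?L
    proof (intro allI impI)
      fix e :: real assume e: "0 < e"
      then have "0 < sqrt e" by simp
      with C obtain M where M: "\<forall>m\<ge>M. \<forall>n\<ge>M. en (\<lambda>x. s n x - s m x) < sqrt e" unfolding en_Cauchy_def by blast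
      then have "\<forall>m\<ge>M. \<forall>n\<ge>M. E0 al a (\<lambda>x. s n x - s m x) (\<lambda>x. s n x - s m x) < e"
        unfolding en_def real_sqrt_less_iff .
      then show "\<exists>M. \<forall>m\<ge>M. \<forall>n\<ge>M. E0 al a (\<lambda>x. s n x - s m x) (\<lambda>x. s n x - s m x) < e" by blast
    qed
  qed
  then show ?thesis unfolding approx_seq_def L2norm_eq_nrm2 by blast
qed

lemma en_Cauchy_bounded:
  assumes C: "\<And>n. C2 (s n)" and s: "en_Cauchy s"
  obtains B where "0 \<le> B" "\<And>n. en (s n) \<le> B"
proof -
  obtain N where N: "\<And>m n. N \<le> m \<Longrightarrow> N \<le> n \<Longrightarrow> en (\<lambda>x. s n x - s m x) < 1"
    using s unfolding en_Cauchy_def by (meson zero_less_one)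
  define B where "B = 1 + en (s N) + (\<Sum>k<N. en (s k))"
  show ?thesis
  proof
    have S: "0 \<le> (\<Sum>k<N. en (s k))" by (intro sum_nonneg) simp
    then show "0 \<le> B" unfolding B_def by (simp add: add_nonneg_nonneg)
    fix n
    show "en (s n) \<le> B"
    proof (cases "n < N")
      case True
      then have "en (s n) \<le> (\<Sum>k<N. en (s k))" by (intro member_le_sum) auto
      then show ?thesis unfolding B_def using en_nonneg[of "s N"] by linarith
    next
      case False
      then show ?thesis unfolding B_def using N[of N n] en_le_add[OF C C, of n N] S by simp
    qed
  qed
qed

lemma en_Cauchy_diff:
  assumes C: "\<And>n. C2 (s n)" "\<And>n. C2 (t n)" and s: "en_Cauchy s" and t: "en_Cauchy t"
  shows "en_Cauchy (\<lambda>n x. s n x - t n x)"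
  unfolding en_Cauchy_def
proof (intro allI impI)
  fix e :: real assume "0 < e"
  then have e: "0 < e / 2" by simp
  obtain N where N: "\<And>m n. N \<le> m \<Longrightarrow> N \<le> n \<Longrightarrow> en (\<lambda>x. s n x - s m x) < e / 2"
    using s e unfolding en_Cauchy_def by meson
  obtain K where K: "\<And>m n. K \<le> m \<Longrightarrow> K \<le> n \<Longrightarrow> en (\<lambda>x. t n x - t m x) < e / 2"
    using t e unfolding en_Cauchy_def by meson
  have "en (\<lambda>x. (s n x - t n x) - (s m x - t m x)) < e" if "max N K \<le> m" "max N K \<le> n" for m n
  proof -
    have "en (\<lambda>x. (s n x - s m x) - (t n x - t m x)) \<le> en (\<lambda>x. s n x - s m x) + en (\<lambda>x. t n x - t m x)"
      by (intro en_triangle C2_diff C)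
    also have "\<dots> < e" using N[of m n] K[of m n] that by simp
    also have "(\<lambda>x. (s n x - s m x) - (t n x - t m x)) = (\<lambda>x. (s n x - t n x) - (s m x - t m x))"
      by (auto simp: algebra_simps)
    finally show ?thesis .
  qed
  then show "\<exists>N. \<forall>m\<ge>N. \<forall>n\<ge>N. en (\<lambda>x. (s n x - t n x) - (s m x - t m x)) < e" by blast
qed

text \<open>The energy of \<open>g n\<close> is \<open>E0\<close> of \<open>g n\<close> with
  \<open>g n - g m\<close> plus \<open>E0\<close> of \<open>g n\<close> with \<open>g m\<close>. The
  first term is small since \<open>g\<close> is Cauchy and bounded in energy. The second is, up to
  sign, the inner product of \<open>g m\<close> with \<open>Lop al a (g n)\<close>, which tends to 0
  as \<open>m\<close> grows with \<open>n\<close> fixed.\<close>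

lemma closable:
  assumes C: "\<And>n. C2 (g n)" and g: "en_Cauchy g" and lim: "(\<lambda>n. nrm2 \<mu> (g n)) \<longlonglongrightarrow> 0"
  shows "(\<lambda>n. en (g n)) \<longlonglongrightarrow> 0"
proof -
  obtain B where B: "0 \<le> B" "\<And>n. en (g n) \<le> B" using en_Cauchy_bounded[OF C g] by blast
  have "(\<lambda>n. E0 al a (g n) (g n)) \<longlonglongrightarrow> 0"
  proof (rule LIMSEQ_I)
    fix e :: real assume e: "0 < e"
    define d where "d = e / 2 / (B + 1)"
    have B1: "B + 1 \<noteq> 0" "0 < B + 1" using B by auto
    have d: "0 < d" using e B1 by (simp add: d_def)
    have cancel: "x * (y / x) = y" if "x \<noteq> 0" for x y :: real using that by simp
    have Bd: "(B + 1) * d = e / 2" unfolding d_def by (rule cancel[OF B1(1)])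
    obtain N where N: "\<And>m n. N \<le> m \<Longrightarrow> N \<le> n \<Longrightarrow> en (\<lambda>x. g n x - g m x) < d"
      using g d unfolding en_Cauchy_def by meson
    have "E0 al a (g n) (g n) \<le> B * d" if n: "N \<le> n" for n
    proof -
      have "(\<lambda>m. B * d + nrm2 \<mu> (g m) * nrm2 \<mu> (Lop al a (g n))) \<longlonglongrightarrow> B * d + 0 * nrm2 \<mu> (Lop al a (g n))"
        by (intro tendsto_intros lim)
      moreover have "E0 al a (g n) (g n) \<le> B * d + nrm2 \<mu> (g m) * nrm2 \<mu> (Lop al a (g n))" if m: "N \<le> m" for m
      proof -
        have "E0 al a (g n) (g n) = E0 al a (g n) (\<lambda>x. g n x - g m x) + E0 al a (g n) (g m)"
          using E0_diff(2)[OF C C C, of n n m] by simp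
        moreover have "E0 al a (g n) (\<lambda>x. g n x - g m x) \<le> en (g n) * en (\<lambda>x. g n x - g m x)"
          using E0_cauchy_schwarz[OF C C2_diff[OF C C], of n n m] by simp
        moreover have "\<dots> \<le> B * d" using B N[OF m n] by (intro mult_mono) auto
        moreover have "E0 al a (g n) (g m) = - ip (g m) (Lop al a (g n))"
          using ip_Lop[OF C C, of m n] by (simp add: E0_commute[of "g n"])
        moreover have "\<bar>ip (g m) (Lop al a (g n))\<bar> \<le> nrm2 \<mu> (g m) * nrm2 \<mu> (Lop al a (g n))"
          unfolding ip_def by (intro cauchy_schwarz_L2 sqint_continuous C2_continuous(1) Lop_continuous C)
        ultimately show ?thesis by linarith
      qed
      ultimately have "E0 al a (g n) (g n) \<le> B * d + 0 * nrm2 \<mu> (Lop al a (g n))"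
        by (intro LIMSEQ_le_const[of _ _ "E0 al a (g n) (g n)"]) auto
      then show ?thesis by simp
    qed
    moreover have "B * d < e"
    proof -
      have "B * d \<le> (B + 1) * d" using d by (intro mult_right_mono) auto
      also have "\<dots> = e / 2" by (rule Bd)
      also have "\<dots> < e" using e by simp
      finally show ?thesis .
    qed
    ultimately have "E0 al a (g n) (g n) < e" if "N \<le> n" for n
      using that le_less_trans by blast
    then have "\<forall>n\<ge>N. norm (E0 al a (g n) (g n) - 0) < e"
      using E0_nonneg by simp
    then show "\<exists>N. \<forall>n\<ge>N. norm (E0 al a (g n) (g n) - 0) < e" by blast
  qed
  from tendsto_real_sqrt[OF this] show ?thesis by (simp add: en_def)
qed

lemma E0_diff_bound:
  assumes "C2 s" "C2 s'" "C2 t" "C2 t'"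
  shows "\<bar>E0 al a s t - E0 al a s' t'\<bar> \<le> en (\<lambda>x. s x - s' x) * en t + en s' * en (\<lambda>x. t x - t' x)"
proof -
  have "E0 al a s t - E0 al a s' t' = E0 al a (\<lambda>x. s x - s' x) t + E0 al a s' (\<lambda>x. t x - t' x)"
    using assms by (simp add: E0_diff)
  moreover have "\<bar>E0 al a (\<lambda>x. s x - s' x) t\<bar> \<le> en (\<lambda>x. s x - s' x) * en t"
    "\<bar>E0 al a s' (\<lambda>x. t x - t' x)\<bar> \<le> en s' * en (\<lambda>x. t x - t' x)"
    by (intro E0_cauchy_schwarz C2_diff assms)+
  ultimately show ?thesis by linarith
qed

text \<open>The difference of two approximating sequences is Cauchy in energy and tends to 0 in L2,
  so \<open>closable\<close> applies. This is what makes \<open>energy\<close> independent of the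
  chosen sequences.\<close>

lemma approx_seqs_equiv:
  assumes f: "sqint \<mu> f" and s: "approx_seq al a f s" and s': "approx_seq al a f s'"
  shows "(\<lambda>n. en (\<lambda>x. s n x - s' n x)) \<longlonglongrightarrow> 0"
proof -
  note s = s[unfolded approx_seq_iff] and s' = s'[unfolded approx_seq_iff]
  have C: "C2 (s n)" "C2 (s' n)" for n using s s' by auto
  have sq: "sqint \<mu> (s n)" "sqint \<mu> (s' n)" for n by (intro sqint_continuous C2_continuous(1) C)+
  show ?thesis
  proof (rule closable)
    show "C2 (\<lambda>x. s n x - s' n x)" for n by (intro C2_diff C)
    show "en_Cauchy (\<lambda>n x. s n x - s' n x)" by (intro en_Cauchy_diff C) (use s s' in auto)
    have lim: "(\<lambda>n. nrm2 \<mu> (\<lambda>x. s n x - f x) + nrm2 \<mu> (\<lambda>x. s' n x - f x)) \<longlonglongrightarrow> 0 + 0"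
      by (intro tendsto_add) (use s s' in auto)
    have "nrm2 \<mu> (\<lambda>x. s n x - s' n x) \<le> nrm2 \<mu> (\<lambda>x. s n x - f x) + nrm2 \<mu> (\<lambda>x. s' n x - f x)" for n
      using nrm2_triangle_diff[OF sq(1) f sq(2), of n n] by (simp add: nrm2_commute[of \<mu> f])
    then show "(\<lambda>n. nrm2 \<mu> (\<lambda>x. s n x - s' n x)) \<longlonglongrightarrow> 0"
      by (intro Lim_null_comparison[OF _ lim[simplified]]) auto
  qed
qed

text \<open>\<open>energy\<close> is a \<open>lim\<close> along sequences picked by
  \<open>SOME\<close>; after this lemma any approximating sequences may be used. The values along
  the chosen sequences converge because they are Cauchy, and other sequences differ by a null
  sequence.\<close>

lemma energy_LIMSEQ:
  assumes f: "sqint \<mu> f" and g: "sqint \<mu> g" and s: "approx_seq al a f s" and t: "approx_seq al a g t"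
  shows "(\<lambda>n. E0 al a (s n) (t n)) \<longlonglongrightarrow> energy al a f g"
proof -
  define s' where "s' = (SOME s. approx_seq al a f s)"
  define t' where "t' = (SOME t. approx_seq al a g t)"
  have s': "approx_seq al a f s'" unfolding s'_def by (rule someI[of "approx_seq al a f", OF s])
  have t': "approx_seq al a g t'" unfolding t'_def by (rule someI[of "approx_seq al a g", OF t])
  have C: "C2 (s n)" "C2 (t n)" "C2 (s' n)" "C2 (t' n)" for n using s t s' t' by (auto simp: approx_seq_iff)
  have Cy: "en_Cauchy s" "en_Cauchy t" "en_Cauchy s'" "en_Cauchy t'" using s t s' t' by (auto simp: approx_seq_iff)
  obtain A where A: "0 \<le> A" "\<And>n. en (s' n) \<le> A" using en_Cauchy_bounded[OF C(3) Cy(3)] by blast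
  obtain B where B: "0 \<le> B" "\<And>n. en (t n) \<le> B" using en_Cauchy_bounded[OF C(2) Cy(2)] by blast
  obtain B' where B': "0 \<le> B'" "\<And>n. en (t' n) \<le> B'" using en_Cauchy_bounded[OF C(4) Cy(4)] by blast
  have "Cauchy (\<lambda>n. E0 al a (s' n) (t' n))"
  proof (rule CauchyI)
    fix e :: real assume e: "0 < e"
    define d where "d = e / (A + B' + 1)"
    have d: "0 < d" "(A + B' + 1) * d = e" using e A B' by (simp_all add: d_def)
    obtain N where N: "\<And>m n. N \<le> m \<Longrightarrow> N \<le> n \<Longrightarrow> en (\<lambda>x. s' n x - s' m x) < d"
      using Cy(3) d(1) unfolding en_Cauchy_def by meson
    obtain K where K: "\<And>m n. K \<le> m \<Longrightarrow> K \<le> n \<Longrightarrow> en (\<lambda>x. t' n x - t' m x) < d"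
      using Cy(4) d(1) unfolding en_Cauchy_def by meson
    have "norm (E0 al a (s' m) (t' m) - E0 al a (s' n) (t' n)) < e" if "max N K \<le> m" "max N K \<le> n" for m n
    proof -
      have "\<bar>E0 al a (s' m) (t' m) - E0 al a (s' n) (t' n)\<bar>
          \<le> en (\<lambda>x. s' m x - s' n x) * en (t' m) + en (s' n) * en (\<lambda>x. t' m x - t' n x)"
        by (intro E0_diff_bound C)
      also have "\<dots> \<le> d * B' + A * d"
        using N[of n m] K[of n m] that A B' d(1) by (intro add_mono mult_mono) auto
      also have "\<dots> < (A + B' + 1) * d" using d(1) by (simp add: algebra_simps)
      also have "\<dots> = e" by (rule d)
      finally show ?thesis by simp
    qed
    then show "\<exists>M. \<forall>m\<ge>M. \<forall>n\<ge>M. norm (E0 al a (s' m) (t' m) - E0 al a (s' n) (t' n)) < e" by blast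
  qed
  then have "convergent (\<lambda>n. E0 al a (s' n) (t' n))" by (simp add: Cauchy_convergent_iff)
  then have lim': "(\<lambda>n. E0 al a (s' n) (t' n)) \<longlonglongrightarrow> energy al a f g"
    unfolding energy_def s'_def[symmetric] t'_def[symmetric] by (simp add: convergent_LIMSEQ_iff)
  have "(\<lambda>n. E0 al a (s n) (t n) - E0 al a (s' n) (t' n)) \<longlonglongrightarrow> 0"
  proof (rule Lim_null_comparison)
    show "\<forall>\<^sub>F n in sequentially. norm (E0 al a (s n) (t n) - E0 al a (s' n) (t' n))
        \<le> en (\<lambda>x. s n x - s' n x) * B + A * en (\<lambda>x. t n x - t' n x)"
    proof (intro always_eventually allI)
      fix n
      have "\<bar>E0 al a (s n) (t n) - E0 al a (s' n) (t' n)\<bar>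
          \<le> en (\<lambda>x. s n x - s' n x) * en (t n) + en (s' n) * en (\<lambda>x. t n x - t' n x)"
        by (intro E0_diff_bound C)
      also have "\<dots> \<le> en (\<lambda>x. s n x - s' n x) * B + A * en (\<lambda>x. t n x - t' n x)"
        using A B by (intro add_mono mult_mono) auto
      finally show "norm (E0 al a (s n) (t n) - E0 al a (s' n) (t' n))
        \<le> en (\<lambda>x. s n x - s' n x) * B + A * en (\<lambda>x. t n x - t' n x)" by simp
    qed
    have "(\<lambda>n. en (\<lambda>x. s n x - s' n x) * B + A * en (\<lambda>x. t n x - t' n x)) \<longlonglongrightarrow> 0 * B + A * 0"
      by (intro tendsto_intros approx_seqs_equiv[OF f s s'] approx_seqs_equiv[OF g t t'])
    then show "(\<lambda>n. en (\<lambda>x. s n x - s' n x) * B + A * en (\<lambda>x. t n x - t' n x)) \<longlonglongrightarrow> 0" by simp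
  qed
  from tendsto_add[OF this lim'] show ?thesis by simp
qed

section \<open>The domain of the closed form and its generator\<close>

lemma domE_sqint: "domE al a f \<Longrightarrow> sqint \<mu> f"
  by (simp add: domE_def L2_iff_sqint)

lemma energy_commute: "energy al a f g = energy al a g f"
  unfolding energy_def by (simp add: E0_commute)

lemma approx_seq_const: "C2 f \<Longrightarrow> approx_seq al a f (\<lambda>n. f)"
  by (simp add: approx_seq_iff en_Cauchy_def nrm2_def en_def E0_def)

lemma domE_C2: "C2 f \<Longrightarrow> domE al a f"
  unfolding domE_def L2_iff_sqint using approx_seq_const sqint_continuous C2_continuous(1) by blast

lemma energy_C2:
  assumes "C2 f" shows "energy al a f f = E0 al a f f"
  using energy_LIMSEQ[OF domE_sqint[OF domE_C2[OF assms]] domE_sqint[OF domE_C2[OF assms]]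
      approx_seq_const[OF assms] approx_seq_const[OF assms]]
  by (simp add: LIMSEQ_const_iff)

lemma sqint_one: "sqint \<mu> (\<lambda>x. 1)"
  by (simp add: sqint_def)

theorem poincare_domE:
  assumes f: "domE al a f"
  shows "a * ((\<integral>x. (f x)\<^sup>2 \<partial>\<mu>) - (\<integral>x. f x \<partial>\<mu>)\<^sup>2) \<le> energy al a f f"
proof -
  obtain s where s: "approx_seq al a f s" using f by (auto simp: domE_def)
  note sq = domE_sqint[OF f]
  have C: "C2 (s n)" for n using s by (auto simp: approx_seq_iff)
  have sqs: "sqint \<mu> (s n)" for n by (intro sqint_continuous C2_continuous(1) C)
  have lim: "(\<lambda>n. nrm2 \<mu> (\<lambda>x. s n x - f x)) \<longlonglongrightarrow> 0" using s by (auto simp: approx_seq_iff)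
  have "(\<lambda>n. \<integral>x. s n x * s n x \<partial>\<mu>) \<longlonglongrightarrow> (\<integral>x. f x * f x \<partial>\<mu>)"
    by (rule tendsto_ip_L2[OF sqs sq sqs sq lim lim])
  moreover have "(\<lambda>n. \<integral>x. s n x * 1 \<partial>\<mu>) \<longlonglongrightarrow> (\<integral>x. f x * 1 \<partial>\<mu>)"
    by (rule tendsto_ip_L2[OF sqs sq sqint_one sqint_one lim]) (simp add: nrm2_def)
  ultimately have "(\<lambda>n. a * ((\<integral>x. (s n x)\<^sup>2 \<partial>\<mu>) - (\<integral>x. s n x \<partial>\<mu>)\<^sup>2)) \<longlonglongrightarrow> a * ((\<integral>x. (f x)\<^sup>2 \<partial>\<mu>) - (\<integral>x. f x \<partial>\<mu>)\<^sup>2)"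
    by (intro tendsto_intros) (simp_all add: power2_eq_square)
  moreover note energy_LIMSEQ[OF sq sq s s]
  ultimately show ?thesis
    by (rule LIMSEQ_le) (use poincare_C2[OF C] in blast)
qed

text \<open>With \<open>f\<close> approximated by the constant sequence, integration by parts passes
  to the limit in the other argument.\<close>

lemma form_generator_C2:
  assumes f: "C2 f"
  shows "form_generator al a f (Lop al a f)"
  unfolding form_generator_def
proof (intro conjI allI impI)
  show "domE al a f" by (rule domE_C2[OF f])
  have L: "sqint \<mu> (Lop al a f)" by (intro sqint_continuous Lop_continuous f)
  then show "L2 al a (Lop al a f)" by (simp add: L2_iff_sqint)
  fix g assume g: "domE al a g"
  obtain t where t: "approx_seq al a g t" using g by (auto simp: domE_def)
  have C: "C2 (t n)" for n using t by (auto simp: approx_seq_iff)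
  have sqt: "sqint \<mu> (t n)" for n by (intro sqint_continuous C2_continuous(1) C)
  have lim: "(\<lambda>n. nrm2 \<mu> (\<lambda>x. t n x - g x)) \<longlonglongrightarrow> 0" using t by (auto simp: approx_seq_iff)
  have "(\<lambda>n. E0 al a f (t n)) \<longlonglongrightarrow> energy al a f g"
    by (rule energy_LIMSEQ[OF domE_sqint[OF domE_C2[OF f]] domE_sqint[OF g] approx_seq_const[OF f] t])
  moreover have "E0 al a f (t n) = - (\<integral>x. Lop al a f x * t n x \<partial>\<mu>)" for n
    using ip_Lop[OF C f, of n] by (simp add: E0_commute[of f] ip_def mult.commute)
  moreover have "(\<lambda>n. \<integral>x. Lop al a f x * t n x \<partial>\<mu>) \<longlonglongrightarrow> (\<integral>x. Lop al a f x * g x \<partial>\<mu>)"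
    by (rule tendsto_ip_L2[OF L L sqt domE_sqint[OF g] _ lim]) (simp add: nrm2_def)
  from tendsto_minus[OF this] have "(\<lambda>n. - (\<integral>x. Lop al a f x * t n x \<partial>\<mu>)) \<longlonglongrightarrow> - (\<integral>x. Lop al a f x * g x \<partial>\<mu>)" .
  ultimately show "energy al a f g = - (\<integral>x. Lop al a f x * g x \<partial>\<mu>)"
    using LIMSEQ_unique by simp
qed

text \<open>A Lebesgue measurable function is an a.e. limit of continuous \<open>g n\<close>, with
  no control of their size. Truncation at level \<open>M\<close>, by \<open>cl\<close>, makes
  dominated convergence available on a finite measure: first \<open>f\<close> is replaced by its
  truncation, then this by the truncation of some \<open>g n\<close>, which is continuous.\<close>

lemma continuous_dense_L2:
  assumes f: "sqint \<mu> f" and e: "0 < e"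
  obtains g where "continuous_on UNIV g" "nrm2 \<mu> (\<lambda>x. f x - g x) < e"
proof -
  have fm: "f \<in> borel_measurable borel" using f by (simp add: L2_iff_sqint[symmetric] L2_def)
  note [measurable] = fm
  have "f \<in> borel_measurable lebesgue" using fm by (intro measurable_completion) simp
  then have "f measurable_on UNIV" by (intro lebesgue_measurable_imp_measurable_on) auto
  then obtain N g where N: "negligible N" and g: "\<And>n. continuous_on UNIV (g n)"
    and lim: "\<And>x. x \<notin> N \<Longrightarrow> (\<lambda>n. g n x) \<longlonglongrightarrow> f x"
    by (auto simp: measurable_on_def)
  have "AE x in lebesgue. x \<notin> N" using N by (simp add: negligible_iff_null_sets AE_not_in)
  then have "AE x in lborel. x \<notin> N" by (simp add: AE_completion_iff)
  then have N\<mu>: "AE x in \<mu>. x \<notin> N" unfolding dirichlet_def by (subst AE_density) (auto elim: eventually_mono)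
  define cl where "cl M y = max (- M) (min M y)" for M y :: real
  have cl_abs: "\<bar>cl M y\<bar> \<le> M" if "0 \<le> M" for M y using that by (auto simp: cl_def)
  have [measurable]: "cl M \<in> borel_measurable borel" for M unfolding cl_def by measurable
  have fM: "(\<lambda>M. \<integral>x. (f x - cl (real M) (f x))\<^sup>2 \<partial>\<mu>) \<longlonglongrightarrow> (\<integral>x. 0 \<partial>\<mu>)"
  proof (rule integral_dominated_convergence)
    show "integrable \<mu> (\<lambda>x. (f x)\<^sup>2)" using f by (simp add: sqint_def)
    show "AE x in \<mu>. (\<lambda>M. (f x - cl (real M) (f x))\<^sup>2) \<longlonglongrightarrow> 0"
    proof (intro AE_I2 tendsto_eventually)
      fix x
      obtain M0 :: nat where M0: "\<bar>f x\<bar> < real M0" using reals_Archimedean2 by blast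
      show "\<forall>\<^sub>F M in sequentially. (f x - cl (real M) (f x))\<^sup>2 = 0"
        using eventually_ge_at_top[of M0]
      proof eventually_elim
        case (elim M)
        then have "real M0 \<le> real M" by simp
        with M0 have "\<bar>f x\<bar> \<le> real M" by linarith
        then show ?case by (auto simp: cl_def)
      qed
    qed
    have "\<bar>f x - cl (real M) (f x)\<bar> \<le> \<bar>f x\<bar>" for M x by (auto simp: cl_def)
    then show "AE x in \<mu>. norm ((f x - cl (real M) (f x))\<^sup>2) \<le> (f x)\<^sup>2" for M
      by (simp add: abs_le_square_iff[symmetric])
  qed measurable
  then have "(\<lambda>M. nrm2 \<mu> (\<lambda>x. f x - cl (real M) (f x))) \<longlonglongrightarrow> 0"
    unfolding nrm2_def using tendsto_real_sqrt by fastforce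
  then have "\<forall>\<^sub>F M in sequentially. nrm2 \<mu> (\<lambda>x. f x - cl (real M) (f x)) < e / 2"
    using e by (intro order_tendstoD(2)) auto
  then obtain M where M: "nrm2 \<mu> (\<lambda>x. f x - cl (real M) (f x)) < e / 2"
    by (auto simp: eventually_sequentially)
  have gm [measurable]: "g n \<in> borel_measurable borel" for n by (intro borel_measurable_continuous_onI g)
  have gn: "(\<lambda>n. \<integral>x. (cl (real M) (f x) - cl (real M) (g n x))\<^sup>2 \<partial>\<mu>) \<longlonglongrightarrow> (\<integral>x. 0 \<partial>\<mu>)"
  proof (rule integral_dominated_convergence)
    show "integrable \<mu> (\<lambda>x. (2 * real M)\<^sup>2)" by simp
    show "AE x in \<mu>. (\<lambda>n. (cl (real M) (f x) - cl (real M) (g n x))\<^sup>2) \<longlonglongrightarrow> 0"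
      using N\<mu>
    proof eventually_elim
      case (elim x)
      have "(\<lambda>n. (cl (real M) (f x) - cl (real M) (g n x))\<^sup>2) \<longlonglongrightarrow> (cl (real M) (f x) - cl (real M) (f x))\<^sup>2"
        unfolding cl_def by (intro tendsto_intros lim elim)
      then show ?case by simp
    qed
    have "\<bar>cl (real M) u - cl (real M) v\<bar> \<le> \<bar>2 * real M\<bar>" for u v
      using cl_abs[of "real M" u] cl_abs[of "real M" v] by linarith
    then show "AE x in \<mu>. norm ((cl (real M) (f x) - cl (real M) (g n x))\<^sup>2) \<le> (2 * real M)\<^sup>2" for n
      by (simp only: abs_le_square_iff norm_power real_norm_def power2_abs) simp
  qed measurable
  then have "(\<lambda>n. nrm2 \<mu> (\<lambda>x. cl (real M) (f x) - cl (real M) (g n x))) \<longlonglongrightarrow> 0"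
    unfolding nrm2_def using tendsto_real_sqrt by fastforce
  then have "\<forall>\<^sub>F n in sequentially. nrm2 \<mu> (\<lambda>x. cl (real M) (f x) - cl (real M) (g n x)) < e / 2"
    using e by (intro order_tendstoD(2)) auto
  then obtain n where n: "nrm2 \<mu> (\<lambda>x. cl (real M) (f x) - cl (real M) (g n x)) < e / 2"
    by (auto simp: eventually_sequentially)
  have cg: "continuous_on UNIV (\<lambda>x. cl (real M) (g n x))" unfolding cl_def by (intro continuous_intros g)
  have sqc: "sqint \<mu> (\<lambda>x. cl (real M) (f x))"
  proof -
    have "integrable \<mu> (\<lambda>x. (cl (real M) (f x))\<^sup>2)"
    proof (rule integrable_const_bound)
      have "\<bar>cl (real M) u\<bar> \<le> \<bar>real M\<bar>" for u using cl_abs[of "real M" u] by simp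
      then show "AE x in \<mu>. norm ((cl (real M) (f x))\<^sup>2) \<le> (real M)\<^sup>2"
        by (simp only: abs_le_square_iff norm_power real_norm_def power2_abs) simp
    qed measurable
    then show ?thesis by (simp add: sqint_def)
  qed
  have "nrm2 \<mu> (\<lambda>x. f x - cl (real M) (g n x)) < e"
    using nrm2_triangle_diff[OF f sqc sqint_continuous[OF cg]] M n by linarith
  with cg that show ?thesis by blast
qed

lemma form_generator_dense:
  assumes f: "sqint \<mu> f" and e: "0 < e"
  shows "\<exists>g h. form_generator al a g h \<and> nrm2 \<mu> (\<lambda>x. f x - g x) < e"
proof -
  have "0 < e / 2" using e by simp
  then obtain g where g: "continuous_on UNIV g" "nrm2 \<mu> (\<lambda>x. f x - g x) < e / 2"
    using continuous_dense_L2[OF f] by blast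
  obtain k p where p: "p \<in> polys k" "nrm2 \<mu> (\<lambda>x. g x - p x) \<le> e / 2"
    using polys_dense_continuous[OF g(1) \<open>0 < e / 2\<close>] by blast
  have "nrm2 \<mu> (\<lambda>x. f x - p x) < e"
    using nrm2_triangle_diff[OF f sqint_continuous[OF g(1)] sqint_continuous[OF polys_continuous[OF p(1)]]] g(2) p(2)
    by linarith
  with form_generator_C2[OF polys_C2[OF p(1)]] show ?thesis by blast
qed

text \<open>The facts on \<open>P\<close> are the conjuncts of \<open>form_semigroup\<close>. Those
  on the generator come from the form: symmetry of \<open>energy\<close> gives
  \<open>Gen_sym\<close>, and C2 functions give \<open>Gen_one\<close> and
  \<open>Gen_dense\<close>.\<close>

lemma L2_semigroup_form_semigroup:
  assumes "form_semigroup al a P"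
  shows "L2_semigroup \<mu> P (form_generator al a)"
proof -
  note P = assms[unfolded form_semigroup_def L2_iff_sqint L2norm_eq_nrm2]
  note P1 = conjunct1[OF P] and Q1 = conjunct2[OF P]
  note P2 = conjunct1[OF Q1] and Q2 = conjunct2[OF Q1]
  note P3 = conjunct1[OF Q2] and Q3 = conjunct2[OF Q2]
  note P4 = conjunct1[OF Q3] and Q4 = conjunct2[OF Q3]
  note P5 = conjunct1[OF Q4] and Q5 = conjunct2[OF Q4]
  note P6 = conjunct1[OF Q5] and P7 = conjunct2[OF Q5]
  show ?thesis
  proof (unfold_locales, goal_cases)
    case 1
    show ?case by (simp add: measure_\<mu>)
  next
    case (2 t f)
    then show ?case using P1 by blast
  next
    case (3 t f g c)
    then show ?case using P2 by blast
  next
    case (4 t)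
    then show ?case using P3 by blast
  next
    case (5 f)
    then show ?case using P4 by blast
  next
    case (6 s t f)
    then show ?case using P5 by blast
  next
    case (7 f)
    then show ?case using P6 by blast
  next
    case (8 f h)
    then show ?case using P7 by blast
  next
    case (9 f h)
    then show ?case by (simp add: form_generator_def L2_iff_sqint domE_sqint)
  next
    case (10 f h g k)
    then have "energy al a f g = - (\<integral>x. h x * g x \<partial>\<mu>)" "energy al a g f = - (\<integral>x. k x * f x \<partial>\<mu>)"
      unfolding form_generator_def by blast+
    then show ?case using energy_commute[of f g] by (simp add: mult.commute)
  next
    case 11
    have "Lop al a (\<lambda>x. 1) = (\<lambda>x. 0)" by (simp add: fun_eq_iff Lop_def)
    then show ?case using form_generator_C2[OF C2_const[of 1]] by simp
  next
    case (12 f e)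
    then show ?case by (rule form_generator_dense)
  qed
qed

text \<open>\<open>Lop\<close> sends the coordinate \<open>x $ i\<close> to
  \<open>al $ i * (1 - l1 x) - a * x $ i\<close>. After division by \<open>al $ i\<close> the term
  with \<open>1 - l1 x\<close> is the same for all \<open>i\<close> and cancels in a difference;
  this is where two distinct indices are needed.\<close>

lemma extremal_function:
  assumes "CARD('n) \<ge> 2"
  obtains f where "C2 f" "(\<integral>x. f x \<partial>\<mu>) = 0" "(\<integral>x. (f x)\<^sup>2 \<partial>\<mu>) = 1" "E0 al a f f = a"
proof -
  obtain i j :: 'n where ij: "i \<noteq> j"
    using assms by (metis (full_types) UNIV_eq_I card.empty card_insert_disjoint empty_iff finite.emptyI insert_iff not_numeral_le_zero numeral_le_one_iff One_nat_def semiring_norm(69))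
  define g where "g = (\<lambda>x::real^'n. (1 / al $ i) * x $ i + (- 1 / al $ j) * x $ j)"
  have gp: "g \<in> polys 1" unfolding g_def by (rule polys_lincomb[OF polys_component polys_component])
  note Cg = polys_C2[OF gp] and cg = polys_continuous[OF gp, of UNIV]
  have pdg: "pd l g = (\<lambda>x. (1 / al $ i) * (if l = i then 1 else 0) + (- 1 / al $ j) * (if l = j then 1 else 0))" for l
    unfolding g_def by (intro has_pd_imp_pd has_pd_add has_pd_cmult has_pd_component)
  have pdpdg: "pd l (pd l g) = (\<lambda>x. 0)" for l
    unfolding pdg by simp
  have Lg: "Lop al a g x = - a * g x" for x
  proof -
    have "Lop al a g x = (\<Sum>l\<in>UNIV. (al $ l * (1 - l1 x) - a * x $ l) * ((1 / al $ i) * (if l = i then 1 else 0) + (- 1 / al $ j) * (if l = j then 1 else 0)))"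
      by (simp add: Lop_def pdpdg) (simp add: pdg)
    also have "\<dots> = (\<Sum>l\<in>UNIV. if l = i then (al $ l * (1 - l1 x) - a * x $ l) / al $ i else 0)
        + (\<Sum>l\<in>UNIV. if l = j then (al $ l * (1 - l1 x) - a * x $ l) * (- 1 / al $ j) else 0)"
      unfolding sum.distrib[symmetric] using ij by (intro sum.cong) auto
    also have "\<dots> = (al $ i * (1 - l1 x) - a * x $ i) / al $ i + (al $ j * (1 - l1 x) - a * x $ j) * (- 1 / al $ j)"
      by simp
    also have "\<dots> = - a * g x" using al_pos[of i] al_pos[of j] by (simp add: g_def field_simps)
    finally show ?thesis .
  qed
  have ipL: "ip h (Lop al a g) = - a * ip h g" for h
    by (simp add: ip_def Lg mult.left_commute)
  \<comment> \<open>An eigenfunction with eigenvalue other than 0 is orthogonal to the constants, as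
    the form vanishes on them.\<close>
  have g1: "ip g (\<lambda>x. 1) = 0"
  proof -
    have "ip (\<lambda>x. 1) (Lop al a g) = - E0 al a (\<lambda>x. 1) g" by (rule ip_Lop[OF C2_const Cg])
    then have "a * ip (\<lambda>x. 1) g = 0" unfolding ipL by (simp add: E0_def)
    then show ?thesis using a_pos by (simp add: ip_commute)
  qed
  have Eg: "E0 al a g g = a * ip g g" using ip_Lop[OF Cg Cg] unfolding ipL by simp
  \<comment> \<open>A vanishing norm would make \<open>g\<close> zero on an open set, against its
    derivative \<open>1 / al $ i\<close> in direction \<open>i\<close>.\<close>
  have "ip g g \<noteq> 0"
  proof
    assume "ip g g = 0"
    then have z: "g x = 0" if "x \<in> usimplex" for x using ip_self_eq_0[OF cg _ that] by simp
    obtain x :: "real^'n" where x: "x \<in> usimplex" using \<mu>_usimplex_nonempty by blast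
    have "pd i g x = pd i (\<lambda>x. 0) x" by (rule pd_cong_open[OF open_usimplex x]) (rule z)
    then show False using ij al_pos[of i] by (simp add: pdg)
  qed
  moreover have "0 \<le> ip g g" by (simp add: ip_self)
  ultimately have pos: "0 < ip g g" by simp
  define c where "c = 1 / sqrt (ip g g)"
  have c: "c * c * ip g g = 1" using pos by (simp add: c_def)
  \<comment> \<open>The summand \<open>0 * g x\<close> puts the scalar multiple into the form of the
    lemmas on linear combinations.\<close>
  define f where "f = (\<lambda>x. c * g x + 0 * g x)"
  have f: "C2 f" unfolding f_def by (rule C2_linear(1)[OF Cg Cg])
  note cf = C2_continuous(1)[OF f]
  show ?thesis
  proof
    show "C2 f" by (rule f)
    have "ip f (\<lambda>x. 1) = c * ip g (\<lambda>x. 1) + 0 * ip g (\<lambda>x. 1)"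
      unfolding f_def by (rule ip_lincomb(1)[OF cg cg]) simp
    then show "(\<integral>x. f x \<partial>\<mu>) = 0" by (simp add: g1) (simp add: ip_def)
    have "ip f f = c * ip g f + 0 * ip g f" by (subst (1) f_def) (rule ip_lincomb(1)[OF cg cg cf])
    also have "ip g f = c * ip g g + 0 * ip g g" unfolding f_def by (rule ip_lincomb(2)[OF cg cg cg])
    finally have "ip f f = 1" using c by simp
    then show "(\<integral>x. (f x)\<^sup>2 \<partial>\<mu>) = 1" by (simp add: ip_def power2_eq_square)
    have "E0 al a f f = c * E0 al a g f + 0 * E0 al a g f" by (subst (1) f_def) (rule E0_linear(1)[OF Cg Cg f])
    also have "E0 al a g f = c * E0 al a g g + 0 * E0 al a g g" unfolding f_def by (rule E0_linear(2)[OF Cg Cg Cg])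
    finally have "E0 al a f f = a * (c * c * ip g g)" by (simp add: Eg)
    then show "E0 al a f f = a" unfolding c by simp
  qed
qed

end

theorem theorem2p1:
  fixes al :: "real^'n" and a :: real
  assumes N2: "CARD('n) \<ge> 2"
    and al_pos: "\<forall>i. al $ i > 0"
    and a_pos: "a > 0"
  shows
    \<comment> \<open>(i) symmetry of L on C^2, and symmetry of the associated semigroup\<close>
    "(\<forall>f g. C2 f \<longrightarrow> C2 g \<longrightarrow>
        (\<integral>x. f x * Lop al a g x \<partial>dirichlet al a) = (\<integral>x. g x * Lop al a f x \<partial>dirichlet al a))
     \<and> (\<forall>P. form_semigroup al a P \<longrightarrow>
        (\<forall>t\<ge>0. \<forall>f g. L2 al a f \<longrightarrow> L2 al a g \<longrightarrow>
           (\<integral>x. P t f x * g x \<partial>dirichlet al a) = (\<integral>x. f x * P t g x \<partial>dirichlet al a)))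
     \<comment> \<open>(ii) spectral gap\<close>
     \<and> Inf {energy al a f f | f. domE al a f \<and> (\<integral>x. f x \<partial>dirichlet al a) = 0
                                  \<and> (\<integral>x. (f x)\<^sup>2 \<partial>dirichlet al a) = 1} = a
     \<comment> \<open>(iii) exponential L^2 convergence (operator norm bound)\<close>
     \<and> (\<forall>P. form_semigroup al a P \<longrightarrow>
        (\<forall>t\<ge>0. \<forall>f. L2 al a f \<longrightarrow>
           L2norm al a (\<lambda>x. P t f x - (\<integral>y. f y \<partial>dirichlet al a)) \<le> exp (- a * t) * L2norm al a f))
     \<comment> \<open>(iv) Poincare inequality with sharp constant 1/a\<close>
     \<and> (\<forall>f. domE al a f \<longrightarrow> (\<integral>x. f x \<partial>dirichlet al a) = 0 \<longrightarrow>
           (\<integral>x. (f x)\<^sup>2 \<partial>dirichlet al a) \<le> (1 / a) * energy al a f f)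
     \<and> (\<forall>c. (\<forall>f. domE al a f \<longrightarrow> (\<integral>x. f x \<partial>dirichlet al a) = 0 \<longrightarrow>
              (\<integral>x. (f x)\<^sup>2 \<partial>dirichlet al a) \<le> c * energy al a f f) \<longrightarrow> 1 / a \<le> c)"
proof -
  interpret dirichlet_params al a
    by unfold_locales (use al_pos a_pos in auto)
  obtain f0 where f0: "C2 f0" "(\<integral>x. f0 x \<partial>\<mu>) = 0" "(\<integral>x. (f0 x)\<^sup>2 \<partial>\<mu>) = 1" "E0 al a f0 f0 = a"
    using extremal_function[OF N2] by blast
  have sym: "(\<integral>x. f x * Lop al a g x \<partial>\<mu>) = (\<integral>x. g x * Lop al a f x \<partial>\<mu>)" if "C2 f" "C2 g" for f g
    using integration_by_parts[OF that] integration_by_parts[OF that(2,1)] by (simp add: E0_commute)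
  have Psym: "(\<integral>x. P t f x * g x \<partial>\<mu>) = (\<integral>x. f x * P t g x \<partial>\<mu>)"
    if P: "form_semigroup al a P" and t: "0 \<le> t" and "L2 al a f" "L2 al a g" for P t f g
  proof -
    interpret L2_semigroup \<mu> P "form_generator al a" by (rule L2_semigroup_form_semigroup[OF P])
    show ?thesis using that by (intro P_symmetric) (simp_all add: L2_iff_sqint)
  qed
  have Pdecay: "L2norm al a (\<lambda>x. P t f x - (\<integral>y. f y \<partial>\<mu>)) \<le> exp (- a * t) * L2norm al a f"
    if P: "form_semigroup al a P" and t: "0 \<le> t" and f: "L2 al a f" for P t f
  proof -
    interpret L2_semigroup \<mu> P "form_generator al a" by (rule L2_semigroup_form_semigroup[OF P])
    show ?thesis unfolding L2norm_eq_nrm2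
    proof (rule P_decay[OF _ a_pos t])
      fix f h assume G: "form_generator al a f h"
      then have "energy al a f f = - (\<integral>x. h x * f x \<partial>\<mu>)" "domE al a f" unfolding form_generator_def by blast+
      then show "(\<integral>x. h x * f x \<partial>\<mu>) \<le> - a * ((\<integral>x. (f x)\<^sup>2 \<partial>\<mu>) - (\<integral>x. f x \<partial>\<mu>)\<^sup>2)"
        using poincare_domE[of f] by simp
    qed (use f in \<open>simp add: L2_iff_sqint\<close>)
  qed
  have gap: "a * (\<integral>x. (f x)\<^sup>2 \<partial>\<mu>) \<le> energy al a f f" if "domE al a f" "(\<integral>x. f x \<partial>\<mu>) = 0" for f
    using poincare_domE[OF that(1)] that(2) by simp
  have f0E: "domE al a f0" "energy al a f0 f0 = a" using domE_C2[OF f0(1)] energy_C2[OF f0(1)] f0(4) by auto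
  \<comment> \<open>A minimum, attained at \<open>f0\<close>; so the value does not rest on a
    convention for \<open>Inf\<close> of an empty or unbounded set.\<close>
  have inf: "Inf {energy al a f f | f. domE al a f \<and> (\<integral>x. f x \<partial>\<mu>) = 0 \<and> (\<integral>x. (f x)\<^sup>2 \<partial>\<mu>) = 1} = a"
  proof (rule cInf_eq_minimum)
    show "a \<in> {energy al a f f | f. domE al a f \<and> (\<integral>x. f x \<partial>\<mu>) = 0 \<and> (\<integral>x. (f x)\<^sup>2 \<partial>\<mu>) = 1}"
      using f0 f0E by (intro CollectI exI[of _ f0]) simp
    fix z assume "z \<in> {energy al a f f | f. domE al a f \<and> (\<integral>x. f x \<partial>\<mu>) = 0 \<and> (\<integral>x. (f x)\<^sup>2 \<partial>\<mu>) = 1}"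
    then obtain f where "z = energy al a f f" "domE al a f" "(\<integral>x. f x \<partial>\<mu>) = 0" "(\<integral>x. (f x)\<^sup>2 \<partial>\<mu>) = 1" by blast
    then show "a \<le> z" using gap[of f] by simp
  qed
  have poinc: "(\<integral>x. (f x)\<^sup>2 \<partial>\<mu>) \<le> (1 / a) * energy al a f f" if "domE al a f" "(\<integral>x. f x \<partial>\<mu>) = 0" for f
    using gap[OF that] a_pos by (simp add: field_simps)
  have sharp: "1 / a \<le> c"
    if "\<forall>f. domE al a f \<longrightarrow> (\<integral>x. f x \<partial>\<mu>) = 0 \<longrightarrow> (\<integral>x. (f x)\<^sup>2 \<partial>\<mu>) \<le> c * energy al a f f" for c
  proof -
    have "(\<integral>x. (f0 x)\<^sup>2 \<partial>\<mu>) \<le> c * energy al a f0 f0" using that f0E(1) f0(2) by blast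
    then show ?thesis using a_pos unfolding f0(3) f0E(2) by (simp add: field_simps)
  qed
  from sym Psym inf Pdecay poinc sharp show ?thesis by blast
qed

end
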